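(* Let $\boldsymbol u$ be a smooth divergence-free velocity field on $V\times[0,\infty)$ satisfying the no-penetration condition $\boldsymbol u\cdot\boldsymbol e_z=0$ on $z=0,1$. Let $T$ be a smooth solution on $[0,\infty)$ of the temperature equation $$\partial_tT+\nabla\cdot(\boldsymbol uT)=\frac1{Pe}\nabla^2T+\frac{Q}{Pe}$$ with homogeneous isothermal boundary conditions $T=0$ on $z=0,1$. Suppose that $Q\in H^1$ is time independent and that $$ U_\infty\,Pe<\frac{\pi}{\sqrt{1+\pi^2}} . $$ Then $$ \limsup_{t\to\infty}\|\nabla^2_{x,y}\overline T(t)\|_{L^\infty_zL^2_{x,y}}\ \le\ R_2:=\frac{U_\infty\,Pe\,\|Q\|_{H^1}}{\pi-\sqrt{1+\pi^2}\,U_\infty\,Pe}+\|Q\|_{L^2}. $$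
   Context: Domain: $V=[0,L_x]\times[0,L_y]\times[0,1]$ with $L_x,L_y>0$; all fields are periodic in $x$ and $y$. $Pe>0$. Norms are over $V$ unless indicated, and $\|f\|_{H^1}^2=\|f\|_{L^2}^2+\|\nabla f\|_{L^2}^2$. $\overline T(x,y,z)=\int_0^zT(x,y,z')\,\mathrm dz'$; $\nabla^2_{x,y}=\partial_x^2+\partial_y^2$; $\|f\|_{L^\infty_zL^2_{x,y}}=\sup_{z\in[0,1]}\left(\int|f(x,y,z)|^2\,\mathrm dx\,\mathrm dy\right)^{1/2}$. $$U_\infty=C_{\mathrm S,0}\limsup_{t\to\infty}\|\boldsymbol u\|_{L^3}+C_\infty\limsup_{t\to\infty}\|\nabla\boldsymbol u\|_{L^2},$$ where $C_\infty$ and $C_{\mathrm S,0}$ are positive Sobolev–elliptic constants (depending only on $L_x,L_y$) such that $$\|\nabla T\|_{L^\infty}\le C_\infty\|\nabla^2T\|_{H^1},\qquad\|\nabla\nabla T\|_{L^6}\le C_{\mathrm S,0}\|\nabla^2T\|_{H^1}$$ for all $T\in H^3(V)$ periodic in $x,y$ with $T=0$ on $z=0,1$ ($\nabla^2$ is the Laplacian, $\nabla\nabla T$ the Hessian). *)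

theory Defs
  imports "HOL-Analysis.Analysis" "HOL-Probability.Essential_Supremum"
begin

text \<open>
  A field that is periodic in x and y is a function on the whole slab R x R x [0,1] (its values
  outside the slab are irrelevant); norms are taken over the period cell V.  All norms are
  extended nonnegative reals, so that infinite norms and infinite limits superior are not
  silently replaced by a real default value.
\<close>

definition slab :: "(real^3) set"
  where "slab = {x. 0 \<le> x $ 3 \<and> x $ 3 \<le> 1}"

definition open_slab :: "(real^3) set"
  where "open_slab = {x. 0 < x $ 3 \<and> x $ 3 < 1}"

definition walls :: "(real^3) set"
  where "walls = {x. x $ 3 = 0 \<or> x $ 3 = 1}"

definition cell :: "real \<Rightarrow> real \<Rightarrow> (real^3) set"
  where "cell Lx Ly = cbox 0 (vector [Lx, Ly, 1])"

definition xy_periodic :: "real \<Rightarrow> real \<Rightarrow> (real^3 \<Rightarrow> 'b) \<Rightarrow> bool"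
  where "xy_periodic Lx Ly f \<longleftrightarrow>
    (\<forall>x\<in>slab. f (x + axis 1 Lx) = f x \<and> f (x + axis 2 Ly) = f x)"

definition dir_deriv :: "'a::real_normed_vector \<Rightarrow> ('a \<Rightarrow> real) \<Rightarrow> 'a \<Rightarrow> real"
  where "dir_deriv b f x = deriv (\<lambda>s. f (x + s *\<^sub>R b)) 0"

text \<open>
  A function is \<open>C\<^sup>\<infinity>\<close> on an open set if all iterated partial derivatives exist and are continuous.
  On an arbitrary set, smooth means having a \<open>C\<^sup>\<infinity>\<close> extension to an open neighbourhood;
  on the closed slab this is smoothness up to the boundary.
\<close>

definition smooth_open :: "'a::euclidean_space set \<Rightarrow> ('a \<Rightarrow> real) \<Rightarrow> bool"
  where "smooth_open U f \<longleftrightarrow>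
    (\<forall>bs. set bs \<subseteq> Basis \<longrightarrow>
       continuous_on U (foldr dir_deriv bs f) \<and>
       (\<forall>x\<in>U. \<forall>b\<in>Basis. (\<lambda>s. foldr dir_deriv bs f (x + s *\<^sub>R b)) differentiable (at 0)))"

definition smooth_on :: "'a::euclidean_space set \<Rightarrow> ('a \<Rightarrow> real) \<Rightarrow> bool"
  where "smooth_on S f \<longleftrightarrow>
    (\<exists>U g. open U \<and> S \<subseteq> U \<and> smooth_open U g \<and> (\<forall>x\<in>S. g x = f x))"

abbreviation pd :: "3 \<Rightarrow> (real^3 \<Rightarrow> real) \<Rightarrow> real^3 \<Rightarrow> real"
  where "pd i \<equiv> dir_deriv (axis i 1)"

definition divergence :: "(real^3 \<Rightarrow> real^3) \<Rightarrow> real^3 \<Rightarrow> real"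
  where "divergence v x = (\<Sum>i\<in>UNIV. pd i (\<lambda>y. v y $ i) x)"

definition laplacian :: "(real^3 \<Rightarrow> real) \<Rightarrow> real^3 \<Rightarrow> real"
  where "laplacian f x = (\<Sum>i\<in>UNIV. pd i (pd i f) x)"

definition laplacian_xy :: "(real^3 \<Rightarrow> real) \<Rightarrow> real^3 \<Rightarrow> real"
  where "laplacian_xy f x = pd 1 (pd 1 f) x + pd 2 (pd 2 f) x"

definition vgrad :: "(real^3 \<Rightarrow> real^3) \<Rightarrow> real^3 \<Rightarrow> real^3^3"
  where "vgrad v x = (\<chi> i j. pd j (\<lambda>y. v y $ i) x)"

definition zint :: "(real^3 \<Rightarrow> real) \<Rightarrow> real^3 \<Rightarrow> real"
  where "zint f x = integral {0..x $ 3} (\<lambda>s. f (vector [x $ 1, x $ 2, s]))"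

definition test_function :: "(real^3 \<Rightarrow> real) \<Rightarrow> bool"
  where "test_function \<phi> \<longleftrightarrow>
    smooth_on UNIV \<phi> \<and> (\<exists>K. compact K \<and> K \<subseteq> open_slab \<and> (\<forall>x. x \<notin> K \<longrightarrow> \<phi> x = 0))"

definition locally_integrable :: "(real^3 \<Rightarrow> real) \<Rightarrow> bool"
  where "locally_integrable f \<longleftrightarrow>
    (\<forall>K. compact K \<and> K \<subseteq> open_slab \<longrightarrow> f absolutely_integrable_on K)"

definition has_weak_pd :: "3 \<Rightarrow> (real^3 \<Rightarrow> real) \<Rightarrow> (real^3 \<Rightarrow> real) \<Rightarrow> bool"
  where "has_weak_pd i f g \<longleftrightarrow>
    locally_integrable f \<and> locally_integrable g \<and>
    (\<forall>\<phi>. test_function \<phi> \<longrightarrow>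
      (LINT x:open_slab|lebesgue. f x * pd i \<phi> x) = - (LINT x:open_slab|lebesgue. g x * \<phi> x))"

text \<open>A representative; the weak derivative is unique up to a null set where it exists.\<close>

definition wpd :: "3 \<Rightarrow> (real^3 \<Rightarrow> real) \<Rightarrow> real^3 \<Rightarrow> real"
  where "wpd i f = (SOME g. has_weak_pd i f g)"

definition wgrad :: "(real^3 \<Rightarrow> real) \<Rightarrow> real^3 \<Rightarrow> real^3"
  where "wgrad f x = (\<chi> i. wpd i f x)"

definition whess :: "(real^3 \<Rightarrow> real) \<Rightarrow> real^3 \<Rightarrow> real^3^3"
  where "whess f x = (\<chi> i j. wpd j (wpd i f) x)"

definition wlaplacian :: "(real^3 \<Rightarrow> real) \<Rightarrow> real^3 \<Rightarrow> real"
  where "wlaplacian f x = (\<Sum>i\<in>UNIV. wpd i (wpd i f) x)"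

definition eroot :: "nat \<Rightarrow> ennreal \<Rightarrow> ennreal"
  where "eroot p a = (if a = \<infinity> then \<infinity> else ennreal (root p (enn2real a)))"

definition Lnorm :: "nat \<Rightarrow> 'a measure \<Rightarrow> ('a \<Rightarrow> 'b::real_normed_vector) \<Rightarrow> ennreal"
  where "Lnorm p M f = eroot p (\<integral>\<^sup>+ x. ennreal (norm (f x) ^ p) \<partial>M)"

definition Linfnorm :: "'a measure \<Rightarrow> ('a \<Rightarrow> 'b::real_normed_vector) \<Rightarrow> ennreal"
  where "Linfnorm M f = esssup M (\<lambda>x. ennreal (norm (f x)))"

definition H1norm :: "real \<Rightarrow> real \<Rightarrow> (real^3 \<Rightarrow> real) \<Rightarrow> ennreal"
  where "H1norm Lx Ly f =
    eroot 2 ((Lnorm 2 (lebesgue_on (cell Lx Ly)) f)\<^sup>2 +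
             (Lnorm 2 (lebesgue_on (cell Lx Ly)) (wgrad f))\<^sup>2)"

text \<open>
  Since the weak derivatives are taken on the whole open slab, not only inside the cell,
  \<open>periodic_H\<close> below is the periodic Sobolev space: no jumps across the lateral faces.
\<close>

primrec sobolev :: "real \<Rightarrow> real \<Rightarrow> nat \<Rightarrow> (real^3 \<Rightarrow> real) \<Rightarrow> bool" where
  "sobolev Lx Ly 0 f \<longleftrightarrow>
     f \<in> borel_measurable (lebesgue_on (cell Lx Ly)) \<and> Lnorm 2 (lebesgue_on (cell Lx Ly)) f < \<infinity>"
| "sobolev Lx Ly (Suc k) f \<longleftrightarrow>
     f \<in> borel_measurable (lebesgue_on (cell Lx Ly)) \<and> Lnorm 2 (lebesgue_on (cell Lx Ly)) f < \<infinity> \<and>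
     (\<forall>i. \<exists>g. has_weak_pd i f g \<and> sobolev Lx Ly k g)"

definition periodic_H :: "real \<Rightarrow> real \<Rightarrow> nat \<Rightarrow> (real^3 \<Rightarrow> real) \<Rightarrow> bool"
  where "periodic_H Lx Ly k f \<longleftrightarrow> xy_periodic Lx Ly f \<and> sobolev Lx Ly k f"

text \<open>
  \<open>H\<^sup>3\<close> functions in three dimensions are continuous up to the boundary after modification on a
  null set; the boundary values are those of the continuous representative.
\<close>

definition zero_on_walls :: "(real^3 \<Rightarrow> real) \<Rightarrow> bool"
  where "zero_on_walls f \<longleftrightarrow>
    (\<exists>g. continuous_on slab g \<and> (AE x in lebesgue_on slab. g x = f x) \<and> (\<forall>x\<in>walls. g x = 0))"

definition sobolev_elliptic_constants :: "real \<Rightarrow> real \<Rightarrow> real \<Rightarrow> real \<Rightarrow> bool"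
  where "sobolev_elliptic_constants Lx Ly C\<^sub>S C\<^sub>i \<longleftrightarrow>
    0 < C\<^sub>S \<and> 0 < C\<^sub>i \<and>
    (\<forall>f. periodic_H Lx Ly 3 f \<and> zero_on_walls f \<longrightarrow>
       Linfnorm (lebesgue_on (cell Lx Ly)) (wgrad f) \<le> ennreal C\<^sub>i * H1norm Lx Ly (wlaplacian f) \<and>
       Lnorm 6 (lebesgue_on (cell Lx Ly)) (whess f) \<le> ennreal C\<^sub>S * H1norm Lx Ly (wlaplacian f))"

definition Linf_z_L2_xy :: "real \<Rightarrow> real \<Rightarrow> (real^3 \<Rightarrow> real) \<Rightarrow> ennreal"
  where "Linf_z_L2_xy Lx Ly f =
    (SUP z\<in>{0..1}. Lnorm 2 (lebesgue_on (cbox (0, 0) (Lx, Ly)))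
                     (\<lambda>(x, y). f (vector [x, y, z])))"

definition U_inf :: "real \<Rightarrow> real \<Rightarrow> real \<Rightarrow> real \<Rightarrow> (real \<Rightarrow> real^3 \<Rightarrow> real^3) \<Rightarrow> ennreal"
  where "U_inf Lx Ly C\<^sub>S C\<^sub>i u =
    ennreal C\<^sub>S * Limsup at_top (\<lambda>t. Lnorm 3 (lebesgue_on (cell Lx Ly)) (u t)) +
    ennreal C\<^sub>i * Limsup at_top (\<lambda>t. Lnorm 2 (lebesgue_on (cell Lx Ly)) (vgrad (u t)))"

definition R2 :: "real \<Rightarrow> real \<Rightarrow> real \<Rightarrow> real \<Rightarrow> (real^3 \<Rightarrow> real) \<Rightarrow> real"
  where "R2 Lx Ly Pe U Q =
    U * Pe * enn2real (H1norm Lx Ly Q) / (pi - sqrt (1 + pi\<^sup>2) * U * Pe)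
    + enn2real (Lnorm 2 (lebesgue_on (cell Lx Ly)) Q)"

end

theory Submission
  imports Defs
begin

text \<open>
  Put \<open>W = Pe (\<partial>\<^sub>t T + u \<cdot> \<nabla>T) = \<nabla>\<^sup>2T + Q\<close>, which vanishes on the walls.  Multiplying \<open>\<partial>\<^sub>t W = \<nabla>\<^sup>2\<partial>\<^sub>t T\<close>
  by \<open>W\<close> and integrating by parts once gives
  \<open>1/2 d/dt \<parallel>W\<parallel>\<^sup>2 = - 1/Pe \<parallel>\<nabla>W\<parallel>\<^sup>2 + \<integral> \<nabla>W \<cdot> \<nabla>(u \<cdot> \<nabla>T)\<close>.  By Hoelder's inequality and the
  Sobolev-elliptic constants, \<open>\<parallel>\<nabla>(u \<cdot> \<nabla>T)\<parallel>\<close> is at most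
  \<open>(C\<^sub>S \<parallel>u\<parallel>\<^sub>3 + C\<^sub>i \<parallel>\<nabla>u\<parallel>\<^sub>2) \<parallel>\<nabla>\<^sup>2T\<parallel>\<close> with the \<open>H\<^sup>1\<close> norm on the right, and
  \<open>\<nabla>\<^sup>2T = W - Q\<close>.  With the sharp Poincare inequality \<open>\<pi> \<parallel>W\<parallel> \<le> \<parallel>\<nabla>W\<parallel>\<close> this closes to a differential
  inequality bounding \<open>limsup \<parallel>W\<parallel>\<close>.  Finally \<open>\<parallel>T\<^sub>x\<^sub>x + T\<^sub>y\<^sub>y\<parallel> \<le> \<parallel>\<nabla>\<^sup>2T\<parallel>\<close> because the integrals of
  \<open>T\<^sub>x\<^sub>x T\<^sub>z\<^sub>z\<close> and \<open>T\<^sub>y\<^sub>y T\<^sub>z\<^sub>z\<close> equal those of \<open>T\<^sub>x\<^sub>z\<^sup>2\<close> and \<open>T\<^sub>y\<^sub>z\<^sup>2\<close>.  The functions \<open>T\<close> and \<open>W\<close> are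
  classical, so \<open>Q\<close> agrees almost everywhere with a \<open>C\<^sup>1\<close> function; uniqueness of weak derivatives
  identifies the Sobolev norms of the statement with classical integrals.
\<close>

text \<open>\<open>W\<close> suits the energy estimate for two reasons. The boundary conditions
  alone make it vanish on the walls, whereas the Laplacian of T does not where Q is nonzero; so
  Poincare and integration by parts apply to it. And as Q is constant in time, its time derivative
  is that of the Laplacian: no time derivative of u enters.

  Origin of the constants: with N the norm of the gradient of \<open>W\<close>, Poincare bounds its
  H1 norm by \<open>sqrt (1 + pi^2) / pi * N\<close>. For U slightly above U_inf the energy
  therefore decreases while N (1 - U Pe \<open>sqrt (1 + pi^2) / pi\<close>) exceeds U Pe times the
  H1 norm of Q. Poincare again, norm of \<open>W\<close> at most N / \<open>pi\<close>, turns this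
  threshold into the first term of R2; the second comes from subtracting Q. Integrating in z costs
  no factor, since the slab has height 1.

  A recurrent obstacle: fields are given on the slab only, and vertical two-sided derivatives at a
  wall see values outside it. Identities are proved in the open slab and carried to the walls by
  continuity, or use horizontal derivatives, whose lines stay in the slab.\<close>

subsection \<open>Integration over boxes in three dimensions\<close>

text \<open>Coordinates in cyclic order, with \<open>i\<close> last: index arithmetic in type
  \<open>3\<close> is modulo 3, so one Fubini lemma with the inner integral in direction
  \<open>i\<close> serves all three directions.\<close>

definition ins3 :: "3 \<Rightarrow> (real \<times> real) \<times> real \<Rightarrow> real^3"
  where "ins3 i = (\<lambda>((p, q), r). \<chi> j. if j = i then r else if j = i + 1 then p else q)"

lemma ins3_nth:
  "ins3 i ((p, q), r) $ i = r" "ins3 i ((p, q), r) $ (i + 1) = p" "ins3 i ((p, q), r) $ (i + 2) = q"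
proof -
  have "i + 1 \<noteq> i" "i + 2 \<noteq> i" "i + 2 \<noteq> i + 1" by auto
  then show "ins3 i ((p, q), r) $ i = r" "ins3 i ((p, q), r) $ (i + 1) = p" "ins3 i ((p, q), r) $ (i + 2) = q"
    by (simp_all add: ins3_def)
qed

lemma UNIV_3_cyclic: "(UNIV :: 3 set) = {i, i + 1, i + 2}"
proof -
  have "\<forall>i::3. (UNIV :: 3 set) = {i, i + 1, i + 2}"
    unfolding forall_3 UNIV_3 by auto
  then show ?thesis by blast
qed

lemma all_3_cyclic: "(\<forall>j::3. P j) \<longleftrightarrow> P i \<and> P (i + 1) \<and> P (i + 2)"
  using UNIV_3_cyclic[of i] by (metis UNIV_I insertE empty_iff)

lemma ins3_add: "ins3 i ((p, q), r) + s *\<^sub>R axis i 1 = ins3 i ((p, q), r + s)"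
  by (simp add: vec_eq_iff ins3_def axis_def)

lemma continuous_on_ins3: "continuous_on S (ins3 i)"
proof -
  have "continuous_on S (\<lambda>z. if j = i then snd z else if j = i + 1 then fst (fst z) else snd (fst z))" for j
    by (cases "j = i"; cases "j = i + 1") (auto intro!: continuous_intros)
  then show ?thesis unfolding ins3_def case_prod_beta by (rule continuous_on_vec_lambda)
qed

lemma ins3_measurable [measurable]: "ins3 i \<in> borel_measurable borel"
proof -
  have "continuous_on UNIV (ins3 i)"
    by (rule continuous_on_ins3)
  then show ?thesis by (rule borel_measurable_continuous_onI)
qed

lemma prod_Basis_vec3: "(\<Prod>b\<in>Basis. (v :: real^3) \<bullet> b) = v $ i * v $ (i + 1) * v $ (i + 2)"
proof -
  have B: "(Basis :: (real^3) set) = (\<lambda>i. axis i 1) ` UNIV"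
    by (auto simp: Basis_vec_def)
  have "inj_on (\<lambda>i. axis i (1::real) :: real^3) UNIV"
    by (auto intro!: inj_onI simp: axis_eq_axis)
  then have "(\<Prod>b\<in>Basis. v \<bullet> b) = (\<Prod>j\<in>UNIV. v $ j)"
    unfolding B by (subst prod.reindex) (auto simp: inner_axis)
  also have "\<dots> = v $ i * v $ (i + 1) * v $ (i + 2)"
  proof -
    have "i + 1 \<noteq> i" "i + 2 \<noteq> i" "i + 2 \<noteq> i + 1" by auto
    then show ?thesis
      by (simp only: UNIV_3_cyclic[of i]) (auto simp: algebra_simps)
  qed
  finally show ?thesis .
qed

lemma mem_box_vec3: "x \<in> box a b \<longleftrightarrow> (a $ i < x $ i \<and> x $ i < b $ i) \<and>
    (a $ (i + 1) < x $ (i + 1) \<and> x $ (i + 1) < b $ (i + 1)) \<and>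
    (a $ (i + 2) < x $ (i + 2) \<and> x $ (i + 2) < b $ (i + 2))" for x :: "real^3"
  unfolding mem_box_cart by (rule all_3_cyclic)

lemma mem_cbox_vec3: "x \<in> cbox a b \<longleftrightarrow> (a $ i \<le> x $ i \<and> x $ i \<le> b $ i) \<and>
    (a $ (i + 1) \<le> x $ (i + 1) \<and> x $ (i + 1) \<le> b $ (i + 1)) \<and>
    (a $ (i + 2) \<le> x $ (i + 2) \<and> x $ (i + 2) \<le> b $ (i + 2))" for x :: "real^3"
  unfolding mem_box_cart by (rule all_3_cyclic)

lemma box_Pair_eq: "box (a, c) (b, d) = box a b \<times> box c d"
  by (force simp: box_def Basis_prod_def)

lemma ins3_mem_cbox:
  "ins3 i z \<in> cbox a b \<longleftrightarrow> z \<in> cbox ((a $ (i + 1), a $ (i + 2)), a $ i) ((b $ (i + 1), b $ (i + 2)), b $ i)"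
  by (cases z rule: prod.exhaust[of _ thesis for thesis], rename_tac pq r, case_tac pq)
    (auto simp: mem_cbox_vec3[of _ _ _ i] ins3_nth cbox_Pair_iff)

lemma ins3_mem_box:
  "ins3 i z \<in> box a b \<longleftrightarrow> z \<in> box ((a $ (i + 1), a $ (i + 2)), a $ i) ((b $ (i + 1), b $ (i + 2)), b $ i)"
  by (cases z rule: prod.exhaust[of _ thesis for thesis], rename_tac pq r, case_tac pq)
    (auto simp: mem_box_vec3[of _ _ _ i] ins3_nth box_Pair_eq)

text \<open>A permutation of coordinates pulls boxes back to boxes of the same volume, and the
  volumes of boxes determine Lebesgue measure.\<close>

lemma distr_ins3: "distr lborel borel (ins3 i) = lborel"
proof (rule lborel_eqI[symmetric])
  fix l u :: "real^3" assume le: "\<And>b. b \<in> Basis \<Longrightarrow> l \<bullet> b \<le> u \<bullet> b"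
  have le': "l $ j \<le> u $ j" for j
    using le[of "axis j 1"] by (simp add: inner_axis axis_in_Basis_iff)
  have "emeasure (distr lborel borel (ins3 i)) (box l u) = emeasure lborel (ins3 i -` box l u)"
    by (subst emeasure_distr) auto
  also have "ins3 i -` box l u = box ((l $ (i + 1), l $ (i + 2)), l $ i) ((u $ (i + 1), u $ (i + 2)), u $ i)"
    using ins3_mem_box[of i] by blast
  also have "\<dots> = (box (l $ (i + 1)) (u $ (i + 1)) \<times> box (l $ (i + 2)) (u $ (i + 2))) \<times> box (l $ i) (u $ i)"
    by (simp add: box_Pair_eq)
  also have "emeasure lborel \<dots> = ennreal ((u $ (i + 1) - l $ (i + 1)) * (u $ (i + 2) - l $ (i + 2)) * (u $ i - l $ i))"
    using le' by (simp add: lborel_prod[symmetric] lborel.emeasure_pair_measure_Times ennreal_mult)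
  finally show "emeasure (distr lborel borel (ins3 i)) (box l u) = (\<Prod>b\<in>Basis. (u - l) \<bullet> b)"
    by (subst prod_Basis_vec3[of _ i]) (simp add: algebra_simps)
qed simp

lemma integral_cbox_ins3:
  fixes f :: "real^3 \<Rightarrow> real"
  assumes f: "continuous_on (cbox a b) f"
  shows "integral (cbox a b) f = integral (cbox (a $ (i + 1), a $ (i + 2)) (b $ (i + 1), b $ (i + 2)))
     (\<lambda>p. integral {a $ i..b $ i} (\<lambda>r. f (ins3 i (p, r))))"
proof -
  let ?C = "cbox ((a $ (i + 1), a $ (i + 2)), a $ i) ((b $ (i + 1), b $ (i + 2)), b $ i)"
  have c: "continuous_on ?C (\<lambda>z. f (ins3 i z))"
    by (rule continuous_on_compose2[OF f continuous_on_ins3]) (auto simp: ins3_mem_cbox)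
  have "integral (cbox a b) f = (LINT x:cbox a b|lborel. f x)"
    using borel_integrable_compact[OF compact_cbox f]
    by (intro set_borel_integral_eq_integral(2)[symmetric]) (simp add: set_integrable_def)
  also have "\<dots> = (LINT z:?C|lborel. f (ins3 i z))"
  proof -
    have m: "(\<lambda>x. indicator (cbox a b) x *\<^sub>R f x) \<in> borel_measurable borel"
      using borel_integrable_compact[OF compact_cbox f] by (auto simp: set_integrable_def)
    show ?thesis
      unfolding set_lebesgue_integral_def
      by (subst distr_ins3[of i, symmetric], subst integral_distr) (use m in \<open>auto simp: ins3_mem_cbox indicator_def\<close>)
  qed
  also have "\<dots> = integral ?C (\<lambda>z. f (ins3 i z))"
    by (intro set_borel_integral_eq_integral(2)) (use borel_integrable_compact[OF compact_cbox c] in \<open>simp add: set_integrable_def\<close>)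
  also have "\<dots> = integral (cbox (a $ (i + 1), a $ (i + 2)) (b $ (i + 1), b $ (i + 2)))
     (\<lambda>p. integral {a $ i..b $ i} (\<lambda>r. f (ins3 i (p, r))))"
    using integral_prod_continuous[OF c] by simp
  finally show ?thesis .
qed

text \<open>The fundamental theorem of calculus on each line in direction \<open>i\<close>.
  Assumption \<open>faces\<close> covers periodic fields, fields that vanish on both faces, and
  products with a test function alike.\<close>

lemma integral_partial_deriv_cbox:
  fixes f F :: "real^3 \<Rightarrow> real"
  assumes f: "continuous_on (cbox a b) f" and F: "continuous_on (cbox a b) F"
    and ab: "a $ i \<le> b $ i"
    and deriv: "\<And>x. x \<in> cbox a b \<Longrightarrow> a $ i < x $ i \<Longrightarrow> x $ i < b $ i \<Longrightarrow>
      ((\<lambda>s. f (x + s *\<^sub>R axis i 1)) has_real_derivative F x) (at 0)"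
    and faces: "\<And>x. x \<in> cbox a b \<Longrightarrow> x $ i = a $ i \<Longrightarrow> f (x + (b $ i - a $ i) *\<^sub>R axis i 1) = f x"
  shows "integral (cbox a b) F = 0"
proof -
  have "integral {a $ i..b $ i} (\<lambda>r. F (ins3 i (p, r))) = 0"
    if p: "p \<in> cbox (a $ (i + 1), a $ (i + 2)) (b $ (i + 1), b $ (i + 2))" for p
  proof -
    obtain p1 p2 where pp: "p = (p1, p2)" by (cases p)
    have mem: "ins3 i (p, r) \<in> cbox a b" if "r \<in> {a $ i..b $ i}" for r
      using p that by (simp add: ins3_mem_cbox cbox_Pair_iff pp)
    have "((\<lambda>r. F (ins3 i (p, r))) has_integral f (ins3 i (p, b $ i)) - f (ins3 i (p, a $ i))) {a $ i..b $ i}"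
    proof (rule fundamental_theorem_of_calculus_interior[OF ab])
      show "continuous_on {a $ i..b $ i} (\<lambda>r. f (ins3 i (p, r)))"
        by (rule continuous_on_compose2[OF f]) 
          (auto intro!: continuous_on_compose2[OF continuous_on_ins3] continuous_intros mem)
      fix r assume r: "r \<in> {a $ i<..<b $ i}"
      have "((\<lambda>s. f (ins3 i (p, r) + s *\<^sub>R axis i 1)) has_real_derivative F (ins3 i (p, r))) (at 0)"
        using r by (intro deriv mem) (auto simp: pp ins3_nth)
      then have "((\<lambda>s. f (ins3 i (p, r + s))) has_real_derivative F (ins3 i (p, r))) (at 0)"
        by (simp add: pp ins3_add)
      then have "((\<lambda>s. f (ins3 i (p, s))) has_real_derivative F (ins3 i (p, r))) (at r)"
        using DERIV_shift[of "\<lambda>s. f (ins3 i (p, s))" "F (ins3 i (p, r))" 0 r] by (simp add: add.commute)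
      then show "((\<lambda>r. f (ins3 i (p, r))) has_vector_derivative F (ins3 i (p, r))) (at r)"
        by (simp add: has_real_derivative_iff_has_vector_derivative)
    qed
    moreover have "f (ins3 i (p, b $ i)) = f (ins3 i (p, a $ i))"
      using faces[OF mem[of "a $ i"]] ab by (simp add: pp ins3_nth ins3_add)
    ultimately show ?thesis by (simp add: integral_unique)
  qed
  then have "integral (cbox (a $ (i + 1), a $ (i + 2)) (b $ (i + 1), b $ (i + 2)))
     (\<lambda>p. integral {a $ i..b $ i} (\<lambda>r. F (ins3 i (p, r)))) = 0"
    by (subst integral_cong[where g="\<lambda>_. 0"]) auto
  then show ?thesis using integral_cbox_ins3[OF F, of i] by simp
qed

lemma nn_integral_lebesgue_on_cbox:
  fixes h :: "'a::euclidean_space \<Rightarrow> real"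
  assumes h: "continuous_on (cbox a b) h" and nn: "\<And>x. x \<in> cbox a b \<Longrightarrow> 0 \<le> h x"
  shows "(\<integral>\<^sup>+x. ennreal (h x) \<partial>lebesgue_on (cbox a b)) = ennreal (integral (cbox a b) h)"
proof -
  have i: "h integrable_on cbox a b" by (rule integrable_continuous[OF h])
  have "integrable (lebesgue_on (cbox a b)) h"
    using absolutely_integrable_continuous[OF h] by (simp add: set_integrable_def integrable_restrict_space)
  then have "(\<integral>\<^sup>+x. ennreal (h x) \<partial>lebesgue_on (cbox a b)) = ennreal (integral\<^sup>L (lebesgue_on (cbox a b)) h)"
    by (intro nn_integral_eq_integral AE_I2) (auto simp: nn space_restrict_space)
  also have "integral\<^sup>L (lebesgue_on (cbox a b)) h = integral (cbox a b) h"
    by (rule lebesgue_integral_eq_integral) (use \<open>integrable (lebesgue_on (cbox a b)) h\<close> in auto)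
  finally show ?thesis .
qed

subsection \<open>Smooth functions and periodic fields on the slab\<close>

lemma smooth_open_dir_deriv:
  assumes "smooth_open U f" "b \<in> Basis"
  shows "smooth_open U (dir_deriv b f)"
  unfolding smooth_open_def
proof (intro allI impI)
  fix bs :: "'a list" assume "set bs \<subseteq> Basis"
  then have "set (bs @ [b]) \<subseteq> Basis" using assms(2) by simp
  with assms(1) have "continuous_on U (foldr dir_deriv (bs @ [b]) f) \<and>
       (\<forall>x\<in>U. \<forall>c\<in>Basis. (\<lambda>s. foldr dir_deriv (bs @ [b]) f (x + s *\<^sub>R c)) differentiable (at 0))"
    unfolding smooth_open_def by blast
  then show "continuous_on U (foldr dir_deriv bs (dir_deriv b f)) \<and>
       (\<forall>x\<in>U. \<forall>c\<in>Basis. (\<lambda>s. foldr dir_deriv bs (dir_deriv b f) (x + s *\<^sub>R c)) differentiable (at 0))"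
    by simp
qed

lemma smooth_open_continuous_on: "smooth_open U f \<Longrightarrow> continuous_on U f"
  unfolding smooth_open_def by (drule spec[of _ "[]"]) simp

lemma smooth_open_has_real_derivative_0:
  assumes "smooth_open U f" "b \<in> Basis" "x \<in> U"
  shows "((\<lambda>s. f (x + s *\<^sub>R b)) has_real_derivative dir_deriv b f x) (at 0)"
proof -
  have "(\<lambda>s. f (x + s *\<^sub>R b)) differentiable (at 0)"
    using assms unfolding smooth_open_def by (metis empty_subsetI foldr.simps(1) id_apply list.set(1))
  then show ?thesis
    unfolding dir_deriv_def
    by (simp add: real_differentiable_def DERIV_deriv_iff_real_differentiable[symmetric])
       (metis DERIV_imp_deriv)
qed

lemma smooth_open_has_real_derivative:
  assumes "smooth_open U f" "b \<in> Basis" "x + s *\<^sub>R b \<in> U"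
  shows "((\<lambda>s. f (x + s *\<^sub>R b)) has_real_derivative dir_deriv b f (x + s *\<^sub>R b)) (at s)"
proof -
  have "((\<lambda>r. f (x + s *\<^sub>R b + r *\<^sub>R b)) has_real_derivative dir_deriv b f (x + s *\<^sub>R b)) (at 0)"
    by (rule smooth_open_has_real_derivative_0[OF assms])
  then have "((\<lambda>r. f (x + (r + s) *\<^sub>R b)) has_real_derivative dir_deriv b f (x + s *\<^sub>R b)) (at 0)"
    by (simp add: algebra_simps)
  then show ?thesis
    using DERIV_shift[of "\<lambda>s. f (x + s *\<^sub>R b)" "dir_deriv b f (x + s *\<^sub>R b)" 0 s] by simp
qed

text \<open>Two mean value steps: first in direction \<open>a\<close> for the increment of
  \<open>f\<close> along \<open>b\<close>, then in direction \<open>b\<close>. The second difference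
  itself is symmetric in \<open>a\<close> and \<open>b\<close>.\<close>

lemma second_difference_mvt:
  assumes f: "smooth_open U f" and ab: "a \<in> Basis" "b \<in> Basis" and h: "0 < h"
    and U: "\<And>s r. 0 \<le> s \<Longrightarrow> s \<le> h \<Longrightarrow> 0 \<le> r \<Longrightarrow> r \<le> h \<Longrightarrow> x + s *\<^sub>R a + r *\<^sub>R b \<in> U"
  shows "\<exists>s r. 0 \<le> s \<and> s \<le> h \<and> 0 \<le> r \<and> r \<le> h \<and>
    f (x + h *\<^sub>R a + h *\<^sub>R b) - f (x + h *\<^sub>R a) - f (x + h *\<^sub>R b) + f x =
      h * h * dir_deriv b (dir_deriv a f) (x + s *\<^sub>R a + r *\<^sub>R b)"
proof -
  have Da: "((\<lambda>s. f (x + s *\<^sub>R a + r *\<^sub>R b)) has_real_derivative dir_deriv a f (x + s *\<^sub>R a + r *\<^sub>R b)) (at s)"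
    if "0 \<le> s" "s \<le> h" "0 \<le> r" "r \<le> h" for s r
    using smooth_open_has_real_derivative[OF f ab(1), of "x + r *\<^sub>R b" s] U[OF that]
    by (simp add: algebra_simps)
  have "\<exists>s>0. s < h \<and> (f (x + h *\<^sub>R a + h *\<^sub>R b) - f (x + h *\<^sub>R a + 0 *\<^sub>R b)) - (f (x + 0 *\<^sub>R a + h *\<^sub>R b) - f (x + 0 *\<^sub>R a + 0 *\<^sub>R b))
      = (h - 0) * (dir_deriv a f (x + s *\<^sub>R a + h *\<^sub>R b) - dir_deriv a f (x + s *\<^sub>R a + 0 *\<^sub>R b))"
    by (rule MVT2[OF h, of "\<lambda>s. f (x + s *\<^sub>R a + h *\<^sub>R b) - f (x + s *\<^sub>R a + 0 *\<^sub>R b)"])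
      (intro DERIV_diff Da; use h in simp)
  then obtain s where s: "0 < s" "s < h" and
    e1: "f (x + h *\<^sub>R a + h *\<^sub>R b) - f (x + h *\<^sub>R a) - f (x + h *\<^sub>R b) + f x =
      h * (dir_deriv a f (x + s *\<^sub>R a + h *\<^sub>R b) - dir_deriv a f (x + s *\<^sub>R a + 0 *\<^sub>R b))"
    by auto
  have "\<exists>r>0. r < h \<and> dir_deriv a f (x + s *\<^sub>R a + h *\<^sub>R b) - dir_deriv a f (x + s *\<^sub>R a + 0 *\<^sub>R b)
      = (h - 0) * dir_deriv b (dir_deriv a f) (x + s *\<^sub>R a + r *\<^sub>R b)"
    by (rule MVT2[OF h])
      (intro smooth_open_has_real_derivative[OF smooth_open_dir_deriv[OF f ab(1)] ab(2)] U; use s in simp)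
  then obtain r where r: "0 < r" "r < h" and
    e2: "dir_deriv a f (x + s *\<^sub>R a + h *\<^sub>R b) - dir_deriv a f (x + s *\<^sub>R a + 0 *\<^sub>R b)
      = h * dir_deriv b (dir_deriv a f) (x + s *\<^sub>R a + r *\<^sub>R b)" by auto
  show ?thesis
    using s r e1 e2 by (intro exI[of _ s] exI[of _ r]) auto
qed

text \<open>Evaluating the same second difference in both orders gives points arbitrarily close to
  \<open>x\<close> at which the two mixed derivatives agree. Continuity excludes a gap at
  \<open>x\<close>: \<open>e\<close> is half the gap, so two deviations below \<open>e\<close>
  cannot close it.\<close>

lemma smooth_open_mixed_partials:
  assumes U: "open U" and f: "smooth_open U f" and ab: "a \<in> Basis" "b \<in> Basis" and x: "x \<in> U"
  shows "dir_deriv a (dir_deriv b f) x = dir_deriv b (dir_deriv a f) x"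
proof (rule ccontr)
  assume ne: "\<not> ?thesis"
  define e where "e = \<bar>dir_deriv a (dir_deriv b f) x - dir_deriv b (dir_deriv a f) x\<bar> / 2"
  have e: "e > 0" using ne by (simp add: e_def)
  obtain d0 where d0: "d0 > 0" "ball x d0 \<subseteq> U" using U x by (meson open_contains_ball)
  have c: "continuous (at x) (dir_deriv a' (dir_deriv b' f))" if "a' \<in> Basis" "b' \<in> Basis" for a' b'
    using smooth_open_continuous_on[OF smooth_open_dir_deriv[OF smooth_open_dir_deriv[OF f that(2)] that(1)]] U x
    by (simp add: continuous_on_eq_continuous_at)
  obtain d1 where d1: "d1 > 0" "\<And>y. dist y x < d1 \<Longrightarrow> dist (dir_deriv a (dir_deriv b f) y) (dir_deriv a (dir_deriv b f) x) < e"
    using c[OF ab] e unfolding continuous_at_eps_delta by (auto simp: dist_real_def) 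
  obtain d2 where d2: "d2 > 0" "\<And>y. dist y x < d2 \<Longrightarrow> dist (dir_deriv b (dir_deriv a f) y) (dir_deriv b (dir_deriv a f) x) < e"
    using c[OF ab(2,1)] e unfolding continuous_at_eps_delta by (auto simp: dist_real_def) 
  \<comment> \<open>Points of the square with side \<open>h\<close> at \<open>x\<close> have
    distance at most \<open>2 * h\<close> from \<open>x\<close>; division by 3 puts this strictly
    below all three radii.\<close>
  define h where "h = Min {d0, d1, d2} / 3"
  have h: "h > 0" "2 * h < d0" "2 * h < d1" "2 * h < d2" using d0 d1 d2 by (auto simp: h_def)
  have near: "dist (x + s *\<^sub>R a' + r *\<^sub>R b') x \<le> 2 * h"
    if "0 \<le> s" "s \<le> h" "0 \<le> r" "r \<le> h" "a' \<in> Basis" "b' \<in> Basis" for s r a' b'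
  proof -
    have "dist (x + s *\<^sub>R a' + r *\<^sub>R b') x = norm (s *\<^sub>R a' + r *\<^sub>R b')" by (simp add: dist_norm add.assoc)
    also have "\<dots> \<le> norm (s *\<^sub>R a') + norm (r *\<^sub>R b')" by (rule norm_triangle_ineq)
    also have "\<dots> \<le> 2 * h" using that by simp
    finally show ?thesis .
  qed
  have inU: "x + s *\<^sub>R a' + r *\<^sub>R b' \<in> U"
    if "0 \<le> s" "s \<le> h" "0 \<le> r" "r \<le> h" "a' \<in> Basis" "b' \<in> Basis" for s r a' b'
    using near[OF that] h d0(2) by (auto simp: subset_iff dist_commute)
  obtain s r where 1: "0 \<le> s" "s \<le> h" "0 \<le> r" "r \<le> h"
    "f (x + h *\<^sub>R a + h *\<^sub>R b) - f (x + h *\<^sub>R a) - f (x + h *\<^sub>R b) + f x =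
      h * h * dir_deriv b (dir_deriv a f) (x + s *\<^sub>R a + r *\<^sub>R b)"
    using second_difference_mvt[OF f ab h(1) inU] ab by blast
  obtain s' r' where 2: "0 \<le> s'" "s' \<le> h" "0 \<le> r'" "r' \<le> h"
    "f (x + h *\<^sub>R b + h *\<^sub>R a) - f (x + h *\<^sub>R b) - f (x + h *\<^sub>R a) + f x =
      h * h * dir_deriv a (dir_deriv b f) (x + s' *\<^sub>R b + r' *\<^sub>R a)"
    using second_difference_mvt[OF f ab(2,1) h(1) inU] ab by blast
  have "h * h * dir_deriv b (dir_deriv a f) (x + s *\<^sub>R a + r *\<^sub>R b) =
      h * h * dir_deriv a (dir_deriv b f) (x + s' *\<^sub>R b + r' *\<^sub>R a)"
    using 1(5) 2(5) by (simp add: algebra_simps)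
  then have eq: "dir_deriv b (dir_deriv a f) (x + s *\<^sub>R a + r *\<^sub>R b) =
      dir_deriv a (dir_deriv b f) (x + s' *\<^sub>R b + r' *\<^sub>R a)" using h by simp
  have "dist (dir_deriv b (dir_deriv a f) (x + s *\<^sub>R a + r *\<^sub>R b)) (dir_deriv b (dir_deriv a f) x) < e"
    using near[OF 1(1-4) ab] h by (intro d2) auto
  moreover have "dist (dir_deriv a (dir_deriv b f) (x + s' *\<^sub>R b + r' *\<^sub>R a)) (dir_deriv a (dir_deriv b f) x) < e"
    using near[OF 2(1-4) ab(2,1)] h by (intro d1) auto
  ultimately show False using eq by (simp add: e_def dist_real_def abs_if split: if_splits)
qed

lemma eventually_line_in_open:
  fixes x b :: "'a::real_normed_vector"
  assumes "open S" "x \<in> S"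
  shows "\<forall>\<^sub>F s in nhds 0. x + s *\<^sub>R b \<in> S"
proof -
  have "((\<lambda>s. x + s *\<^sub>R b) \<longlongrightarrow> x + 0 *\<^sub>R b) (nhds 0)"
    by (intro tendsto_intros filterlim_ident)
  then show ?thesis using topological_tendstoD[of _ "x + 0 *\<^sub>R b"] assms by fastforce
qed

text \<open>\<open>F\<close> carries the partial derivatives. They are two-sided even on the walls,
  so for \<open>i = 3\<close> they depend on values of \<open>f\<close> outside the slab; the notion
  is therefore applied to smooth extensions of the given fields.\<close>

definition periodic_C1 :: "real \<Rightarrow> real \<Rightarrow> (real^3 \<Rightarrow> real) \<Rightarrow> (3 \<Rightarrow> real^3 \<Rightarrow> real) \<Rightarrow> bool"
  where "periodic_C1 Lx Ly f F \<longleftrightarrow> xy_periodic Lx Ly f \<and> continuous_on slab f \<and>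
    (\<forall>i. continuous_on slab (F i)) \<and>
    (\<forall>i. \<forall>x\<in>slab. ((\<lambda>s. f (x + s *\<^sub>R axis i 1)) has_real_derivative F i x) (at 0))"

lemma periodic_C1D:
  assumes "periodic_C1 Lx Ly f F"
  shows "xy_periodic Lx Ly f" "continuous_on slab f" "continuous_on slab (F i)"
    "x \<in> slab \<Longrightarrow> ((\<lambda>s. f (x + s *\<^sub>R axis i 1)) has_real_derivative F i x) (at 0)"
  using assms unfolding periodic_C1_def by auto

lemma periodic_C1_mult:
  assumes "periodic_C1 Lx Ly f F" "periodic_C1 Lx Ly g G"
  shows "periodic_C1 Lx Ly (\<lambda>x. f x * g x) (\<lambda>i x. F i x * g x + f x * G i x)"
  using assms unfolding periodic_C1_def
  by (auto intro!: continuous_intros derivative_eq_intros simp: xy_periodic_def)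

lemma periodic_C1_add:
  assumes "periodic_C1 Lx Ly f F" "periodic_C1 Lx Ly g G"
  shows "periodic_C1 Lx Ly (\<lambda>x. f x + g x) (\<lambda>i x. F i x + G i x)"
  using assms unfolding periodic_C1_def
  by (auto intro!: continuous_intros derivative_eq_intros simp: xy_periodic_def)

lemma periodic_C1_diff:
  assumes "periodic_C1 Lx Ly f F" "periodic_C1 Lx Ly g G"
  shows "periodic_C1 Lx Ly (\<lambda>x. f x - g x) (\<lambda>i x. F i x - G i x)"
  using assms unfolding periodic_C1_def
  by (auto intro!: continuous_intros derivative_eq_intros simp: xy_periodic_def)

lemma periodic_C1_cmult:
  assumes "periodic_C1 Lx Ly f F"
  shows "periodic_C1 Lx Ly (\<lambda>x. c * f x) (\<lambda>i x. c * F i x)"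
  using assms unfolding periodic_C1_def
  by (auto intro!: continuous_intros derivative_eq_intros simp: xy_periodic_def)

lemma periodic_C1_sum:
  assumes "\<And>k. k \<in> K \<Longrightarrow> periodic_C1 Lx Ly (f k) (F k)"
  shows "periodic_C1 Lx Ly (\<lambda>x. \<Sum>k\<in>K. f k x) (\<lambda>i x. \<Sum>k\<in>K. F k i x)"
  using assms unfolding periodic_C1_def
  by (auto intro!: continuous_intros derivative_eq_intros sum.cong DERIV_sum simp: xy_periodic_def)

section \<open>The slab, the period cell and integration by parts\<close>

lemma mem_cell: "x \<in> cell Lx Ly \<longleftrightarrow> (0 \<le> x $ 1 \<and> x $ 1 \<le> Lx) \<and> (0 \<le> x $ 2 \<and> x $ 2 \<le> Ly) \<and> 0 \<le> x $ 3 \<and> x $ 3 \<le> 1"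
  by (auto simp: cell_def mem_box_cart forall_3 vector_3)

lemma cell_subset_slab: "cell Lx Ly \<subseteq> slab"
  by (auto simp: mem_cell slab_def)

lemma open_slab_subset_slab: "open_slab \<subseteq> slab"
  by (auto simp: slab_def open_slab_def)

lemma open_open_slab: "open open_slab"
proof -
  have "open_slab = {x. 0 < x $ 3} \<inter> {x. x $ 3 < 1}" by (auto simp: open_slab_def)
  then show ?thesis using open_Int[OF open_halfspace_component_gt_cart open_halfspace_component_lt_cart] by metis
qed

lemma slab_subset_closure: "slab \<subseteq> closure open_slab"
proof
  fix x :: "real^3" assume x: "x \<in> slab"
  show "x \<in> closure open_slab"
    unfolding closure_approachable
  proof (intro allI impI)
    fix e :: real assume e: "e > 0"
    define d where "d = min 1 e"
    \<comment> \<open>This moves \<open>x\<close> towards the mid-plane by the fraction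
      \<open>d\<close> of its distance from it.\<close>
    define y where "y = x + (d * (1/2 - x $ 3)) *\<^sub>R axis 3 1"
    have d: "0 < d" "d \<le> 1" "d \<le> e" using e by (auto simp: d_def)
    have x3: "0 \<le> x $ 3" "x $ 3 \<le> 1" using x by (auto simp: slab_def)
    have y3: "y $ 3 = (1 - d) * x $ 3 + d / 2" by (simp add: y_def axis_def algebra_simps)
    have "(1 - d) * x $ 3 \<ge> 0" "(1 - d) * x $ 3 \<le> (1 - d) * 1"
      using d x3 by (intro mult_nonneg_nonneg mult_left_mono; simp)+
    then have "y \<in> open_slab" using d by (auto simp: open_slab_def y3)
    moreover have "dist y x < e"
    proof -
      have "dist y x = d * \<bar>1/2 - x $ 3\<bar>" using d by (simp add: y_def dist_norm abs_mult)
      also have "\<dots> \<le> d * (1/2)" using d x3 by (intro mult_left_mono) (auto simp: abs_if)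
      also have "\<dots> < e" using d e by simp
      finally show ?thesis .
    qed
    ultimately show "\<exists>y\<in>open_slab. dist y x < e" by blast
  qed
qed

lemma closure_open_slab: "closure open_slab = slab"
proof
  have "closed slab"
    unfolding slab_def Collect_conj_eq
    by (intro closed_Int closed_Collect_le continuous_intros)
  then show "closure open_slab \<subseteq> slab" using open_slab_subset_slab by (simp add: closure_minimal)
qed (rule slab_subset_closure)

lemma axis_scaleR: "c *\<^sub>R axis i (1::real) = axis i c"
  by (simp add: vec_eq_iff axis_def)

text \<open>Opposite faces carry equal values: by periodicity in the horizontal directions, and
  because both faces are walls in the vertical one.\<close>

lemma integral_cell_partial_deriv:
  assumes f: "periodic_C1 Lx Ly f F" and L: "0 < Lx" "0 < Ly"
    and w: "i = 3 \<Longrightarrow> (\<forall>x\<in>walls. f x = 0)"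
  shows "integral (cell Lx Ly) (F i) = 0"
  unfolding cell_def
proof (rule integral_partial_deriv_cbox[of _ _ f _ i])
  note C = periodic_C1D[OF f]
  have sub: "cbox 0 (vector [Lx, Ly, 1] :: real^3) \<subseteq> slab"
    using cell_subset_slab by (simp add: cell_def)
  show "continuous_on (cbox 0 (vector [Lx, Ly, 1])) f"
    "continuous_on (cbox 0 (vector [Lx, Ly, 1])) (F i)"
    using C(2,3) sub continuous_on_subset by blast+
  show "0 $ i \<le> (vector [Lx, Ly, 1] :: real^3) $ i"
    using L exhaust_3[of i] by auto
  fix x :: "real^3" assume x: "x \<in> cbox 0 (vector [Lx, Ly, 1])"
  then have xs: "x \<in> slab" using sub by blast
  show "((\<lambda>s. f (x + s *\<^sub>R axis i 1)) has_real_derivative F i x) (at 0)"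
    by (rule C(4)[OF xs])
  assume xi: "x $ i = (0 :: real^3) $ i"
  show "f (x + (vector [Lx, Ly, 1] $ i - 0 $ i) *\<^sub>R axis i 1) = f x"
    using exhaust_3[of i]
  proof (elim disjE)
    assume "i = 1" then show ?thesis using C(1) xs by (simp add: xy_periodic_def axis_scaleR)
  next
    assume "i = 2" then show ?thesis using C(1) xs by (simp add: xy_periodic_def axis_scaleR)
  next
    assume i: "i = 3"
    then have "x \<in> walls" "x + axis 3 1 \<in> walls" using xi by (auto simp: walls_def axis_def)
    then show ?thesis using w i by simp
  qed
qed

lemma continuous_on_cell: "continuous_on slab f \<Longrightarrow> continuous_on (cell Lx Ly) f"
  using cell_subset_slab continuous_on_subset by blast

lemma integrable_on_cell: "continuous_on slab f \<Longrightarrow> f integrable_on cell Lx Ly" for f :: "_ \<Rightarrow> 'b::banach"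
  unfolding cell_def by (rule integrable_continuous, fold cell_def) (rule continuous_on_cell)

text \<open>The wall hypothesis concerns the product, so either factor may be the one that
  vanishes.\<close>

lemma integral_cell_by_parts:
  assumes f: "periodic_C1 Lx Ly f F" and g: "periodic_C1 Lx Ly g G" and L: "0 < Lx" "0 < Ly"
    and w: "i = 3 \<Longrightarrow> (\<forall>x\<in>walls. f x * g x = 0)"
  shows "integral (cell Lx Ly) (\<lambda>x. F i x * g x) = - integral (cell Lx Ly) (\<lambda>x. f x * G i x)"
proof -
  have "integral (cell Lx Ly) (\<lambda>x. F i x * g x + f x * G i x) = 0"
    by (rule integral_cell_partial_deriv[OF periodic_C1_mult[OF f g] L w])
  moreover have "integral (cell Lx Ly) (\<lambda>x. F i x * g x + f x * G i x) =
      integral (cell Lx Ly) (\<lambda>x. F i x * g x) + integral (cell Lx Ly) (\<lambda>x. f x * G i x)"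
    by (intro integral_add integrable_on_cell continuous_intros periodic_C1D[OF f] periodic_C1D[OF g])
  ultimately show ?thesis by simp
qed

text \<open>\<open>g\<close> extends a field smoothly past the walls and past t = 0, and is
  arbitrary there. Periodicity is stated for t > 0: at such times small time shifts stay positive,
  so it passes directly to \<open>dt g\<close>.\<close>

definition st_field :: "real \<Rightarrow> real \<Rightarrow> (real \<times> (real^3)) set \<Rightarrow> (real \<times> (real^3) \<Rightarrow> real) \<Rightarrow> bool"
  where "st_field Lx Ly U g \<longleftrightarrow> open U \<and> {0..} \<times> slab \<subseteq> U \<and> smooth_open U g \<and>
    (\<forall>t>0. xy_periodic Lx Ly (\<lambda>x. g (t, x)))"

abbreviation dt :: "(real \<times> (real^3) \<Rightarrow> real) \<Rightarrow> real \<times> (real^3) \<Rightarrow> real"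
  where "dt \<equiv> dir_deriv (1, 0)"

abbreviation dx :: "3 \<Rightarrow> (real \<times> (real^3) \<Rightarrow> real) \<Rightarrow> real \<times> (real^3) \<Rightarrow> real"
  where "dx i \<equiv> dir_deriv (0, axis i 1)"

lemma space_time_Basis: "(1, 0) \<in> (Basis :: (real \<times> (real^3)) set)" "(0, axis i 1) \<in> (Basis :: (real \<times> (real^3)) set)"
  by (auto simp: Basis_prod_def axis_in_Basis_iff)

lemma st_fieldD:
  assumes "st_field Lx Ly U g"
  shows "open U" "smooth_open U g" "0 \<le> t \<Longrightarrow> x \<in> slab \<Longrightarrow> (t, x) \<in> U"
    "0 < t \<Longrightarrow> xy_periodic Lx Ly (\<lambda>x. g (t, x))"
  using assms unfolding st_field_def by auto

lemma slab_add_axis: "x \<in> slab \<Longrightarrow> i \<noteq> 3 \<Longrightarrow> x + axis i c \<in> slab"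
  by (simp add: slab_def axis_def)

lemma st_field_continuous_on_slice:
  assumes g: "st_field Lx Ly U g" and t: "0 \<le> t"
  shows "continuous_on slab (\<lambda>x. g (t, x))"
proof (rule continuous_on_compose2[OF smooth_open_continuous_on[OF st_fieldD(2)[OF g]]])
  show "continuous_on slab (Pair t)" by (intro continuous_intros)
qed (use st_fieldD(3)[OF g] t in auto)

text \<open>The delicate point is periodicity of a vertical derivative on the walls, where the
  difference quotients leave the slab. It is proved in the open slab and extended by
  continuity.\<close>

lemma st_field_dir_deriv:
  assumes g: "st_field Lx Ly U g" and b: "b \<in> Basis"
  shows "st_field Lx Ly U (dir_deriv b g)"
proof -
  note D = st_fieldD[OF g]
  have sm: "smooth_open U (dir_deriv b g)" by (rule smooth_open_dir_deriv[OF D(2) b])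
  have cont: "continuous_on slab (\<lambda>x. dir_deriv b g (t, x))" if "0 < t" for t
  proof (rule continuous_on_compose2[OF smooth_open_continuous_on[OF sm]])
    show "continuous_on slab (Pair t)" by (intro continuous_intros)
  qed (use D(3) that in auto)
  have per: "dir_deriv b g (t, x + e) = dir_deriv b g (t, x)"
    if t: "0 < t" and x: "x \<in> slab" and e: "e = axis 1 Lx \<or> e = axis 2 Ly" for t x e
  proof -
    have e3: "e $ 3 = 0" using e by (auto simp: axis_def)
    have inner: "dir_deriv b g (t, y + e) - dir_deriv b g (t, y) = 0" if y: "y \<in> open_slab" for y
    proof -
      have "open ({0<..} \<times> open_slab :: (real \<times> (real^3)) set)" by (simp add: open_Times open_open_slab)
      then have "\<forall>\<^sub>F s in nhds 0. (t, y) + s *\<^sub>R b \<in> {0<..} \<times> open_slab"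
        using t y by (intro eventually_line_in_open) auto
      then have "\<forall>\<^sub>F s in nhds 0. g ((t, y + e) + s *\<^sub>R b) = g ((t, y) + s *\<^sub>R b)"
      proof eventually_elim
        case (elim s)
        obtain p q where pq: "(t, y) + s *\<^sub>R b = (p, q)" by (cases "(t, y) + s *\<^sub>R b")
        then have "(t, y + e) + s *\<^sub>R b = (p, q + e)" by (cases b) (auto simp: algebra_simps)
        moreover have "0 < p" "q \<in> slab" using elim pq open_slab_subset_slab by auto
        ultimately show ?case using D(4)[of p] e pq by (auto simp: xy_periodic_def)
      qed
      then show ?thesis unfolding dir_deriv_def by (simp add: deriv_cong_ev)
    qed
    have c: "continuous_on slab (\<lambda>x. dir_deriv b g (t, x + e) - dir_deriv b g (t, x))"
      by (intro continuous_intros continuous_on_compose2[OF cont[OF t]] cont[OF t])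
        (use e3 in \<open>auto simp: slab_def\<close>)
    have "dir_deriv b g (t, x + e) - dir_deriv b g (t, x) = 0"
      by (rule continuous_constant_on_closure[where S=open_slab and f="\<lambda>x. dir_deriv b g (t, x + e) - dir_deriv b g (t, x)"])
       (use c closure_open_slab x inner in auto)
    then show ?thesis by simp
  qed
  show ?thesis
    using D(1,3) sm per unfolding st_field_def xy_periodic_def by auto
qed

lemmas st_field_dt = st_field_dir_deriv[OF _ space_time_Basis(1)]
lemmas st_field_dx = st_field_dir_deriv[OF _ space_time_Basis(2)]

lemma st_field_periodic_C1:
  assumes g: "st_field Lx Ly U g" and t: "0 < t"
  shows "periodic_C1 Lx Ly (\<lambda>x. g (t, x)) (\<lambda>i x. dx i g (t, x))"
  unfolding periodic_C1_def
proof (intro conjI allI ballI)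
  show "((\<lambda>s. g (t, x + s *\<^sub>R axis i 1)) has_real_derivative dx i g (t, x)) (at 0)"
    if "x \<in> slab" for x i
    using smooth_open_has_real_derivative_0[OF st_fieldD(2)[OF g] space_time_Basis(2) st_fieldD(3)[OF g], of t x i] t that
    by simp
qed (use st_fieldD(4)[OF g t] st_field_continuous_on_slice[OF st_field_dx[OF g]]
      st_field_continuous_on_slice[OF g] t in auto)

lemma st_field_has_time_derivative:
  assumes g: "st_field Lx Ly U g" and t: "0 < t" and x: "x \<in> slab"
  shows "((\<lambda>s. g (s, x)) has_real_derivative dt g (t, x)) (at t)"
  using smooth_open_has_real_derivative[OF st_fieldD(2)[OF g] space_time_Basis(1), of "(0, x)" t]
    st_fieldD(3)[OF g, of t x] t x by simp

lemma st_field_commute: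
  assumes g: "st_field Lx Ly U g" and "0 < t" "x \<in> slab"
  shows "dx i (dx j g) (t, x) = dx j (dx i g) (t, x)" "dt (dx j g) (t, x) = dx j (dt g) (t, x)"
  using smooth_open_mixed_partials[OF st_fieldD(1,2)[OF g] _ _ st_fieldD(3)[OF g]] space_time_Basis assms
  by auto

text \<open>Time and the horizontal directions are tangential to the walls, so the difference
  quotients vanish identically.\<close>

lemma st_field_zero_on_walls:
  assumes z: "\<And>t x. 0 < t \<Longrightarrow> x \<in> walls \<Longrightarrow> g (t, x) = 0" and t: "0 < t" and x: "x \<in> walls"
  shows "dt g (t, x) = 0" "i \<noteq> 3 \<Longrightarrow> dx i g (t, x) = 0"
proof -
  have "\<forall>\<^sub>F s in nhds 0. t + s > 0"
    using t by (intro eventually_nhds_in_open[of "{-t<..}", THEN eventually_mono]) auto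
  then have "\<forall>\<^sub>F s in nhds 0. g ((t, x) + s *\<^sub>R (1, 0)) = 0"
    by eventually_elim (use x z in auto)
  then show "dt g (t, x) = 0" unfolding dir_deriv_def by (subst deriv_cong_ev[where g="\<lambda>_. 0"]) auto
  assume i: "i \<noteq> 3"
  have "g ((t, x) + s *\<^sub>R (0, axis i 1)) = 0" for s
    using x t z i by (simp add: walls_def axis_def)
  then show "dx i g (t, x) = 0" unfolding dir_deriv_def by simp
qed

subsection \<open>Uniqueness of weak derivatives\<close>

text \<open>All derivatives of \<open>exp (-1/y)\<close> for \<open>y > 0\<close>, extended by zero, have this shape.\<close>

definition bump :: "real poly \<Rightarrow> real \<Rightarrow> real"
  where "bump P y = (if y > 0 then poly P (1 / y) * exp (- (1 / y)) else 0)"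

text \<open>The free power \<open>w ^ k\<close> drives the induction: \<open>pCons c P\<close>
  splits off a constant coefficient and raises \<open>k\<close> by one.\<close>

lemma poly_exp_tendsto_0: "((\<lambda>w::real. w ^ k * poly P w * exp (- w)) \<longlongrightarrow> 0) at_top"
proof (induction P arbitrary: k)
  case 0
  then show ?case by simp
next
  case (pCons c P)
  have "((\<lambda>w::real. c * (w ^ k / exp w) + w ^ Suc k * poly P w * exp (- w)) \<longlongrightarrow> c * 0 + 0) at_top"
    by (intro tendsto_intros tendsto_power_div_exp_0 pCons.IH)
  then show ?case by (simp add: algebra_simps exp_minus divide_inverse)
qed

text \<open>With w = 1/y, the derivative of P(w) exp (-w) in y is w^2 (P(w) - P'(w)) exp (-w), again
  of the same shape. At y = 0 the right difference quotient is w P(w) exp (-w), which tends to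
  0.\<close>

lemma bump_has_real_derivative:
  "(bump P has_real_derivative bump (monom 1 2 * (P - pderiv P)) y) (at y)"
proof -
  consider "y > 0" | "y < 0" | "y = 0" by linarith
  then show ?thesis
  proof cases
    case 1
    have d: "((\<lambda>y. 1 / y) has_real_derivative - (1 / y ^ 2)) (at y)"
      using DERIV_inverse[of y] 1 by (simp add: divide_inverse power_inverse numeral_2_eq_2)
    have "((\<lambda>y. poly P (1 / y) * exp (- (1 / y))) has_real_derivative
        (poly (pderiv P) (1 / y) * - (1 / y ^ 2)) * exp (- (1 / y)) +
        (exp (- (1 / y)) * - (- (1 / y ^ 2))) * poly P (1 / y)) (at y)"
      by (intro DERIV_mult DERIV_chain2[OF poly_DERIV d] DERIV_chain2[OF DERIV_exp DERIV_minus[OF d]])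
    moreover have "(poly (pderiv P) (1 / y) * - (1 / y ^ 2)) * exp (- (1 / y)) +
        (exp (- (1 / y)) * - (- (1 / y ^ 2))) * poly P (1 / y) = bump (monom 1 2 * (P - pderiv P)) y"
      using 1 by (simp add: bump_def poly_monom algebra_simps power_one_over)
    ultimately have "((\<lambda>y. poly P (1 / y) * exp (- (1 / y))) has_real_derivative
        bump (monom 1 2 * (P - pderiv P)) y) (at y)" by simp
    then show ?thesis
      by (rule DERIV_cong_ev[THEN iffD1, rotated -1])
        (use 1 in \<open>auto simp: bump_def eventually_nhds intro!: exI[of _ "{0<..}"]\<close>)
  next
    case 2
    have "((\<lambda>y::real. 0) has_real_derivative bump (monom 1 2 * (P - pderiv P)) y) (at y)"
      using 2 by (simp add: bump_def)
    then show ?thesis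
      by (rule DERIV_cong_ev[THEN iffD1, rotated -1])
        (use 2 in \<open>auto simp: bump_def eventually_nhds intro!: exI[of _ "{..<0}"]\<close>)
  next
    case 3
    have "((\<lambda>h. bump P h / h) \<longlongrightarrow> 0) (at_right 0)"
    proof -
      have "((\<lambda>h::real. (inverse h) ^ 1 * poly P (inverse h) * exp (- inverse h)) \<longlongrightarrow> 0) (at_right 0)"
        by (rule filterlim_compose[OF poly_exp_tendsto_0 filterlim_inverse_at_top_right])
      then show ?thesis
        by (rule Lim_transform_eventually)
          (auto simp: bump_def divide_inverse eventually_at_filter intro!: always_eventually)
    qed
    moreover have "((\<lambda>h. bump P h / h) \<longlongrightarrow> 0) (at_left 0)"
      by (rule Lim_transform_eventually[OF tendsto_const])
        (auto simp: bump_def eventually_at_filter intro!: always_eventually)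
    ultimately have "((\<lambda>h. bump P h / h) \<longlongrightarrow> 0) (at 0)" by (simp add: filterlim_split_at)
    then show ?thesis using 3 by (simp add: DERIV_def bump_def)
  qed
qed

text \<open>A class closed under directional differentiation: the inner derivative of the affine
  argument is absorbed into the polynomial, and the product rule stays inside the class. Hence all
  iterated partial derivatives exist and are continuous.\<close>

inductive bump_algebra :: "(real^3 \<Rightarrow> real) \<Rightarrow> bool" where
  base: "bump_algebra (\<lambda>x. bump P (c * x $ i + d))"
| add: "bump_algebra f \<Longrightarrow> bump_algebra g \<Longrightarrow> bump_algebra (\<lambda>x. f x + g x)"
| mult: "bump_algebra f \<Longrightarrow> bump_algebra g \<Longrightarrow> bump_algebra (\<lambda>x. f x * g x)"

lemma bump_smult: "bump (smult k P) y = k * bump P y"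
  by (simp add: bump_def)

lemma bump_algebra_derivative:
  assumes "bump_algebra f"
  shows "\<exists>f'. bump_algebra f' \<and> (\<forall>x. ((\<lambda>s. f (x + s *\<^sub>R b)) has_real_derivative f' x) (at 0))"
  using assms
proof induction
  case (base P c i d)
  show ?case
  proof (intro exI conjI allI)
    show "bump_algebra (\<lambda>x. bump (smult (c * b $ i) (monom 1 2 * (P - pderiv P))) (c * x $ i + d))"
      by (rule bump_algebra.base)
    fix x :: "real^3"
    have "((\<lambda>s. bump P (c * (x $ i + s * b $ i) + d)) has_real_derivative
      bump (monom 1 2 * (P - pderiv P)) (c * (x $ i + 0 * b $ i) + d) * (c * b $ i)) (at 0)"
      by (rule DERIV_chain2[OF bump_has_real_derivative]) (auto intro!: derivative_eq_intros)
    then show "((\<lambda>s. bump P (c * (x + s *\<^sub>R b) $ i + d)) has_real_derivative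
      bump (smult (c * b $ i) (monom 1 2 * (P - pderiv P))) (c * x $ i + d)) (at 0)"
      unfolding bump_smult by (simp add: mult.commute)
  qed
next
  case (add f g)
  then obtain f' g' where "bump_algebra f'" "bump_algebra g'"
    "\<And>x. ((\<lambda>s. f (x + s *\<^sub>R b)) has_real_derivative f' x) (at 0)"
    "\<And>x. ((\<lambda>s. g (x + s *\<^sub>R b)) has_real_derivative g' x) (at 0)" by blast
  then show ?case
    by (intro exI[of _ "\<lambda>x. f' x + g' x"]) (auto intro: bump_algebra.intros DERIV_add)
next
  case (mult f g)
  then obtain f' g' where "bump_algebra f'" "bump_algebra g'"
    "\<And>x. ((\<lambda>s. f (x + s *\<^sub>R b)) has_real_derivative f' x) (at 0)"
    "\<And>x. ((\<lambda>s. g (x + s *\<^sub>R b)) has_real_derivative g' x) (at 0)" by blast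
  with mult.hyps show ?case
    by (intro exI[of _ "\<lambda>x. f' x * g x + f x * g' x"])
      (auto intro!: bump_algebra.intros derivative_eq_intros)
qed

lemma bump_algebra_continuous: "bump_algebra f \<Longrightarrow> continuous_on UNIV f"
proof (induction rule: bump_algebra.induct)
  case (base P c i d)
  have "continuous_on UNIV (bump P)"
    by (intro continuous_at_imp_continuous_on ballI DERIV_isCont[OF bump_has_real_derivative])
  then show ?case by (rule continuous_on_compose2) (auto intro!: continuous_intros)
qed (auto intro!: continuous_intros)

lemma bump_algebra_smooth_open:
  assumes "bump_algebra f"
  shows "smooth_open UNIV f"
proof -
  have "bump_algebra (foldr dir_deriv bs f)" for bs
  proof (induction bs)
    case (Cons b bs)
    obtain f' where f': "bump_algebra f'"
      "\<And>x. ((\<lambda>s. foldr dir_deriv bs f (x + s *\<^sub>R b)) has_real_derivative f' x) (at 0)"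
      using bump_algebra_derivative[OF Cons, of b] by blast
    have "foldr dir_deriv (b # bs) f = f'"
      using DERIV_imp_deriv[OF f'(2)] by (auto simp: dir_deriv_def)
    then show ?case using f'(1) by simp
  qed (use assms in simp)
  then show ?thesis
    unfolding smooth_open_def real_differentiable_def
    using bump_algebra_continuous bump_algebra_derivative by blast
qed

lemma test_functionI:
  assumes "smooth_open UNIV f" "compact K" "K \<subseteq> open_slab" "\<And>x. x \<notin> K \<Longrightarrow> f x = 0"
  shows "test_function f"
  unfolding test_function_def smooth_on_def
proof
  show "\<exists>U g. open U \<and> UNIV \<subseteq> U \<and> smooth_open U g \<and> (\<forall>x\<in>UNIV. g x = f x)"
    using assms(1) by (intro exI[of _ UNIV] exI[of _ f]) simp
  show "\<exists>K. compact K \<and> K \<subseteq> open_slab \<and> (\<forall>x. x \<notin> K \<longrightarrow> f x = 0)"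
    using assms(2-) by blast
qed

text \<open>Smooth approximations of the indicator of the open box: each factor exp (-1/((n+1) y))
  tends to 1 for y > 0 and is 0 for y \<le> 0. All values lie in [0,1], as dominated convergence
  requires.\<close>

definition box_bump :: "real^3 \<Rightarrow> real^3 \<Rightarrow> nat \<Rightarrow> real^3 \<Rightarrow> real"
  where "box_bump a b n x =
    (bump 1 (Suc n * (x $ 1 - a $ 1)) * bump 1 (Suc n * (b $ 1 - x $ 1))) *
    (bump 1 (Suc n * (x $ 2 - a $ 2)) * bump 1 (Suc n * (b $ 2 - x $ 2))) *
    (bump 1 (Suc n * (x $ 3 - a $ 3)) * bump 1 (Suc n * (b $ 3 - x $ 3)))"

lemma bump_1_bounds: "0 \<le> bump 1 y" "bump 1 y \<le> 1"
  by (auto simp: bump_def)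

lemma bump_1_LIMSEQ: "(\<lambda>n. bump 1 (real (Suc n) * y)) \<longlonglongrightarrow> (if y > 0 then 1 else 0)"
proof (cases "y > 0")
  case True
  have "(\<lambda>n. exp (- (inverse (real (Suc n)) * inverse y))) \<longlonglongrightarrow> exp (- (0 * inverse y))"
    by (intro tendsto_intros LIMSEQ_inverse_real_of_nat)
  moreover have "bump 1 (real (Suc n) * y) = exp (- (inverse (real (Suc n)) * inverse y))" for n
    using True by (simp add: bump_def divide_inverse del: of_nat_Suc)
  ultimately show ?thesis using True by (simp del: of_nat_Suc)
next
  case False
  then have "\<not> real (Suc n) * y > 0" for n
    by (simp add: mult_le_0_iff not_less)
  then show ?thesis using False by (simp add: bump_def del: of_nat_Suc)
qed

lemma box_bump_bump_algebra: "bump_algebra (box_bump a b n)"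
proof -
  have *: "bump_algebra (\<lambda>x. bump 1 (Suc n * (x $ i - a $ i)))" "bump_algebra (\<lambda>x. bump 1 (Suc n * (b $ i - x $ i)))" for i
    using bump_algebra.base[of 1 "real (Suc n)" i "- real (Suc n) * a $ i"]
      bump_algebra.base[of 1 "- real (Suc n)" i "real (Suc n) * b $ i"]
    by (simp_all add: algebra_simps)
  show ?thesis unfolding box_bump_def by (intro bump_algebra.mult *)
qed

lemma box_bump_bounds: "0 \<le> box_bump a b n x" "box_bump a b n x \<le> 1"
  unfolding box_bump_def by (intro mult_nonneg_nonneg mult_le_one bump_1_bounds)+

lemma box_bump_eq_0: "x \<notin> box a b \<Longrightarrow> box_bump a b n x = 0"
proof -
  have z: "bump 1 (real (Suc n) * y) = 0" if "y \<le> 0" for y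
    using that by (simp add: bump_def zero_less_mult_iff del: of_nat_Suc)
  assume "x \<notin> box a b"
  then obtain i where "x $ i \<le> a $ i \<or> b $ i \<le> x $ i" by (auto simp: mem_box_cart not_less)
  then have "x $ i - a $ i \<le> 0 \<or> b $ i - x $ i \<le> 0" by auto
  then show ?thesis using exhaust_3[of i] z unfolding box_bump_def by (auto simp del: of_nat_Suc)
qed

lemma box_bump_LIMSEQ: "(\<lambda>n. box_bump a b n x) \<longlonglongrightarrow> indicator (box a b) x"
proof -
  have eq: "indicator (box a b) x =
    ((if x $ 1 - a $ 1 > 0 then 1 else 0) * (if b $ 1 - x $ 1 > 0 then 1 else 0)) *
    ((if x $ 2 - a $ 2 > 0 then 1 else 0) * (if b $ 2 - x $ 2 > 0 then 1 else 0)) *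
    ((if x $ 3 - a $ 3 > 0 then 1 else 0) * (if b $ 3 - x $ 3 > 0 then 1 else (0::real)))"
    by (auto simp: indicator_def mem_box_cart forall_3)
  show ?thesis
    unfolding box_bump_def eq by (intro tendsto_mult bump_1_LIMSEQ)
qed

text \<open>Dynkin's argument: boxes are stable under intersection and generate the Borel sets. The
  whole space is not a box, so complements use \<open>tot\<close>. A function with zero integral
  over every Borel set vanishes almost everywhere.\<close>

lemma AE_zero_if_box_integrals_zero:
  fixes h :: "'a::euclidean_space \<Rightarrow> real"
  assumes h: "integrable lborel h" and tot: "integral\<^sup>L lborel h = 0"
    and box: "\<And>a b. (LINT x:box a b|lborel. h x) = 0"
  shows "AE x in lborel. h x = 0"
proof (rule density_unique_real[OF h])
  fix A :: "'a set" assume "A \<in> sets lborel"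
  then have A: "A \<in> sigma_sets UNIV (range (\<lambda>(a, b). box a b))"
    by (subst (asm) sets_lborel, subst (asm) borel_eq_box) (simp add: sets_measure_of)
  have b: "sigma_sets UNIV (range (\<lambda>(a, b). box a b :: 'a set)) = sets borel"
    by (subst borel_eq_box) (simp add: sets_measure_of)
  have si: "set_integrable lborel B h" if "B \<in> sets borel" for B
    unfolding set_integrable_def by (rule integrable_mult_indicator[OF _ h]) (use that in simp)
  have int: "Int_stable (range (\<lambda>(a, b). box a b :: 'a set))"
    by (auto simp: Int_stable_def box_Int_box)
  have sub: "range (\<lambda>(a, b). box a b :: 'a set) \<subseteq> Pow UNIV" by simp
  have "(LINT x:A|lborel. h x) = 0"
    using int sub A
  proof (induction rule: sigma_sets_induct_disjoint)
    case (basic B)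
    then show ?case using box by auto
  next
    case empty
    then show ?case by (simp add: set_lebesgue_integral_def)
  next
    case (compl B)
    then have B: "B \<in> sets borel" by (simp add: b)
    have "(LINT x:B \<union> (UNIV - B)|lborel. h x) = (LINT x:B|lborel. h x) + (LINT x:UNIV - B|lborel. h x)"
      using B by (intro set_integral_Un si) auto
    then show ?case using compl tot by (simp add: set_lebesgue_integral_def)
  next
    case (union B)
    then have B: "B i \<in> sets borel" for i using b by auto
    have "(LINT x:(\<Union>i. B i)|lborel. h x) = (\<Sum>i. (LINT x:(B i)|lborel. h x))"
      using B union by (intro lebesgue_integral_countable_add si) (auto simp: disjoint_family_on_def)
    then show ?case using union by simp
  qed
  then show "(LINT x:A|lborel. h x) = (LINT x:A|lborel. 0)" by (simp add: set_lebesgue_integral_def)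
qed simp

section \<open>Test functions and the fundamental lemma of the calculus of variations\<close>

lemma test_function_smooth_open:
  assumes "test_function \<phi>"
  shows "smooth_open UNIV \<phi>"
proof -
  obtain U g where "smooth_open U g" "UNIV \<subseteq> U" "\<And>x. g x = \<phi> x"
    using assms unfolding test_function_def smooth_on_def by blast
  moreover have "U = UNIV" "g = \<phi>" using calculation by auto
  ultimately show ?thesis by simp
qed

lemma pd_eq_0_outside:
  assumes "compact K" "\<And>y. y \<notin> K \<Longrightarrow> \<phi> y = 0" "x \<notin> K"
  shows "pd i \<phi> x = 0"
proof -
  have "open (- K)" using assms(1) by (simp add: compact_imp_closed open_Compl)
  then have "\<forall>\<^sub>F s in nhds 0. x + s *\<^sub>R axis i 1 \<in> - K"
    using assms(3) by (intro eventually_line_in_open) auto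
  then have "\<forall>\<^sub>F s in nhds 0. \<phi> (x + s *\<^sub>R axis i 1) = 0"
    by eventually_elim (use assms(2) in auto)
  then show ?thesis unfolding dir_deriv_def by (subst deriv_cong_ev[where g="\<lambda>_. 0"]) auto
qed

lemma test_function_pd:
  assumes \<phi>: "test_function \<phi>"
  shows "test_function (pd i \<phi>)"
proof -
  obtain K where K: "compact K" "K \<subseteq> open_slab" "\<And>x. x \<notin> K \<Longrightarrow> \<phi> x = 0"
    using \<phi> unfolding test_function_def by blast
  show ?thesis
  proof (rule test_functionI[OF _ K(1,2)])
    show "smooth_open UNIV (pd i \<phi>)"
      using smooth_open_dir_deriv[OF test_function_smooth_open[OF \<phi>]] by (simp add: axis_in_Basis_iff)
    show "pd i \<phi> x = 0" if "x \<notin> K" for x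
      by (rule pd_eq_0_outside[OF K(1) _ that]) (rule K(3))
  qed
qed

lemma set_integrable_mult_test_function:
  assumes g: "locally_integrable g" and \<phi>: "test_function \<phi>"
  shows "set_integrable lebesgue open_slab (\<lambda>x. g x * \<phi> x)"
proof -
  obtain K where K: "compact K" "K \<subseteq> open_slab" "\<And>x. x \<notin> K \<Longrightarrow> \<phi> x = 0"
    using \<phi> unfolding test_function_def by blast
  have c: "continuous_on UNIV \<phi>" by (rule smooth_open_continuous_on[OF test_function_smooth_open[OF \<phi>]])
  then have "bounded (\<phi> ` K)"
    using K(1) by (meson compact_continuous_image compact_imp_bounded continuous_on_subset subset_UNIV)
  then obtain M where M: "\<And>x. x \<in> K \<Longrightarrow> \<bar>\<phi> x\<bar> \<le> M" unfolding bounded_iff by auto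
  have gK: "integrable lebesgue (\<lambda>x. indicator K x *\<^sub>R g x)"
    using g K unfolding locally_integrable_def set_integrable_def by blast
  have [measurable]: "\<phi> \<in> borel_measurable lebesgue"
    using borel_measurable_continuous_onI[OF c] by (simp add: measurable_completion)
  have "integrable lebesgue (\<lambda>x. (indicator K x *\<^sub>R g x) * \<phi> x)"
  proof (rule Bochner_Integration.integrable_bound)
    show "integrable lebesgue (\<lambda>x. M * norm (indicator K x *\<^sub>R g x))"
      using gK by simp
    show "(\<lambda>x. (indicator K x *\<^sub>R g x) * \<phi> x) \<in> borel_measurable lebesgue"
      using gK by (intro borel_measurable_times) auto
    have "norm ((indicator K x *\<^sub>R g x) * \<phi> x) \<le> norm (M * norm (indicator K x *\<^sub>R g x))" for x
    proof (cases "x \<in> K")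
      case True
      have "\<bar>g x\<bar> * \<bar>\<phi> x\<bar> \<le> \<bar>g x\<bar> * \<bar>M\<bar>" using M[OF True] by (intro mult_left_mono) auto
      then show ?thesis using True by (simp add: abs_mult mult.commute)
    qed simp
    then show "AE x in lebesgue. norm ((indicator K x *\<^sub>R g x) * \<phi> x) \<le> norm (M * norm (indicator K x *\<^sub>R g x))"
      by simp
  qed
  moreover have "(\<lambda>x. (indicator K x *\<^sub>R g x) * \<phi> x) = (\<lambda>x. indicator open_slab x *\<^sub>R (g x * \<phi> x))"
    using K by (intro ext, rename_tac x, case_tac "x \<in> K") auto
  ultimately show ?thesis unfolding set_integrable_def by metis
qed

text \<open>Testing with \<open>box_bump\<close> and passing to the limit shows that
  \<open>h\<close> integrates to zero over every sub-box; then
  \<open>AE_zero_if_box_integrals_zero\<close> applies to \<open>h\<close> cut off to the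
  box.\<close>

lemma AE_zero_if_test_integrals_zero_box:
  assumes h: "locally_integrable h"
    and test: "\<And>\<phi>. test_function \<phi> \<Longrightarrow> (LINT x:open_slab|lebesgue. h x * \<phi> x) = 0"
    and ab: "cbox a b \<subseteq> open_slab"
  shows "AE x in lebesgue. x \<in> box a b \<longrightarrow> h x = 0"
proof -
  have hK: "integrable lebesgue (\<lambda>x. indicator (cbox a b) x *\<^sub>R h x)"
    using h ab compact_cbox unfolding locally_integrable_def set_integrable_def by blast
  have bc: "box a b \<subseteq> cbox a b" by (rule box_subset_cbox)
  have "integrable lebesgue (\<lambda>x. indicator (box a b) x *\<^sub>R (indicator (cbox a b) x *\<^sub>R h x))"
    by (rule integrable_mult_indicator[OF _ hK]) simp
  then have hB: "integrable lebesgue (\<lambda>x. indicator (box a b) x * h x)"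
    by (rule Bochner_Integration.integrable_cong[THEN iffD1, rotated -1]) (use bc in \<open>auto simp: indicator_def\<close>)
  \<comment> \<open>The Dynkin argument works with Borel sets and \<open>lborel\<close>, while
    \<open>h\<close> is only Lebesgue measurable; \<open>h'\<close> is a Borel representative of the
    cut-off function.\<close>
  then obtain h' where h': "h' \<in> borel_measurable lborel" "AE x in lborel. indicator (box a b) x * h x = h' x"
    using completion_ex_borel_measurable_real[of "\<lambda>x. indicator (box a b) x * h x" lborel] by auto
  have AE: "AE x in lebesgue. indicator (box a b) x * h x = h' x"
    using h'(2) by (rule AE_completion)
  have m': "h' \<in> borel_measurable lebesgue" using h'(1) by (rule measurable_completion)
  have "integrable lebesgue h'"
    using hB AE m' by (subst integrable_cong_AE[symmetric]) auto
  then have ih': "integrable lborel h'" using h'(1) by (simp add: integrable_completion)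
  have zero: "(LINT x|lebesgue. indicator (box c d) x * h x) = 0" if cd: "box c d \<subseteq> box a b" for c d
  proof -
    have "(\<lambda>n. LINT x|lebesgue. indicator open_slab x *\<^sub>R (h x * box_bump c d n x)) \<longlonglongrightarrow>
      (LINT x|lebesgue. indicator (box c d) x * h x)"
    proof (rule integral_dominated_convergence)
      show "integrable lebesgue (\<lambda>x. norm (indicator (cbox a b) x *\<^sub>R h x))" using hK by simp
      have 1: "indicator open_slab x *\<^sub>R (h x * box_bump c d n x) = (indicator (cbox a b) x *\<^sub>R h x) * box_bump c d n x" for x n
      proof (cases "x \<in> box c d")
        case True
        then have "x \<in> cbox a b" "x \<in> open_slab" using cd bc ab by blast+
        then show ?thesis by simp
      qed (simp add: box_bump_eq_0)
      have "box_bump c d n \<in> borel_measurable lebesgue" for n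
        using borel_measurable_continuous_onI[OF bump_algebra_continuous[OF box_bump_bump_algebra, of c d n]]
        by (simp add: measurable_completion)
      then show "(\<lambda>x. indicator open_slab x *\<^sub>R (h x * box_bump c d n x)) \<in> borel_measurable lebesgue" for n
        unfolding 1 using hK by (intro borel_measurable_times) auto
      have m: "(\<lambda>x. indicator (box c d) x *\<^sub>R (indicator (cbox a b) x *\<^sub>R h x)) \<in> borel_measurable lebesgue"
        by (intro borel_measurable_integrable integrable_mult_indicator[OF _ hK]) simp
      have 2: "indicator (box c d) x *\<^sub>R (indicator (cbox a b) x *\<^sub>R h x) = indicator (box c d) x * h x" for x
        using subsetD[OF subset_trans[OF cd bc], of x] by (simp add: indicator_def)
      show "(\<lambda>x. indicator (box c d) x * h x) \<in> borel_measurable lebesgue" using m unfolding 2 .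
      have "(\<lambda>n. (indicator (cbox a b) x *\<^sub>R h x) * box_bump c d n x) \<longlonglongrightarrow> indicator (box c d) x * h x" for x
      proof -
        have "(\<lambda>n. (indicator (cbox a b) x *\<^sub>R h x) * box_bump c d n x) \<longlonglongrightarrow>
          (indicator (cbox a b) x *\<^sub>R h x) * indicator (box c d) x"
          by (intro tendsto_intros box_bump_LIMSEQ)
        also have "(indicator (cbox a b) x *\<^sub>R h x) * indicator (box c d) x = indicator (box c d) x * h x"
          using subsetD[OF subset_trans[OF cd bc], of x] by (simp add: indicator_def)
        finally show ?thesis .
      qed
      then show "AE x in lebesgue. (\<lambda>n. indicator open_slab x *\<^sub>R (h x * box_bump c d n x)) \<longlonglongrightarrow> indicator (box c d) x * h x"
        unfolding 1 by simp
      have "norm ((indicator (cbox a b) x *\<^sub>R h x) * box_bump c d n x) \<le> norm (indicator (cbox a b) x *\<^sub>R h x)" for x n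
        unfolding norm_mult by (rule mult_right_le_one_le) (use box_bump_bounds[of c d n x] in auto)
      then show "AE x in lebesgue. norm (indicator open_slab x *\<^sub>R (h x * box_bump c d n x)) \<le> norm (indicator (cbox a b) x *\<^sub>R h x)" for n
        unfolding 1 by simp
    qed
    moreover have "(LINT x|lebesgue. indicator open_slab x *\<^sub>R (h x * box_bump c d n x)) = 0" for n
    proof -
      have "box_bump c d n x = 0" if "x \<notin> cbox a b" for x
        using that cd bc by (intro box_bump_eq_0) blast
      then have "test_function (box_bump c d n)"
        by (rule test_functionI[OF bump_algebra_smooth_open[OF box_bump_bump_algebra] compact_cbox ab])
      from test[OF this] show ?thesis by (simp add: set_lebesgue_integral_def)
    qed
    ultimately show ?thesis using LIMSEQ_unique[OF _ tendsto_const[of 0]] by simp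
  qed
  have "AE x in lborel. h' x = 0"
  proof (rule AE_zero_if_box_integrals_zero[OF ih'])
    show "integral\<^sup>L lborel h' = 0"
    proof -
      have "integral\<^sup>L lborel h' = integral\<^sup>L lebesgue h'" by (rule integral_completion[OF h'(1), symmetric])
      also have "\<dots> = (LINT x|lebesgue. indicator (box a b) x * h x)"
        by (rule integral_cong_AE[OF _ m' AE, symmetric]) (rule borel_measurable_integrable[OF hB])
      finally show ?thesis using zero[of a b] by simp
    qed
    fix c d :: "real^3"
    obtain e f where ef: "box a b \<inter> box c d = box e f" unfolding box_Int_box by blast
    have "(LINT x:box c d|lborel. h' x) = (LINT x|lebesgue. indicator (box c d) x * h' x)"
      unfolding set_lebesgue_integral_def real_scaleR_def
      by (rule integral_completion[symmetric], rule borel_measurable_times[OF borel_measurable_indicator h'(1)]) simp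
    also have "\<dots> = (LINT x|lebesgue. indicator (box c d) x * (indicator (box a b) x * h x))"
    proof (rule integral_cong_AE)
      have i: "(indicator (box c d) :: _ \<Rightarrow> real) \<in> borel_measurable lebesgue"
        by (rule borel_measurable_indicator) simp
      show "(\<lambda>x. indicator (box c d) x * h' x) \<in> borel_measurable lebesgue"
        by (rule borel_measurable_times[OF i m'])
      show "(\<lambda>x. indicator (box c d) x * (indicator (box a b) x * h x)) \<in> borel_measurable lebesgue"
        by (rule borel_measurable_times[OF i borel_measurable_integrable[OF hB]])
      show "AE x in lebesgue. indicator (box c d) x * h' x = indicator (box c d) x * (indicator (box a b) x * h x)"
        using AE by eventually_elim simp
    qed
    also have "\<dots> = (LINT x|lebesgue. indicator (box e f) x * h x)"
      unfolding ef[symmetric] indicator_inter_arith by (simp add: mult_ac)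
    also have "\<dots> = 0" using ef by (intro zero) auto
    finally show "(LINT x:box c d|lborel. h' x) = 0" .
  qed
  then have "AE x in lebesgue. h' x = 0" by (rule AE_completion)
  with AE show ?thesis by eventually_elim (auto split: split_indicator_asm)
qed

lemma AE_zero_if_test_integrals_zero:
  assumes h: "locally_integrable h"
    and test: "\<And>\<phi>. test_function \<phi> \<Longrightarrow> (LINT x:open_slab|lebesgue. h x * \<phi> x) = 0"
  shows "AE x in lebesgue. x \<in> open_slab \<longrightarrow> h x = 0"
proof -
  \<comment> \<open>Boxes at distance 1/(n+1) from the walls, growing horizontally, exhaust the open
    slab. The first ones are degenerate, which does no harm.\<close>
  define a b :: "nat \<Rightarrow> real^3"
    where "a n = vector [- real (Suc n), - real (Suc n), 1 / real (Suc n)]"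
      and "b n = vector [real (Suc n), real (Suc n), 1 - 1 / real (Suc n)]" for n
  have "cbox (a n) (b n) \<subseteq> open_slab" for n
  proof
    fix x assume "x \<in> cbox (a n) (b n)"
    then have x: "1 / real (Suc n) \<le> x $ 3" "x $ 3 \<le> 1 - 1 / real (Suc n)"
      by (auto simp: mem_box_cart a_def b_def forall_3 vector_3 simp del: of_nat_Suc)
    moreover have "1 / real (Suc n) > 0" by simp
    ultimately have "0 < x $ 3" "x $ 3 < 1" by linarith+
    then show "x \<in> open_slab" by (simp add: open_slab_def)
  qed
  then have "AE x in lebesgue. \<forall>n. x \<in> box (a n) (b n) \<longrightarrow> h x = 0"
    unfolding AE_all_countable by (intro allI AE_zero_if_test_integrals_zero_box[OF h test])
  then show ?thesis
  proof eventually_elim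
    case (elim x)
    show ?case
    proof
      assume x: "x \<in> open_slab"
      obtain n where n: "real n > Max {\<bar>x $ 1\<bar>, \<bar>x $ 2\<bar>, 1 / x $ 3, 1 / (1 - x $ 3)}"
        using reals_Archimedean2 by blast
      then have "x $ 3 > 1 / real (Suc n)" "1 - x $ 3 > 1 / real (Suc n)"
        using x by (auto simp: open_slab_def field_simps)
      then have "x \<in> box (a n) (b n)"
        using n by (auto simp: mem_box_cart a_def b_def forall_3 vector_3)
      then show "h x = 0" using elim by blast
    qed
  qed
qed

lemma open_slab_lebesgue [measurable]: "open_slab \<in> sets lebesgue"
  using borel_open[OF open_open_slab] by (simp add: sets_completionI_sets)

lemma has_weak_pd_unique:
  assumes g: "has_weak_pd i f g" and g': "has_weak_pd i f g'"
  shows "AE x in lebesgue_on open_slab. g x = g' x"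
proof -
  have l: "locally_integrable g" "locally_integrable g'" using g g' by (auto simp: has_weak_pd_def)
  have "AE x in lebesgue. x \<in> open_slab \<longrightarrow> g x - g' x = 0"
  proof (rule AE_zero_if_test_integrals_zero)
    show "locally_integrable (\<lambda>x. g x - g' x)"
      unfolding locally_integrable_def
    proof (intro allI impI set_integral_diff(1))
      fix K assume "compact K \<and> K \<subseteq> open_slab"
      then show "g absolutely_integrable_on K" "g' absolutely_integrable_on K"
        using l unfolding locally_integrable_def by blast+
    qed
    fix \<phi> assume \<phi>: "test_function \<phi>"
    have "(LINT x:open_slab|lebesgue. g x * \<phi> x) = (LINT x:open_slab|lebesgue. g' x * \<phi> x)"
      using g g' \<phi> unfolding has_weak_pd_def by fastforce
    then show "(LINT x:open_slab|lebesgue. (g x - g' x) * \<phi> x) = 0"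
      using set_integral_diff(2)[OF set_integrable_mult_test_function[OF l(1) \<phi>] set_integrable_mult_test_function[OF l(2) \<phi>]]
      by (simp add: algebra_simps)
  qed
  then show ?thesis by (subst AE_restrict_space_iff) auto
qed

lemma AE_open_slab_negligible:
  assumes "AE x in lebesgue_on open_slab. P x"
  obtains N where "negligible N" "\<And>x. x \<in> open_slab - N \<Longrightarrow> P x"
proof -
  have "AE x in lebesgue. x \<in> open_slab \<longrightarrow> P x"
    using assms by (subst (asm) AE_restrict_space_iff) auto
  then obtain N where "N \<in> null_sets lebesgue" "{x. \<not> (x \<in> open_slab \<longrightarrow> P x)} \<subseteq> N"
    unfolding eventually_ae_filter by auto
  then show ?thesis using that[of N] by (auto simp: negligible_iff_null_sets)
qed

section \<open>Classical derivatives are weak derivatives\<close>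

lemma locally_integrable_AE_continuous:
  assumes f: "continuous_on open_slab f" and ae: "AE x in lebesgue_on open_slab. f' x = f x"
  shows "locally_integrable f'"
  unfolding locally_integrable_def
proof (intro allI impI)
  fix K assume K: "compact K \<and> K \<subseteq> open_slab"
  obtain N where N: "negligible N" "\<And>x. x \<in> open_slab - N \<Longrightarrow> f' x = f x"
    using AE_open_slab_negligible[OF ae] by blast
  have i: "integrable lborel (\<lambda>x. indicator K x *\<^sub>R f x)"
    using borel_integrable_compact K f continuous_on_subset by blast
  then have "integrable lebesgue (\<lambda>x. indicator K x *\<^sub>R f x)"
    by (subst integrable_completion) auto
  then have "f absolutely_integrable_on K" by (simp add: set_integrable_def)
  then show "f' absolutely_integrable_on K"
    by (rule absolutely_integrable_spike[OF _ N(1)]) (use N(2) K in auto)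
qed

lemma compact_open_slab_subset_box:
  assumes K: "compact K" "K \<subseteq> open_slab"
  obtains a b where "cbox a b \<subseteq> open_slab" "K \<subseteq> box a b" "\<And>i. a $ i \<le> b $ i"
proof -
  \<comment> \<open>A point of the mid-plane makes the set nonempty, so that the third coordinate
    attains its extrema on it.\<close>
  define K' where "K' = insert (vector [0, 0, 1/2]) K"
  have K': "compact K'" "K' \<subseteq> open_slab" "K' \<noteq> {}"
    using K by (auto simp: K'_def open_slab_def vector_3)
  have c: "continuous_on K' (\<lambda>x. x $ 3)" by (intro continuous_intros)
  obtain p where p: "p \<in> K'" "\<And>x. x \<in> K' \<Longrightarrow> p $ 3 \<le> x $ 3"
    using continuous_attains_inf[OF K'(1,3) c] by blast
  obtain q where q: "q \<in> K'" "\<And>x. x \<in> K' \<Longrightarrow> x $ 3 \<le> q $ 3"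
    using continuous_attains_sup[OF K'(1,3) c] by blast
  obtain B where B: "\<And>x. x \<in> K' \<Longrightarrow> norm x \<le> B" "B > 0"
    using compact_imp_bounded[OF K'(1)] unfolding bounded_pos by auto
  have pq: "0 < p $ 3" "q $ 3 < 1" "p $ 3 \<le> q $ 3" using p q K'(2) by (auto simp: open_slab_def)
  \<comment> \<open>Vertically the box ends halfway between each wall and the extreme height in
    \<open>K'\<close>; this keeps it inside the open slab and \<open>K\<close> in its
    interior.\<close>
  define a b :: "real^3" where "a = vector [- (B + 1), - (B + 1), p $ 3 / 2]" and "b = vector [B + 1, B + 1, (1 + q $ 3) / 2]"
  show ?thesis
  proof
    show "cbox a b \<subseteq> open_slab" using pq by (auto simp: a_def b_def mem_box_cart forall_3 vector_3 open_slab_def)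
    show "a $ i \<le> b $ i" for i using exhaust_3[of i] pq B(2) by (auto simp: a_def b_def vector_3)
    show "K \<subseteq> box a b"
    proof
      fix x assume "x \<in> K"
      then have x: "x \<in> K'" by (simp add: K'_def)
      have "\<bar>x $ i\<bar> < B + 1" for i using component_le_norm_cart[of x i] B(1)[OF x] by simp
      then have "x $ i < B + 1" "- (B + 1) < x $ i" for i unfolding abs_less_iff by (meson minus_less_iff)+
      then show "x \<in> box a b" using p(2)[OF x] q(2)[OF x] pq
        by (auto simp: a_def b_def mem_box_cart forall_3 vector_3)
    qed
  qed
qed

lemma has_weak_pd_classical:
  assumes f: "continuous_on open_slab f" and F: "continuous_on open_slab F"
    and deriv: "\<And>x. x \<in> open_slab \<Longrightarrow> ((\<lambda>s. f (x + s *\<^sub>R axis i 1)) has_real_derivative F x) (at 0)"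
    and f': "AE x in lebesgue_on open_slab. f' x = f x" and F': "AE x in lebesgue_on open_slab. F' x = F x"
  shows "has_weak_pd i f' F'"
  unfolding has_weak_pd_def
proof (intro conjI allI impI)
  show l: "locally_integrable f'" "locally_integrable F'"
    using locally_integrable_AE_continuous f F f' F' by blast+
  fix \<phi> assume \<phi>: "test_function \<phi>"
  obtain K where K: "compact K" "K \<subseteq> open_slab" "\<And>x. x \<notin> K \<Longrightarrow> \<phi> x = 0"
    using \<phi> unfolding test_function_def by blast
  obtain a b where ab: "cbox a b \<subseteq> open_slab" "K \<subseteq> box a b" "\<And>i. a $ i \<le> b $ i"
    using compact_open_slab_subset_box[OF K(1,2)] by blast
  obtain N1 where N1: "negligible N1" "\<And>x. x \<in> open_slab - N1 \<Longrightarrow> f' x = f x"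
    using AE_open_slab_negligible[OF f'] by blast
  obtain N2 where N2: "negligible N2" "\<And>x. x \<in> open_slab - N2 \<Longrightarrow> F' x = F x"
    using AE_open_slab_negligible[OF F'] by blast
  have sm: "smooth_open UNIV \<phi>" by (rule test_function_smooth_open[OF \<phi>])
  have d\<phi>: "((\<lambda>s. \<phi> (x + s *\<^sub>R axis i 1)) has_real_derivative pd i \<phi> x) (at 0)" for x
    by (rule smooth_open_has_real_derivative_0[OF sm]) (auto simp: axis_in_Basis_iff)
  have c\<phi>: "continuous_on S \<phi>" "continuous_on S (pd i \<phi>)" for S
    using smooth_open_continuous_on[OF sm] smooth_open_continuous_on[OF test_function_smooth_open[OF test_function_pd[OF \<phi>]]]
      continuous_on_subset by blast+
  have out: "\<phi> x = 0" "pd i \<phi> x = 0" if "x \<notin> box a b" for x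
    using that K(3) ab(2) pd_eq_0_outside[OF K(1), of \<phi> x i] by blast+
  define k where "k = (\<lambda>x. F x * \<phi> x + f x * pd i \<phi> x)"
  note si = set_integrable_mult_test_function[OF l(1) test_function_pd[OF \<phi>, of i]]
    set_integrable_mult_test_function[OF l(2) \<phi>]
  have "(LINT x:open_slab|lebesgue. f' x * pd i \<phi> x) + (LINT x:open_slab|lebesgue. F' x * \<phi> x) =
      (LINT x:open_slab|lebesgue. f' x * pd i \<phi> x + F' x * \<phi> x)"
    by (rule set_integral_add(2)[OF si, symmetric])
  also have "\<dots> = integral open_slab (\<lambda>x. f' x * pd i \<phi> x + F' x * \<phi> x)"
    by (rule set_lebesgue_integral_eq_integral(2)[OF set_integral_add(1)[OF si]])
  also have "\<dots> = integral open_slab k"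
    by (rule integral_spike[OF negligible_Un[OF N1(1) N2(1)]]) (use N1(2) N2(2) in \<open>auto simp: k_def\<close>)
  also have "\<dots> = integral (cbox a b) k"
  proof -
    have "(\<lambda>x. if x \<in> open_slab then k x else 0) = (\<lambda>x. if x \<in> cbox a b then k x else 0)"
    proof
      fix x
      have "k x = 0" if "x \<notin> cbox a b" using out[of x] subsetD[OF box_subset_cbox, of x a b] that unfolding k_def by (metis add_0 mult_zero_right)
      then show "(if x \<in> open_slab then k x else 0) = (if x \<in> cbox a b then k x else 0)"
        using ab(1) by auto
    qed
    then show ?thesis
      using integral_restrict_UNIV[of open_slab k] integral_restrict_UNIV[of "cbox a b" k] by simp
  qed
  also have "\<dots> = 0"
  proof (rule integral_partial_deriv_cbox[of a b "\<lambda>x. f x * \<phi> x" k i])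
    show "continuous_on (cbox a b) (\<lambda>x. f x * \<phi> x)" "continuous_on (cbox a b) k"
      unfolding k_def by (intro continuous_intros c\<phi> continuous_on_subset[OF f ab(1)] continuous_on_subset[OF F ab(1)])+
    show "a $ i \<le> b $ i" by (rule ab)
    show "((\<lambda>s. f (x + s *\<^sub>R axis i 1) * \<phi> (x + s *\<^sub>R axis i 1)) has_real_derivative k x) (at 0)"
      if "x \<in> cbox a b" for x
      using DERIV_mult[OF deriv[OF subsetD[OF ab(1) that]] d\<phi>] by (simp add: k_def add.commute mult.commute)
    fix x assume x: "x \<in> cbox a b" "x $ i = a $ i"
    have "x \<notin> box a b" "x + (b $ i - a $ i) *\<^sub>R axis i 1 \<notin> box a b"
      using x by (auto simp: mem_box_cart intro!: exI[of _ i])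
    then show "f (x + (b $ i - a $ i) *\<^sub>R axis i 1) * \<phi> (x + (b $ i - a $ i) *\<^sub>R axis i 1) = f x * \<phi> x"
      using out by simp
  qed
  finally show "(LINT x:open_slab|lebesgue. f' x * pd i \<phi> x) = - (LINT x:open_slab|lebesgue. F' x * \<phi> x)"
    by simp
qed

lemma wpd_AE_eq:
  assumes "has_weak_pd i f g"
  shows "AE x in lebesgue_on open_slab. wpd i f x = g x"
proof -
  have "has_weak_pd i f (wpd i f)" unfolding wpd_def by (rule someI[of "has_weak_pd i f", OF assms])
  then show ?thesis using has_weak_pd_unique assms by blast
qed

subsection \<open>Integral inequalities\<close>

text \<open>Removes the positive \<open>e\<close> that keeps divisors away from zero in the proofs
  of the Cauchy-Schwarz and Hoelder inequalities.\<close>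

lemma le_limit_at_right_0:
  fixes f :: "real \<Rightarrow> real"
  assumes "\<And>e. e > 0 \<Longrightarrow> I \<le> f e" and f: "(f \<longlongrightarrow> f 0) (at_right 0)"
  shows "I \<le> f 0"
  by (rule tendsto_lowerbound[OF f])
    (use assms(1) in \<open>auto simp: eventually_at_filter intro!: always_eventually\<close>)

text \<open>A real-valued L2 norm for continuous fields. With a general codomain it serves scalars,
  gradients, matrices (Frobenius norm) and pairs of a value and a gradient.\<close>

definition L2n :: "'a::euclidean_space set \<Rightarrow> ('a \<Rightarrow> 'b::real_normed_vector) \<Rightarrow> real"
  where "L2n S f = sqrt (integral S (\<lambda>x. (norm (f x))\<^sup>2))"

lemma integral_nonneg_pointwise:
  fixes h :: "'a::euclidean_space \<Rightarrow> real"
  assumes "\<And>x. x \<in> S \<Longrightarrow> 0 \<le> h x"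
  shows "0 \<le> integral S h"
  by (cases "h integrable_on S") (use assms in \<open>auto intro!: integral_nonneg simp: not_integrable_integral\<close>)

lemma L2n_nonneg: "0 \<le> L2n S f"
  unfolding L2n_def by (simp add: integral_nonneg_pointwise)

lemma L2n_power2: "(L2n S f)\<^sup>2 = integral S (\<lambda>x. (norm (f x))\<^sup>2)"
  unfolding L2n_def by (simp add: integral_nonneg_pointwise)

lemma L2n_scaleR: "L2n S (\<lambda>x. c *\<^sub>R f x) = \<bar>c\<bar> * L2n S f"
  by (simp add: L2n_def power_mult_distrib real_sqrt_mult)

lemma L2n_cong: "(\<And>x. x \<in> S \<Longrightarrow> norm (f x) = norm (g x)) \<Longrightarrow> L2n S f = L2n S g"
  unfolding L2n_def by (auto intro: integral_cong)

lemma L2n_mono: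
  assumes "continuous_on (cbox a b) f" "continuous_on (cbox a b) g"
    and "\<And>x. x \<in> cbox a b \<Longrightarrow> norm (f x) \<le> norm (g x)"
  shows "L2n (cbox a b) f \<le> L2n (cbox a b) g"
  unfolding L2n_def
  by (intro real_sqrt_le_mono integral_le integrable_continuous continuous_intros assms power_mono norm_ge_zero)

lemma L2n_Cauchy_Schwarz:
  fixes f g :: "'a::euclidean_space \<Rightarrow> 'b::real_inner"
  assumes f: "continuous_on (cbox a b) f" and g: "continuous_on (cbox a b) g"
  shows "integral (cbox a b) (\<lambda>x. f x \<bullet> g x) \<le> L2n (cbox a b) f * L2n (cbox a b) g"
proof -
  let ?A = "L2n (cbox a b) f" and ?B = "L2n (cbox a b) g"
  have A0: "?A \<ge> 0" and B0: "?B \<ge> 0" by (rule L2n_nonneg)+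
  have "integral (cbox a b) (\<lambda>x. f x \<bullet> g x) \<le> (?A + e) * (?B + e)" if e: "e > 0" for e
  proof -
    \<comment> \<open>Weights for Young's inequality, with \<open>4 * p * q = 1\<close>, that
      balance the two integrals; adding \<open>e\<close> permits a norm to be zero.\<close>
    define p where "p = (?B + e) / (?A + e) / 2"
    define q where "q = (?A + e) / (?B + e) / 2"
    have pq: "p > 0" "q > 0" using A0 B0 e by (auto simp: p_def q_def)
    have pt: "f x \<bullet> g x \<le> p * (norm (f x))\<^sup>2 + q * (norm (g x))\<^sup>2" for x
    proof -
      have "f x \<bullet> g x \<le> norm (f x) * norm (g x)" by (rule norm_cauchy_schwarz)
      also have "\<dots> \<le> p * (norm (f x))\<^sup>2 + q * (norm (g x))\<^sup>2"
      proof -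
        have "4 * p * q = 1" using A0 B0 e by (simp add: p_def q_def) (simp add: algebra_simps)
        moreover have "0 \<le> (2 * p * norm (f x) - norm (g x))\<^sup>2" by simp
        moreover have "4 * p * (p * (norm (f x))\<^sup>2 + q * (norm (g x))\<^sup>2 - norm (f x) * norm (g x)) =
          (2 * p * norm (f x) - norm (g x))\<^sup>2 + (4 * p * q - 1) * (norm (g x))\<^sup>2"
          by (simp add: power2_eq_square algebra_simps)
        ultimately have "0 \<le> 4 * p * (p * (norm (f x))\<^sup>2 + q * (norm (g x))\<^sup>2 - norm (f x) * norm (g x))"
          by simp
        then show ?thesis using pq by (simp add: zero_le_mult_iff)
      qed
      finally show ?thesis .
    qed
    have "integral (cbox a b) (\<lambda>x. f x \<bullet> g x) \<le> integral (cbox a b) (\<lambda>x. p * (norm (f x))\<^sup>2 + q * (norm (g x))\<^sup>2)"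
      by (intro integral_le integrable_continuous continuous_intros f g pt)
    also have "\<dots> = p * ?A\<^sup>2 + q * ?B\<^sup>2"
      unfolding L2n_power2 by (subst integral_add) (auto intro!: integrable_continuous continuous_intros f g)
    also have "\<dots> \<le> p * (?A + e)\<^sup>2 + q * (?B + e)\<^sup>2"
      using pq A0 B0 e by (intro add_mono mult_left_mono power_mono) auto
    also have "\<dots> = (?A + e) * (?B + e)"
    proof -
      have *: "b / a / 2 * a\<^sup>2 = a * b / 2" if "a > 0" for a b :: real
        using that by (simp add: power2_eq_square)
      have "p * (?A + e)\<^sup>2 = (?A + e) * (?B + e) / 2" "q * (?B + e)\<^sup>2 = (?B + e) * (?A + e) / 2"
        unfolding p_def q_def using A0 B0 e by (intro *; simp)+
      then show ?thesis by (simp add: mult.commute)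
    qed
    finally show ?thesis .
  qed
  then have "integral (cbox a b) (\<lambda>x. f x \<bullet> g x) \<le> (?A + 0) * (?B + 0)"
    by (rule le_limit_at_right_0) (auto intro!: tendsto_eq_intros)
  then show ?thesis by simp
qed

lemma L2n_triangle:
  fixes f g :: "'a::euclidean_space \<Rightarrow> 'b::real_inner"
  assumes f: "continuous_on (cbox a b) f" and g: "continuous_on (cbox a b) g"
  shows "L2n (cbox a b) (\<lambda>x. f x + g x) \<le> L2n (cbox a b) f + L2n (cbox a b) g"
proof (rule power2_le_imp_le)
  let ?A = "L2n (cbox a b) f" and ?B = "L2n (cbox a b) g"
  have "(L2n (cbox a b) (\<lambda>x. f x + g x))\<^sup>2 =
      integral (cbox a b) (\<lambda>x. (norm (f x))\<^sup>2 + ((norm (g x))\<^sup>2 + 2 * (f x \<bullet> g x)))"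
    unfolding L2n_power2 by (simp add: power2_norm_eq_inner inner_simps inner_commute algebra_simps)
  also have "\<dots> = ?A\<^sup>2 + (?B\<^sup>2 + 2 * integral (cbox a b) (\<lambda>x. f x \<bullet> g x))"
    unfolding L2n_power2
    by (subst integral_add, (intro integrable_continuous continuous_intros f g)+)+ simp
  also have "\<dots> \<le> (?A + ?B)\<^sup>2"
    using L2n_Cauchy_Schwarz[OF f g] by (simp add: power2_sum)
  finally show "(L2n (cbox a b) (\<lambda>x. f x + g x))\<^sup>2 \<le> (?A + ?B)\<^sup>2" .
qed (simp add: L2n_nonneg)

text \<open>Hoelder's inequality with 1/2 = 1/3 + 1/6. The functions are normalised by their
  enlarged norms and Young's inequality with exponents 3/2 and 3 is applied pointwise.\<close>

lemma Holder_3_6: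
  fixes f g :: "'a::euclidean_space \<Rightarrow> real"
  assumes f: "continuous_on (cbox a b) f" and g: "continuous_on (cbox a b) g"
    and f0: "\<And>x. 0 \<le> f x" and g0: "\<And>x. 0 \<le> g x"
  shows "integral (cbox a b) (\<lambda>x. (f x * g x)\<^sup>2) \<le>
    (root 3 (integral (cbox a b) (\<lambda>x. f x ^ 3)) * root 6 (integral (cbox a b) (\<lambda>x. g x ^ 6)))\<^sup>2"
proof -
  define A where "A = root 3 (integral (cbox a b) (\<lambda>x. f x ^ 3))"
  define B where "B = root 6 (integral (cbox a b) (\<lambda>x. g x ^ 6))"
  have nn: "0 \<le> integral (cbox a b) (\<lambda>x. f x ^ 3)" "0 \<le> integral (cbox a b) (\<lambda>x. g x ^ 6)"
    by (auto intro!: integral_nonneg_pointwise f0)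
  have A: "A \<ge> 0" "integral (cbox a b) (\<lambda>x. f x ^ 3) = A ^ 3"
    and B: "B \<ge> 0" "integral (cbox a b) (\<lambda>x. g x ^ 6) = B ^ 6"
    using nn by (auto simp: A_def B_def real_root_pow_pos2)
  have "integral (cbox a b) (\<lambda>x. (f x * g x)\<^sup>2) \<le> ((A + e) * (B + e))\<^sup>2" if e: "e > 0" for e
  proof -
    define A' where "A' = A + e"
    define B' where "B' = B + e"
    have A': "A' > 0" "A \<le> A'" and B': "B' > 0" "B \<le> B'" using A B e by (auto simp: A'_def B'_def)
    define p where "p = (A' * B')\<^sup>2 * 2 / (3 * A' ^ 3)"
    define q where "q = (A' * B')\<^sup>2 / (3 * B' ^ 6)"
    have pq: "p \<ge> 0" "q \<ge> 0" using A' B' by (auto simp: p_def q_def)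
    have pt: "(f x * g x)\<^sup>2 \<le> p * f x ^ 3 + q * g x ^ 6" for x
    proof -
      define s where "s = f x / A'"
      define r where "r = (g x / B')\<^sup>2"
      have sr: "s \<ge> 0" "r \<ge> 0" using f0 g0 A' B' by (auto simp: s_def r_def)
      \<comment> \<open>The product expands to \<open>2 * s ^ 3 - 3 * s ^ 2 * r + r ^ 3\<close>,
        which is Young's inequality for \<open>s ^ 2 * r\<close>.\<close>
      have "0 \<le> (s - r)\<^sup>2 * (2 * s + r)" using sr by simp
      then have "s\<^sup>2 * r \<le> 2 / 3 * s ^ 3 + 1 / 3 * r ^ 3"
        by (simp add: power2_eq_square power3_eq_cube algebra_simps)
      then have "(A' * B')\<^sup>2 * (s\<^sup>2 * r) \<le> (A' * B')\<^sup>2 * (2 / 3 * s ^ 3 + 1 / 3 * r ^ 3)"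
        by (rule mult_left_mono) simp
      moreover have "(A' * B')\<^sup>2 * (s\<^sup>2 * r) = (f x * g x)\<^sup>2"
        using A' B' by (simp add: s_def r_def power_mult_distrib power_divide)
      moreover have "(A' * B')\<^sup>2 * (2 / 3 * s ^ 3 + 1 / 3 * r ^ 3) = p * f x ^ 3 + q * g x ^ 6"
        by (simp add: s_def r_def p_def q_def power_divide power_mult[symmetric] distrib_left)
      ultimately show ?thesis by simp
    qed
    have "integral (cbox a b) (\<lambda>x. (f x * g x)\<^sup>2) \<le> integral (cbox a b) (\<lambda>x. p * f x ^ 3 + q * g x ^ 6)"
      by (intro integral_le integrable_continuous continuous_intros f g pt)
    also have "\<dots> = p * A ^ 3 + q * B ^ 6"
      unfolding A(2)[symmetric] B(2)[symmetric]
      by (subst integral_add) (auto intro!: integrable_continuous continuous_intros f g)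
    also have "\<dots> \<le> p * A' ^ 3 + q * B' ^ 6"
      using pq A A' B B' by (intro add_mono mult_left_mono power_mono) auto
    also have "\<dots> = (A' * B')\<^sup>2"
      using A' B' by (simp add: p_def q_def)
    finally show ?thesis by (simp add: A'_def B'_def)
  qed
  then have "integral (cbox a b) (\<lambda>x. (f x * g x)\<^sup>2) \<le> ((A + 0) * (B + 0))\<^sup>2"
    by (rule le_limit_at_right_0) (auto intro!: tendsto_eq_intros)
  then show ?thesis by (simp add: A_def B_def)
qed

lemma quotient_tendsto_derivative_quotient:
  fixes f g :: "real \<Rightarrow> real"
  assumes "(f has_real_derivative f') (at c)" "(g has_real_derivative g') (at c)"
    and "f c = 0" "g c = 0" "g' \<noteq> 0"
  shows "((\<lambda>x. f x / g x) \<longlongrightarrow> f' / g') (at c)"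
proof -
  have "((\<lambda>x. ((f x - f c) / (x - c)) / ((g x - g c) / (x - c))) \<longlongrightarrow> f' / g') (at c)"
    using assms by (intro tendsto_divide) (auto simp: has_field_derivative_iff)
  then show ?thesis
    by (rule Lim_transform_eventually)
      (use assms in \<open>auto simp: eventually_at_filter intro!: always_eventually\<close>)
qed

text \<open>
  With \<open>G = \<pi> cot (\<pi> z) w\<^sup>2\<close> one has \<open>w'\<^sup>2 - \<pi>\<^sup>2 w\<^sup>2 = G' + (w' - \<pi> cot (\<pi> z) w)\<^sup>2\<close>, and \<open>G\<close> vanishes at both
  endpoints.
\<close>

lemma Wirtinger_inequality:
  fixes w w' :: "real \<Rightarrow> real"
  assumes w: "\<And>z. z \<in> {0..1} \<Longrightarrow> (w has_real_derivative w' z) (at z)"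
    and w': "continuous_on {0..1} w'" and bc: "w 0 = 0" "w 1 = 0"
  shows "pi\<^sup>2 * integral {0..1} (\<lambda>z. (w z)\<^sup>2) \<le> integral {0..1} (\<lambda>z. (w' z)\<^sup>2)"
proof -
  have cw: "continuous_on {0..1} w"
    using w by (intro continuous_at_imp_continuous_on ballI DERIV_isCont)
  define G where "G = (\<lambda>z. pi * cos (pi * z) * w z * (w z / sin (pi * z)))"
  define G' where "G' = (\<lambda>z. (w' z)\<^sup>2 - pi\<^sup>2 * (w z)\<^sup>2 - (w' z - pi * (cos (pi * z) / sin (pi * z)) * w z)\<^sup>2)"
  have sin_pos: "sin (pi * z) > 0" if "0 < z" "z < 1" for z
    using that by (intro sin_gt_zero) auto
  \<comment> \<open>At the endpoints numerator and sine both vanish to first order, so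
    \<open>w z / sin (pi * z)\<close> has a finite limit, and the remaining factor \<open>w\<close>
    tends to zero. This matches \<open>G z = 0\<close> there.\<close>
  have end0: "isCont G z" if z: "z = 0 \<or> z = 1" for z
  proof -
    have zz: "z \<in> {0..1}" "w z = 0" "sin (pi * z) = 0" "cos (pi * z) \<noteq> 0" using z bc by auto
    have s: "((\<lambda>z. sin (pi * z)) has_real_derivative cos (pi * z) * pi) (at z)"
      by (auto intro!: derivative_eq_intros)
    have "((\<lambda>z. w z / sin (pi * z)) \<longlongrightarrow> w' z / (cos (pi * z) * pi)) (at z)"
      by (rule quotient_tendsto_derivative_quotient[OF w[OF zz(1)] s]) (use zz in auto)
    note L = this
    have w0: "(w \<longlongrightarrow> 0) (at z)" using DERIV_isCont[OF w[OF zz(1)]] zz(2) by (simp add: isCont_def)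
    have "((\<lambda>z. pi * cos (pi * z)) \<longlongrightarrow> pi * cos (pi * z)) (at z)" by (intro tendsto_intros)
    then have "(G \<longlongrightarrow> pi * cos (pi * z) * 0 * (w' z / (cos (pi * z) * pi))) (at z)"
      unfolding G_def by (intro tendsto_mult[OF tendsto_mult[OF _ w0] L])
    then show ?thesis using zz by (simp add: isCont_def G_def)
  qed
  have dG: "(G has_real_derivative G' z) (at z)" if z: "0 < z" "z < 1" for z
  proof -
    have s: "sin (pi * z) \<noteq> 0" using sin_pos[OF z] by simp
    define c s where "c = cos (pi * z)" and "s = sin (pi * z)"
    have s0: "s \<noteq> 0" and cs: "c\<^sup>2 = 1 - s\<^sup>2" using sin_pos[OF z] by (auto simp: c_def s_def cos_squared_eq)
    have dw: "(w has_real_derivative w' z) (at z)" using w z by simp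
    have ds: "((\<lambda>z. sin (pi * z)) has_real_derivative c * pi) (at z)"
      unfolding c_def by (auto intro!: derivative_eq_intros)
    have dc: "((\<lambda>z. pi * cos (pi * z)) has_real_derivative pi * - (s * pi)) (at z)"
      unfolding s_def by (auto intro!: derivative_eq_intros)
    have "(G has_real_derivative ((pi * - (s * pi)) * w z + w' z * (pi * cos (pi * z))) * (w z / sin (pi * z)) +
      (w' z * sin (pi * z) - w z * (c * pi)) / (sin (pi * z) * sin (pi * z)) * (pi * cos (pi * z) * w z)) (at z)"
      unfolding G_def
      by (rule DERIV_mult[OF DERIV_mult[OF dc dw] DERIV_divide[OF dw ds s]])
    moreover have "((pi * - (s * pi)) * w z + w' z * (pi * c)) * (w z / s) +
      (w' z * s - w z * (c * pi)) / (s * s) * (pi * c * w z) = G' z"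
    proof -
      have "((pi * - (s * pi)) * w z + w' z * (pi * c)) * (w z / s) +
        (w' z * s - w z * (c * pi)) / (s * s) * (pi * c * w z) =
        2 * pi * (c / s) * w z * w' z - pi\<^sup>2 * (w z)\<^sup>2 - pi\<^sup>2 * (c / s)\<^sup>2 * (w z)\<^sup>2"
        using s0 by (simp add: field_simps power2_eq_square)
      also have "\<dots> = G' z"
        unfolding G'_def c_def[symmetric] s_def[symmetric] by (simp add: power2_eq_square algebra_simps)
      finally show ?thesis .
    qed
    ultimately show ?thesis by (simp add: c_def s_def)
  qed
  have contG: "continuous_on {0..1} G"
  proof (rule continuous_at_imp_continuous_on, rule ballI)
    fix z :: real assume "z \<in> {0..1}"
    then consider "z = 0 \<or> z = 1" | "0 < z" "z < 1" by fastforce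
    then show "isCont G z" using end0 DERIV_isCont[OF dG] by cases auto
  qed
  have "(G' has_integral (G 1 - G 0)) {0..1}"
    by (rule fundamental_theorem_of_calculus_interior[OF _ contG])
      (use dG in \<open>auto simp: has_real_derivative_iff_has_vector_derivative\<close>)
  then have G'0: "(G' has_integral 0) {0..1}" by (simp add: G_def bc)
  have i: "(\<lambda>z. (w' z)\<^sup>2) integrable_on {0..1}" "(\<lambda>z. pi\<^sup>2 * (w z)\<^sup>2) integrable_on {0..1}"
    by (intro integrable_continuous_real continuous_intros w' cw)+
  have "((\<lambda>z. (w' z)\<^sup>2 - pi\<^sup>2 * (w z)\<^sup>2 - G' z) has_integral
    (integral {0..1} (\<lambda>z. (w' z)\<^sup>2) - integral {0..1} (\<lambda>z. pi\<^sup>2 * (w z)\<^sup>2) - 0)) {0..1}"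
    by (intro has_integral_diff integrable_integral i G'0)
  then have "0 \<le> integral {0..1} (\<lambda>z. (w' z)\<^sup>2) - integral {0..1} (\<lambda>z. pi\<^sup>2 * (w z)\<^sup>2) - 0"
    by (rule has_integral_nonneg) (simp add: G'_def)
  then show ?thesis by simp
qed

section \<open>The Poincare inequality on the cell and a differential inequality\<close>

lemma continuous_on_inner_ins3:
  fixes f :: "real^3 \<Rightarrow> real"
  assumes f: "continuous_on (cbox a b) f"
  shows "continuous_on (cbox (a $ (i + 1), a $ (i + 2)) (b $ (i + 1), b $ (i + 2)))
    (\<lambda>p. integral {a $ i..b $ i} (\<lambda>r. f (ins3 i (p, r))))"
proof -
  have "continuous_on (cbox (a $ (i + 1), a $ (i + 2)) (b $ (i + 1), b $ (i + 2)) \<times> cbox (a $ i) (b $ i)) (\<lambda>(p, r). f (ins3 i (p, r)))"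
    unfolding case_prod_beta prod.collapse
    by (rule continuous_on_compose2[OF f continuous_on_ins3])
      (auto simp: ins3_mem_cbox cbox_Pair_iff mem_Times_iff simp del: prod.collapse)
  from integral_continuous_on_param[OF this] show ?thesis by simp
qed

lemma integral_cbox_le_slicewise:
  fixes f g :: "real^3 \<Rightarrow> real"
  assumes f: "continuous_on (cbox a b) f" and g: "continuous_on (cbox a b) g"
    and le: "\<And>p. p \<in> cbox (a $ (i + 1), a $ (i + 2)) (b $ (i + 1), b $ (i + 2)) \<Longrightarrow>
      integral {a $ i..b $ i} (\<lambda>r. f (ins3 i (p, r))) \<le> integral {a $ i..b $ i} (\<lambda>r. g (ins3 i (p, r)))"
  shows "integral (cbox a b) f \<le> integral (cbox a b) g"
  unfolding integral_cbox_ins3[OF f, of i] integral_cbox_ins3[OF g, of i]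
  by (intro integral_le integrable_continuous continuous_on_inner_ins3 f g le)

text \<open>Wirtinger's inequality on every vertical segment, integrated over the horizontal
  coordinates; the constant is that of the unit interval.\<close>

lemma Poincare_cell:
  assumes f: "periodic_C1 Lx Ly f F" and w: "\<And>x. x \<in> walls \<Longrightarrow> f x = 0"
  shows "pi * L2n (cell Lx Ly) f \<le> L2n (cell Lx Ly) (F 3)"
proof (rule power2_le_imp_le)
  note C = periodic_C1D[OF f]
  let ?v = "vector [Lx, Ly, 1] :: real^3"
  have c: "continuous_on (cbox 0 ?v) f" "continuous_on (cbox 0 ?v) (F 3)"
    using continuous_on_cell[OF C(2), of Lx Ly] continuous_on_cell[OF C(3), of Lx Ly] by (auto simp: cell_def)
  have "integral (cbox 0 ?v) (\<lambda>x. pi\<^sup>2 * (f x)\<^sup>2) \<le> integral (cbox 0 ?v) (\<lambda>x. (F 3 x)\<^sup>2)"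
  proof (rule integral_cbox_le_slicewise[where i=3])
    show "continuous_on (cbox 0 ?v) (\<lambda>x. pi\<^sup>2 * (f x)\<^sup>2)" "continuous_on (cbox 0 ?v) (\<lambda>x. (F 3 x)\<^sup>2)"
      by (intro continuous_intros c)+
    fix p :: "real \<times> real"
    obtain p1 p2 where p: "p = (p1, p2)" by (cases p)
    have s: "ins3 3 (p, r) \<in> slab" if "r \<in> {0..1}" for r
      using that by (simp add: slab_def p ins3_nth)
    have "pi\<^sup>2 * integral {0..1} (\<lambda>r. (f (ins3 3 (p, r)))\<^sup>2) \<le> integral {0..1} (\<lambda>r. (F 3 (ins3 3 (p, r)))\<^sup>2)"
    proof (rule Wirtinger_inequality)
      show "f (ins3 3 (p, 0)) = 0" "f (ins3 3 (p, 1)) = 0"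
        by (auto intro!: w simp: walls_def p ins3_nth)
      show "continuous_on {0..1} (\<lambda>r. F 3 (ins3 3 (p, r)))"
        by (rule continuous_on_compose2[OF C(3)])
          (auto intro!: continuous_on_compose2[OF continuous_on_ins3] continuous_intros s)
      fix r :: real assume r: "r \<in> {0..1}"
      have "((\<lambda>s. f (ins3 3 (p, r) + s *\<^sub>R axis 3 1)) has_real_derivative F 3 (ins3 3 (p, r))) (at 0)"
        by (rule C(4)[OF s[OF r]])
      then have "((\<lambda>s. f (ins3 3 (p, r + s))) has_real_derivative F 3 (ins3 3 (p, r))) (at 0)"
        by (simp add: p ins3_add)
      then show "((\<lambda>s. f (ins3 3 (p, s))) has_real_derivative F 3 (ins3 3 (p, r))) (at r)"
        using DERIV_shift[of "\<lambda>s. f (ins3 3 (p, s))" "F 3 (ins3 3 (p, r))" 0 r] by (simp add: add.commute)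
    qed
    then show "integral {0 $ 3..?v $ 3} (\<lambda>r. pi\<^sup>2 * (f (ins3 3 (p, r)))\<^sup>2) \<le> integral {0 $ 3..?v $ 3} (\<lambda>r. (F 3 (ins3 3 (p, r)))\<^sup>2)"
      by simp
  qed
  then show "(pi * L2n (cell Lx Ly) f)\<^sup>2 \<le> (L2n (cell Lx Ly) (F 3))\<^sup>2"
    by (simp add: power_mult_distrib L2n_power2 cell_def)
qed (rule L2n_nonneg)

text \<open>A nonnegative function cannot decrease at rate \<open>c\<close> forever, so
  \<open>y\<close> falls below \<open>m\<close> at some time. It cannot climb above \<open>m\<close>
  afterwards, since it decreases wherever it is at least \<open>m\<close>.\<close>

lemma eventually_le_if_decreasing_above:
  fixes y y' :: "real \<Rightarrow> real"
  assumes d: "\<And>t. t > t0 \<Longrightarrow> (y has_real_derivative y' t) (at t)"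
    and nn: "\<And>t. 0 \<le> y t" and c: "c > 0"
    and dec: "\<And>t. t > t0 \<Longrightarrow> m \<le> y t \<Longrightarrow> y' t \<le> - c"
  shows "\<forall>\<^sub>F t in at_top. y t \<le> m"
proof -
  have "\<exists>t1>t0. y t1 < m"
  proof (rule ccontr)
    assume "\<not> ?thesis"
    then have ge: "m \<le> y t" if "t > t0" for t using that by (meson not_less)
    \<comment> \<open>After this time a decrease at rate \<open>c\<close> would give
      \<open>y t \<le> -1\<close>.\<close>
    define t where "t = t0 + 1 + (y (t0 + 1) + 1) / c"
    have t: "t \<ge> t0 + 1" using nn[of "t0 + 1"] c by (simp add: t_def)
    have "y t + c * t \<le> y (t0 + 1) + c * (t0 + 1)"
    proof (rule DERIV_nonpos_imp_nonincreasing[OF t])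
      fix s assume s: "t0 + 1 \<le> s" "s \<le> t"
      then have "((\<lambda>t. y t + c * t) has_real_derivative y' s + c) (at s)"
        by (auto intro!: derivative_eq_intros d)
      moreover have "y' s + c \<le> 0" using dec[of s] ge[of s] s by simp
      ultimately show "\<exists>z. ((\<lambda>t. y t + c * t) has_real_derivative z) (at s) \<and> z \<le> 0" by blast
    qed
    moreover have "c * t = c * (t0 + 1) + (y (t0 + 1) + 1)" using c by (simp add: t_def field_simps)
    ultimately show False using nn[of t] by simp
  qed
  then obtain t1 where t1: "t1 > t0" "y t1 < m" by blast
  have "y t2 \<le> m" if t2: "t2 \<ge> t1" for t2
  proof (rule ccontr)
    assume n: "\<not> y t2 \<le> m"
    have cy: "continuous_on {t1..t2} y"
      by (intro continuous_at_imp_continuous_on ballI, rule DERIV_isCont, rule d) (use t1 in auto)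
    \<comment> \<open>The maximum of \<open>S\<close> is the last time before \<open>t2\<close> with
      value at most \<open>m\<close>. The value there is exactly \<open>m\<close> by the
      intermediate value theorem, and \<open>y\<close> cannot increase after it.\<close>
    define S where "S = {s \<in> {t1..t2}. y s \<le> m}"
    have "closed S" unfolding S_def using continuous_on_closed_Collect_le[OF cy continuous_on_const] by simp
    moreover have "bounded S" by (rule bounded_subset[OF bounded_closed_interval]) (auto simp: S_def)
    ultimately have "compact S" by (simp add: compact_eq_bounded_closed)
    moreover have "t1 \<in> S" using t1 t2 by (simp add: S_def)
    ultimately obtain s where s: "s \<in> S" "\<And>r. r \<in> S \<Longrightarrow> r \<le> s"
      using compact_attains_sup[of S] by blast
    have s': "t1 \<le> s" "s < t2" "y s \<le> m" using s n by (auto simp: S_def order.order_iff_strict)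
    have gt: "m < y r" if "s < r" "r \<le> t2" for r
      using s(2)[of r] that s' by (force simp: S_def)
    have ys: "y s = m"
    proof (rule ccontr)
      assume "y s \<noteq> m"
      then have "y s < m" using s' by simp
      moreover have "continuous_on {s..t2} y" using continuous_on_subset[OF cy] s' by simp
      ultimately obtain r where "s \<le> r" "r \<le> t2" "y r = m"
        using IVT'[of y s m t2] n s' by auto
      then show False using gt[of r] \<open>y s < m\<close> by (cases "r = s") auto
    qed
    have "y t2 \<le> y s"
    proof (rule DERIV_nonpos_imp_nonincreasing[of s t2 y])
      show "s \<le> t2" using s' by simp
      fix r assume r: "s \<le> r" "r \<le> t2"
      have "m \<le> y r" using gt[of r] ys r by (cases "r = s") auto
      then have "y' r \<le> - c" using dec[of r] r s' t1 by simp
      then show "\<exists>z. (y has_real_derivative z) (at r) \<and> z \<le> 0"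
        using d[of r] r s' t1 c by (intro exI[of _ "y' r"]) auto
    qed
    then show False using ys n by simp
  qed
  then show ?thesis unfolding eventually_at_top_linorder by blast
qed

subsection \<open>Norms of classical fields\<close>

text \<open>The points where two continuous functions differ form an open set; if nonempty, it
  contains a box of positive measure.\<close>

lemma AE_continuous_imp_eq:
  assumes f: "continuous_on open_slab f" and g: "continuous_on open_slab g"
    and ae: "AE x in lebesgue_on open_slab. f x = g x" and x: "x \<in> open_slab"
  shows "f x = (g x :: real)"
proof (rule ccontr)
  assume ne: "f x \<noteq> g x"
  obtain N where N: "negligible N" "\<And>x. x \<in> open_slab - N \<Longrightarrow> f x = g x"
    using AE_open_slab_negligible[OF ae] by blast
  have "open {x \<in> open_slab. f x - g x \<in> - {0}}"
    by (intro continuous_open_preimage[unfolded vimage_def Int_def mem_Collect_eq] continuous_intros f g open_open_slab)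
  moreover have "x \<in> {x \<in> open_slab. f x - g x \<in> - {0}}" using x ne by simp
  ultimately obtain a b where ab: "cbox a b \<subseteq> {x \<in> open_slab. f x - g x \<in> - {0}}" "x \<in> box a b"
    by (rule open_contains_cbox) blast
  have "cbox a b \<subseteq> N" using ab(1) N(2) by auto
  then have "negligible (cbox a b)" using N(1) negligible_subset by blast
  then show False using ab(2) negligible_interval(1) by blast
qed

lemma AE_continuous_imp_eq_slab:
  fixes f g :: "real^3 \<Rightarrow> real"
  assumes f: "continuous_on slab f" and g: "continuous_on slab g"
    and ae: "AE x in lebesgue_on open_slab. f x = g x" and x: "x \<in> slab"
  shows "f x = g x"
proof -
  have "f y - g y = 0" if "y \<in> open_slab" for y
    using AE_continuous_imp_eq[OF continuous_on_subset[OF f open_slab_subset_slab]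
        continuous_on_subset[OF g open_slab_subset_slab] ae that] by simp
  moreover have "continuous_on (closure open_slab) (\<lambda>x. f x - g x)"
    unfolding closure_open_slab by (intro continuous_intros f g)
  ultimately have "f x - g x = 0"
    using continuous_constant_on_closure[where S=open_slab and f="\<lambda>x. f x - g x" and a=0 and x=x] x
    unfolding closure_open_slab by simp
  then show ?thesis by simp
qed

text \<open>The cell leaves the open slab only in the planes z = 0 and z = 1, which are null
  sets.\<close>

lemma AE_cell_if_AE_open_slab:
  assumes "AE x in lebesgue_on open_slab. P x"
  shows "AE x in lebesgue_on (cell Lx Ly). P x"
proof -
  obtain N where N: "negligible N" "\<And>x. x \<in> open_slab - N \<Longrightarrow> P x"
    using AE_open_slab_negligible[OF assms] by blast
  have "negligible (N \<union> {x. x $ 3 = 0} \<union> {x. x $ 3 = 1})"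
    using N(1) negligible_standard_hyperplane[of "axis 3 1 :: real^3" 0] negligible_standard_hyperplane[of "axis 3 1 :: real^3" 1]
    by (simp add: axis_in_Basis_iff inner_axis)
  then have "N \<union> {x. x $ 3 = 0} \<union> {x. x $ 3 = 1} \<in> null_sets lebesgue"
    by (simp add: negligible_iff_null_sets)
  then have "AE x in lebesgue. x \<in> cell Lx Ly \<longrightarrow> P x"
  proof (rule AE_I', intro subsetI)
    fix x assume "x \<in> {x \<in> space lebesgue. \<not> (x \<in> cell Lx Ly \<longrightarrow> P x)}"
    then have x: "x \<in> cell Lx Ly" "\<not> P x" by auto
    show "x \<in> N \<union> {x. x $ 3 = 0} \<union> {x. x $ 3 = 1}"
    proof (rule ccontr)
      assume "x \<notin> N \<union> {x. x $ 3 = 0} \<union> {x. x $ 3 = 1}"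
      then have "x \<in> open_slab - N" using x(1) by (auto simp: mem_cell open_slab_def)
      then show False using N(2) x(2) by blast
    qed
  qed
  then show ?thesis by (subst AE_restrict_space_iff) (auto simp: cell_def)
qed

lemma AE_lebesgue_on_open_slabI: "(\<And>x. x \<in> open_slab \<Longrightarrow> P x) \<Longrightarrow> AE x in lebesgue_on open_slab. P x"
  by (rule AE_I2) (simp add: space_restrict_space)

lemma eroot_ennreal: "0 \<le> r \<Longrightarrow> eroot p (ennreal r) = ennreal (root p r)"
  by (simp add: eroot_def)

lemma Lnorm_cbox:
  fixes f h :: "'a::euclidean_space \<Rightarrow> 'b::real_normed_vector"
  assumes h: "continuous_on (cbox a b) h" and ae: "AE x in lebesgue_on (cbox a b). f x = h x"
  shows "Lnorm p (lebesgue_on (cbox a b)) f = ennreal (root p (integral (cbox a b) (\<lambda>x. norm (h x) ^ p)))"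
proof -
  have "(\<integral>\<^sup>+x. ennreal (norm (f x) ^ p) \<partial>lebesgue_on (cbox a b)) = (\<integral>\<^sup>+x. ennreal (norm (h x) ^ p) \<partial>lebesgue_on (cbox a b))"
    by (rule nn_integral_cong_AE) (use ae in eventually_elim, simp)
  also have "\<dots> = ennreal (integral (cbox a b) (\<lambda>x. norm (h x) ^ p))"
    by (rule nn_integral_lebesgue_on_cbox) (auto intro!: continuous_intros h)
  finally show ?thesis
    unfolding Lnorm_def by (simp add: eroot_ennreal integral_nonneg_pointwise)
qed

lemma Lnorm_cell:
  fixes f h :: "real^3 \<Rightarrow> 'b::real_normed_vector"
  assumes h: "continuous_on slab h" and ae: "AE x in lebesgue_on open_slab. f x = h x"
  shows "Lnorm p (lebesgue_on (cell Lx Ly)) f = ennreal (root p (integral (cell Lx Ly) (\<lambda>x. norm (h x) ^ p)))"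
  unfolding cell_def
  by (rule Lnorm_cbox; fold cell_def) (rule continuous_on_cell[OF h] AE_cell_if_AE_open_slab[OF ae])+

lemma Lnorm_2_cell:
  fixes f h :: "real^3 \<Rightarrow> 'b::real_normed_vector"
  assumes h: "continuous_on slab h" and ae: "AE x in lebesgue_on open_slab. f x = h x"
  shows "Lnorm 2 (lebesgue_on (cell Lx Ly)) f = ennreal (L2n (cell Lx Ly) h)"
  using Lnorm_cell[OF assms, of 2] by (simp add: L2n_def sqrt_def)

text \<open>The classical H1 norm, with \<open>H\<close> in the role of the gradient. As an L2 norm
  of pairs it inherits the triangle inequality from \<open>L2n_triangle\<close>.\<close>

definition C1n :: "real \<Rightarrow> real \<Rightarrow> (real^3 \<Rightarrow> real) \<Rightarrow> (3 \<Rightarrow> real^3 \<Rightarrow> real) \<Rightarrow> real"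
  where "C1n Lx Ly h H = L2n (cell Lx Ly) (\<lambda>x. (h x, (\<chi> i. H i x) :: real^3))"

lemma C1n_power2:
  assumes h: "continuous_on slab h" and H: "\<And>i. continuous_on slab (H i)"
  shows "(C1n Lx Ly h H)\<^sup>2 = (L2n (cell Lx Ly) h)\<^sup>2 + (L2n (cell Lx Ly) (\<lambda>x. (\<chi> i. H i x) :: real^3))\<^sup>2"
proof -
  have c: "continuous_on slab (\<lambda>x. (\<chi> i. H i x) :: real^3)" by (intro continuous_intros H)
  show ?thesis
    unfolding C1n_def L2n_power2
    by (subst integral_add[symmetric], (intro integrable_on_cell continuous_intros h c)+)
      (simp add: norm_Pair)
qed

lemma has_weak_pd_periodic_C1:
  assumes h: "periodic_C1 Lx Ly h H" and ae: "AE x in lebesgue_on open_slab. f x = h x"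
    and ae': "AE x in lebesgue_on open_slab. f' x = H i x"
  shows "has_weak_pd i f f'"
  by (rule has_weak_pd_classical[OF _ _ _ ae ae'])
    (use periodic_C1D[OF h] open_slab_subset_slab continuous_on_subset in \<open>blast+\<close>)

lemma wpd_AE_eq_periodic_C1:
  assumes h: "periodic_C1 Lx Ly h H" and ae: "AE x in lebesgue_on open_slab. f x = h x"
  shows "AE x in lebesgue_on open_slab. wpd i f x = H i x"
  by (rule wpd_AE_eq, rule has_weak_pd_periodic_C1[OF h ae]) simp

lemma H1norm_periodic_C1:
  assumes h: "periodic_C1 Lx Ly h H" and ae: "AE x in lebesgue_on open_slab. f x = h x"
  shows "H1norm Lx Ly f = ennreal (C1n Lx Ly h H)"
proof -
  note C = periodic_C1D[OF h]
  have c: "continuous_on slab (\<lambda>x. (\<chi> i. H i x) :: real^3)" by (intro continuous_intros C)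
  have "AE x in lebesgue_on open_slab. \<forall>i. wpd i f x = H i x"
    by (intro eventually_all_finite wpd_AE_eq_periodic_C1[OF h ae])
  then have g: "AE x in lebesgue_on open_slab. wgrad f x = (\<chi> i. H i x)"
    by eventually_elim (simp add: wgrad_def)
  have "H1norm Lx Ly f = eroot 2 (ennreal ((C1n Lx Ly h H)\<^sup>2))"
    unfolding H1norm_def Lnorm_2_cell[OF C(2) ae] Lnorm_2_cell[OF c g] C1n_power2[OF C(2,3)]
    by (simp add: ennreal_plus ennreal_power L2n_nonneg)
  also have "\<dots> = ennreal (C1n Lx Ly h H)"
    by (simp add: eroot_ennreal C1n_def sqrt_def[symmetric] L2n_nonneg)
  finally show ?thesis .
qed

lemma sobolev_0_periodic_C1:
  assumes "continuous_on slab h" "AE x in lebesgue_on open_slab. f x = h x"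
    "f \<in> borel_measurable (lebesgue_on (cell Lx Ly))"
  shows "sobolev Lx Ly 0 f"
  using assms(3) Lnorm_2_cell[OF assms(1,2)] by simp

lemma continuous_borel_measurable_cell:
  fixes h :: "real^3 \<Rightarrow> real"
  shows "continuous_on slab h \<Longrightarrow> h \<in> borel_measurable (lebesgue_on (cell Lx Ly))"
  by (rule continuous_imp_measurable_on_sets_lebesgue[OF continuous_on_cell]) (simp_all add: cell_def)

lemma sobolev_st_field:
  assumes "st_field Lx Ly U g" "0 < t"
  shows "sobolev Lx Ly k (\<lambda>x. g (t, x))"
  using assms(1)
proof (induction k arbitrary: g)
  case 0
  note C = periodic_C1D[OF st_field_periodic_C1[OF 0 assms(2)]]
  show ?case
    by (rule sobolev_0_periodic_C1[OF C(2)]) (simp_all add: continuous_borel_measurable_cell[OF C(2)])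
next
  case (Suc k)
  note c1 = st_field_periodic_C1[OF Suc.prems assms(2)]
  note C = periodic_C1D[OF c1]
  have "\<exists>h. has_weak_pd i (\<lambda>x. g (t, x)) h \<and> sobolev Lx Ly k h" for i
    using has_weak_pd_periodic_C1[OF c1, of "\<lambda>x. g (t, x)" "\<lambda>x. dx i g (t, x)" i] Suc.IH[OF st_field_dx[OF Suc.prems], of i]
    by auto
  then show ?case
    using Lnorm_2_cell[OF C(2), of "\<lambda>x. g (t, x)"] continuous_borel_measurable_cell[OF C(2)] by simp
qed

text \<open>A case split on \<open>k\<close> suffices: \<open>f\<close> and \<open>h\<close> have
  the same weak derivatives, so the same witnesses serve at all lower orders.\<close>

lemma sobolev_eq_on_slab:
  assumes "sobolev Lx Ly k h" and eq: "\<And>x. x \<in> slab \<Longrightarrow> f x = h x"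
  shows "sobolev Lx Ly k f"
proof -
  have eqc: "x \<in> cell Lx Ly \<Longrightarrow> f x = h x" for x using eq cell_subset_slab by blast
  have m: "f \<in> borel_measurable (lebesgue_on (cell Lx Ly)) \<longleftrightarrow> h \<in> borel_measurable (lebesgue_on (cell Lx Ly))"
    by (rule measurable_cong) (simp add: space_restrict_space eqc)
  have n: "Lnorm 2 (lebesgue_on (cell Lx Ly)) f = Lnorm 2 (lebesgue_on (cell Lx Ly)) h"
    unfolding Lnorm_def by (intro arg_cong[where f="eroot 2"] nn_integral_cong) (simp add: space_restrict_space eqc)
  have eqo: "x \<in> open_slab \<Longrightarrow> f x = h x" for x using eq open_slab_subset_slab by blast
  have l: "locally_integrable f \<longleftrightarrow> locally_integrable h"
    unfolding locally_integrable_def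
    by (intro all_cong set_integrable_cong refl) (use eqo in auto)
  have w: "has_weak_pd i f F \<longleftrightarrow> has_weak_pd i h F" for i F
  proof -
    have "(LINT x:open_slab|lebesgue. f x * G x) = (LINT x:open_slab|lebesgue. h x * G x)" for G
      by (rule set_lebesgue_integral_cong) (use eqo in auto)
    then show ?thesis unfolding has_weak_pd_def l by simp
  qed
  show ?thesis using assms(1) by (cases k) (auto simp: m n w)
qed

lemma integral_le_except_negligible:
  fixes f g :: "'a::euclidean_space \<Rightarrow> real"
  assumes f: "f integrable_on S" and g: "g integrable_on S" and N: "negligible N"
    and le: "\<And>x. x \<in> S - N \<Longrightarrow> f x \<le> g x"
  shows "integral S f \<le> integral S g"
proof -
  let ?f = "\<lambda>x. if x \<in> N then g x else f x"
  have "integral S f = integral S ?f" by (rule integral_spike[OF N]) simp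
  also have "\<dots> \<le> integral S g"
  proof (rule integral_le)
    show "?f integrable_on S" by (rule integrable_spike[OF f N]) simp
  qed (use g le in auto)
  finally show ?thesis .
qed

text \<open>The norm of \<open>real^3^3\<close> is the Frobenius norm. The vector is a combination
  of the rows of \<open>M\<close>, so the triangle and Cauchy-Schwarz inequalities give the
  bound.\<close>

lemma norm_transpose_mult_le:
  fixes M :: "real^3^3" and a :: "real^3"
  shows "norm (\<chi> i. \<Sum>k\<in>UNIV. M $ k $ i * a $ k) \<le> norm M * norm a"
proof -
  have "(\<chi> i. \<Sum>k\<in>UNIV. M $ k $ i * a $ k) = (\<Sum>k\<in>UNIV. a $ k *\<^sub>R M $ k)"
    by (simp add: vec_eq_iff mult.commute)
  also have "norm \<dots> \<le> (\<Sum>k\<in>UNIV. \<bar>norm (M $ k)\<bar> * \<bar>a $ k\<bar>)"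
    by (rule sum_norm_le) (simp add: mult.commute)
  also have "\<dots> \<le> L2_set (\<lambda>k. norm (M $ k)) UNIV * L2_set (\<lambda>k. a $ k) UNIV"
    by (rule L2_set_mult_ineq)
  also have "\<dots> = norm M * norm a"
    by (simp add: norm_vec_def L2_set_def)
  finally show ?thesis .
qed

section \<open>Vertical integrals and horizontal derivatives\<close>

lemma numeral_mod_3: "(4 :: 3) = 1" "(5 :: 3) = 2"
  by simp_all

lemma ins3_3: "ins3 3 ((p, q), r) = vector [p, q, r]"
  by (simp add: vec_eq_iff forall_3 vector_3 ins3_def)

lemma zint_eq: "zint f x = integral {0..x $ 3} (\<lambda>r. f (ins3 3 ((x $ 1, x $ 2), r)))"
  by (simp add: zint_def ins3_3)

lemma ins3_3_slab: "ins3 3 (p, r) \<in> slab \<longleftrightarrow> 0 \<le> r \<and> r \<le> 1"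
  by (cases p) (simp add: slab_def ins3_nth)

lemma zint_cong:
  assumes "\<And>x. x \<in> slab \<Longrightarrow> f x = g x" "x \<in> slab"
  shows "zint f x = zint g x"
  unfolding zint_eq
proof (intro integral_cong assms(1))
  have "x $ 3 \<le> 1" using assms(2) by (simp add: slab_def)
  then show "ins3 3 ((x $ 1, x $ 2), r) \<in> slab" if "r \<in> {0..x $ 3}" for r
    using that by (simp add: ins3_3_slab)
qed

text \<open>A horizontal shift leaves the upper limit \<open>x $ 3\<close> fixed, so this is
  differentiation under the integral sign.\<close>

lemma pd_zint:
  assumes f: "periodic_C1 Lx Ly f F" and i: "i \<noteq> 3" and x: "x \<in> slab"
  shows "pd i (zint f) x = zint (F i) x"
proof -
  note C = periodic_C1D[OF f]
  define I where "I = (\<lambda>s r. ins3 3 ((x $ 1, x $ 2), r) + s *\<^sub>R axis i 1)"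
  have I: "I s r = ins3 3 (((x + s *\<^sub>R axis i 1) $ 1, (x + s *\<^sub>R axis i 1) $ 2), r)" for s r
    using i exhaust_3[of i] by (auto simp: I_def ins3_3 vec_eq_iff forall_3 vector_3 axis_def)
  have Is: "I s r \<in> slab" if "r \<in> {0..x $ 3}" for s r
    unfolding I ins3_3_slab using that x by (auto simp: slab_def)
  have x3: "(x + s *\<^sub>R axis i 1) $ 3 = x $ 3" for s using i by (simp add: axis_def)
  have z: "zint f (x + s *\<^sub>R axis i 1) = integral {0..x $ 3} (\<lambda>r. f (I s r))" for s
    unfolding zint_eq x3 I ..
  have cI: "continuous_on A (\<lambda>z. I (fst z) (snd z))" for A
    unfolding I_def by (intro continuous_intros continuous_on_compose2[OF continuous_on_ins3[of UNIV]]) auto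
  have "((\<lambda>s. integral (cbox 0 (x $ 3)) (\<lambda>r. f (I s r))) has_field_derivative integral (cbox 0 (x $ 3)) (\<lambda>r. F i (I 0 r))) (at 0 within UNIV)"
  proof (rule leibniz_rule_field_derivative)
    fix s r :: real assume r: "r \<in> cbox 0 (x $ 3)"
    have "((\<lambda>h. f (I s r + h *\<^sub>R axis i 1)) has_real_derivative F i (I s r)) (at 0)"
      by (rule C(4)[OF Is]) (use r in auto)
    moreover have "I s r + h *\<^sub>R axis i 1 = I (h + s) r" for h by (simp add: I_def algebra_simps)
    ultimately show "((\<lambda>s. f (I s r)) has_field_derivative F i (I s r)) (at s within UNIV)"
      using DERIV_shift[of "\<lambda>s. f (I s r)" "F i (I s r)" 0 s] by simp
  next
    fix s :: real
    show "(\<lambda>r. f (I s r)) integrable_on cbox 0 (x $ 3)"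
    proof (rule integrable_continuous)
      show "continuous_on (cbox 0 (x $ 3)) (\<lambda>r. f (I s r))"
        by (rule continuous_on_compose2[OF C(2)], rule continuous_on_compose2[OF cI[of UNIV], of _ "\<lambda>r. (s, r)", simplified])
          (auto intro!: continuous_intros Is)
    qed
  next
    show "continuous_on (UNIV \<times> cbox 0 (x $ 3)) (\<lambda>(s, r). F i (I s r))"
      unfolding case_prod_beta by (rule continuous_on_compose2[OF C(3) cI]) (auto intro!: Is)
  qed auto
  then have "((\<lambda>s. zint f (x + s *\<^sub>R axis i 1)) has_field_derivative integral {0..x $ 3} (\<lambda>r. F i (I 0 r))) (at 0)"
    by (simp add: z)
  then show ?thesis
    unfolding dir_deriv_def by (simp add: DERIV_imp_deriv zint_eq I_def)
qed

text \<open>Horizontal lines through a point of the slab stay in the slab, so agreement there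
  determines these derivatives even on the walls.\<close>

lemma pd_cong_slab:
  assumes "\<And>x. x \<in> slab \<Longrightarrow> f x = g x" "x \<in> slab" "i \<noteq> 3"
  shows "pd i f x = pd i g x"
proof -
  have "(\<lambda>s. f (x + s *\<^sub>R axis i 1)) = (\<lambda>s. g (x + s *\<^sub>R axis i 1))"
    using slab_add_axis[OF assms(2,3)] assms(1) by (simp add: axis_scaleR)
  then show ?thesis by (simp add: dir_deriv_def)
qed

lemma pd_cong_open_slab:
  assumes "\<And>x. x \<in> open_slab \<Longrightarrow> f x = g x" "x \<in> open_slab"
  shows "pd i f x = pd i g x"
proof -
  have "\<forall>\<^sub>F s in nhds 0. x + s *\<^sub>R axis i 1 \<in> open_slab"
    by (rule eventually_line_in_open[OF open_open_slab assms(2)])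
  then have "\<forall>\<^sub>F s in nhds 0. f (x + s *\<^sub>R axis i 1) = g (x + s *\<^sub>R axis i 1)"
    by eventually_elim (rule assms(1))
  then show ?thesis unfolding dir_deriv_def by (rule deriv_cong_ev) simp
qed

lemma pd_slice: "pd i (\<lambda>x. g (t, x)) x = dx i g (t, x)"
  by (simp add: dir_deriv_def)

text \<open>Cauchy-Schwarz against the constant 1 on an interval of length at most 1, applied to
  \<open>h\<close> and to \<open>- h\<close>.\<close>

lemma power2_integral_le:
  fixes h :: "real \<Rightarrow> real"
  assumes h: "continuous_on {0..1} h" and z: "0 \<le> z" "z \<le> 1"
  shows "(integral {0..z} h)\<^sup>2 \<le> integral {0..1} (\<lambda>r. (h r)\<^sup>2)"
proof -
  have hz: "continuous_on (cbox 0 z) h" using continuous_on_subset[OF h] z by auto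
  have L1: "L2n (cbox 0 z) (\<lambda>_. 1 :: real) \<le> 1" using z by (simp add: L2n_def)
  have le: "integral {0..z} k \<le> L2n (cbox 0 z) k" if "continuous_on (cbox 0 z) k" for k :: "real \<Rightarrow> real"
    using L2n_Cauchy_Schwarz[OF that continuous_on_const[of _ 1]] mult_left_le[OF L1 L2n_nonneg[of "cbox 0 z" k]] by simp
  have "\<bar>integral {0..z} h\<bar> \<le> L2n (cbox 0 z) h"
    using le[OF hz] le[OF continuous_on_minus[OF hz]] by (simp add: L2n_def)
  then have "(integral {0..z} h)\<^sup>2 \<le> (L2n (cbox 0 z) h)\<^sup>2"
    by (metis abs_ge_zero power2_abs power_mono)
  also have "\<dots> = integral {0..z} (\<lambda>r. (h r)\<^sup>2)" by (simp add: L2n_power2)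
  also have "\<dots> \<le> integral {0..1} (\<lambda>r. (h r)\<^sup>2)"
    by (rule integral_subset_le)
      (use z in \<open>auto intro!: integrable_continuous_real continuous_intros h continuous_on_subset[OF h]\<close>)
  finally show ?thesis .
qed

text \<open>The bound \<open>power2_integral_le\<close> is uniform in z, so the supremum over
  heights is already controlled by the L2 norm over the cell.\<close>

lemma Linf_z_L2_xy_zint_le:
  assumes h: "continuous_on slab h" and f: "\<And>x. x \<in> slab \<Longrightarrow> f x = zint h x"
  shows "Linf_z_L2_xy Lx Ly f \<le> ennreal (L2n (cell Lx Ly) h)"
  unfolding Linf_z_L2_xy_def
proof (rule SUP_least)
  fix z :: real assume z: "z \<in> {0..1}"
  let ?R = "cbox (0, 0) (Lx, Ly)"
  have hI: "continuous_on (A \<times> cbox 0 z') (\<lambda>(p, r). h (ins3 3 (p, r)))" if "z' \<le> 1" for A z'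
    unfolding case_prod_beta prod.collapse
    by (rule continuous_on_compose2[OF h continuous_on_ins3])
      (use that in \<open>auto simp: ins3_3_slab simp del: prod.collapse\<close>)
  define k where "k = (\<lambda>p. integral {0..z} (\<lambda>r. h (ins3 3 (p, r))))"
  have ck: "continuous_on ?R k"
    unfolding k_def using integral_continuous_on_param[OF hI[of z ?R]] z by simp
  have fk: "(\<lambda>(x, y). f (vector [x, y, z])) p = k p" for p
  proof -
    obtain x y where p: "p = (x, y)" by (cases p)
    have "f (vector [x, y, z]) = zint h (vector [x, y, z])"
      using z by (intro f) (simp add: slab_def vector_3)
    then show ?thesis by (simp add: p k_def zint_eq vector_3)
  qed
  have hr: "continuous_on {0..1} (\<lambda>r. h (ins3 3 (p, r)))" for p
    by (rule continuous_on_compose2[OF h])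
      (auto intro!: continuous_on_compose2[OF continuous_on_ins3[of UNIV]] continuous_intros simp: ins3_3_slab)
  have "Lnorm 2 (lebesgue_on ?R) (\<lambda>(x, y). f (vector [x, y, z])) = ennreal (L2n ?R k)"
    using Lnorm_cbox[OF ck, of "\<lambda>(x, y). f (vector [x, y, z])" 2] fk by (simp add: L2n_def sqrt_def)
  also have "L2n ?R k \<le> L2n (cell Lx Ly) h"
  proof (rule power2_le_imp_le)
    let ?v = "vector [Lx, Ly, 1] :: real^3"
    have c: "continuous_on (cbox 0 ?v) (\<lambda>x. (h x)\<^sup>2)"
      using continuous_on_cell[OF continuous_on_power[OF h, of 2], of Lx Ly] by (simp add: cell_def)
    have "(L2n ?R k)\<^sup>2 = integral ?R (\<lambda>p. (k p)\<^sup>2)" by (simp add: L2n_power2)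
    also have "\<dots> \<le> integral ?R (\<lambda>p. integral {0..1} (\<lambda>r. (h (ins3 3 (p, r)))\<^sup>2))"
    proof (rule integral_le)
      show "(\<lambda>p. (k p)\<^sup>2) integrable_on ?R" by (intro integrable_continuous continuous_intros ck)
      show "(\<lambda>p. integral {0..1} (\<lambda>r. (h (ins3 3 (p, r)))\<^sup>2)) integrable_on ?R"
        using integrable_continuous[OF continuous_on_inner_ins3[OF c, of 3]] by (simp add: vector_3 numeral_mod_3)
      show "(k p)\<^sup>2 \<le> integral {0..1} (\<lambda>r. (h (ins3 3 (p, r)))\<^sup>2)" for p
        unfolding k_def by (rule power2_integral_le[OF hr]) (use z in auto)
    qed
    also have "\<dots> = integral (cbox 0 ?v) (\<lambda>x. (h x)\<^sup>2)"
      unfolding integral_cbox_ins3[OF c, of 3] by (simp add: vector_3 numeral_mod_3)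
    also have "\<dots> = (L2n (cell Lx Ly) h)\<^sup>2" by (simp add: L2n_power2 cell_def)
    finally show "(L2n ?R k)\<^sup>2 \<le> (L2n (cell Lx Ly) h)\<^sup>2" .
  qed (rule L2n_nonneg)
  finally show "Lnorm 2 (lebesgue_on ?R) (\<lambda>(x, y). f (vector [x, y, z])) \<le> ennreal (L2n (cell Lx Ly) h)"
    by (simp add: ennreal_leI)
qed

subsection \<open>The energy estimate\<close>

lemma dir_deriv_cong_open:
  assumes "open U" "\<And>z. z \<in> U \<Longrightarrow> f z = h z" "z \<in> U"
  shows "dir_deriv b f z = dir_deriv b h z"
proof -
  have "\<forall>\<^sub>F s in nhds 0. z + s *\<^sub>R b \<in> U" by (rule eventually_line_in_open[OF assms(1,3)])
  then have "\<forall>\<^sub>F s in nhds 0. f (z + s *\<^sub>R b) = h (z + s *\<^sub>R b)"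
    by eventually_elim (rule assms(2))
  then show ?thesis unfolding dir_deriv_def by (rule deriv_cong_ev) simp
qed

text \<open>The second exchange happens under \<open>dx k\<close>, so it must hold on a
  neighbourhood of the point; hence it is made on the open set \<open>U\<close>.\<close>

lemma st_field_dt_dx_dx:
  assumes g: "st_field Lx Ly U g" and t: "0 < t" and x: "x \<in> slab"
  shows "dt (dx k (dx k g)) (t, x) = dx k (dx k (dt g)) (t, x)"
proof -
  have U: "(t, x) \<in> U" using st_fieldD(3)[OF g] t x by simp
  have "dt (dx k (dx k g)) (t, x) = dx k (dt (dx k g)) (t, x)"
    by (rule st_field_commute(2)[OF st_field_dx[OF g] t x])
  also have "\<dots> = dx k (dx k (dt g)) (t, x)"
    by (rule dir_deriv_cong_open[OF st_fieldD(1)[OF g] _ U])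
      (use smooth_open_mixed_partials[OF st_fieldD(1,2)[OF g]] space_time_Basis in blast)
  finally show ?thesis .
qed

lemma st_field_continuous_on:
  assumes g: "st_field Lx Ly U g"
  shows "continuous_on ({0<..} \<times> slab) g"
  using smooth_open_continuous_on[OF st_fieldD(2)[OF g]]
  by (rule continuous_on_subset) (use st_fieldD(3)[OF g] in auto)

abbreviation vec_of :: "(3 \<Rightarrow> 'a \<Rightarrow> real) \<Rightarrow> 'a \<Rightarrow> real^3"
  where "vec_of F \<equiv> \<lambda>x. \<chi> i. F i x"

text \<open>
  The values of the given fields outside the slab are arbitrary, so \<open>g\<close> and \<open>v\<close> stand for smooth extensions of
  the temperature and the velocity.
\<close>

locale advected_field =
  fixes Lx Ly Pe :: real and U :: "(real \<times> (real^3)) set"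
    and g :: "real \<times> (real^3) \<Rightarrow> real" and v :: "3 \<Rightarrow> real \<times> (real^3) \<Rightarrow> real"
  assumes pos: "0 < Lx" "0 < Ly" "0 < Pe"
    and g: "st_field Lx Ly U g" and v: "\<And>i. st_field Lx Ly U (v i)"
    and g_walls: "\<And>t x. 0 < t \<Longrightarrow> x \<in> walls \<Longrightarrow> g (t, x) = 0"
    and v_walls: "\<And>t x. 0 < t \<Longrightarrow> x \<in> walls \<Longrightarrow> v 3 (t, x) = 0"
begin

text \<open>The advection term in the form u . grad T; incompressibility identifies it with the
  divergence of uT in \<open>W_minus_lap_AE\<close>.\<close>

definition adv :: "real \<Rightarrow> real^3 \<Rightarrow> real"
  where "adv t x = (\<Sum>k\<in>UNIV. v k (t, x) * dx k g (t, x))"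

definition adv_d :: "real \<Rightarrow> 3 \<Rightarrow> real^3 \<Rightarrow> real"
  where "adv_d t i x = (\<Sum>k\<in>UNIV. dx i (v k) (t, x) * dx k g (t, x) + v k (t, x) * dx i (dx k g) (t, x))"

definition W :: "real \<Rightarrow> real^3 \<Rightarrow> real"
  where "W t x = Pe * (dt g (t, x) + adv t x)"

definition W_d :: "real \<Rightarrow> 3 \<Rightarrow> real^3 \<Rightarrow> real"
  where "W_d t i x = Pe * (dx i (dt g) (t, x) + adv_d t i x)"

definition lap :: "real \<Rightarrow> real^3 \<Rightarrow> real"
  where "lap t x = (\<Sum>k\<in>UNIV. dx k (dx k g) (t, x))"

definition lap_d :: "real \<Rightarrow> 3 \<Rightarrow> real^3 \<Rightarrow> real"
  where "lap_d t i x = (\<Sum>k\<in>UNIV. dx i (dx k (dx k g)) (t, x))"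

definition lap_dt :: "real \<Rightarrow> real^3 \<Rightarrow> real"
  where "lap_dt t x = (\<Sum>k\<in>UNIV. dt (dx k (dx k g)) (t, x))"

definition vel :: "real \<Rightarrow> real^3 \<Rightarrow> real^3"
  where "vel t x = (\<chi> i. v i (t, x))"

definition grad_vel :: "real \<Rightarrow> real^3 \<Rightarrow> real^3^3"
  where "grad_vel t x = (\<chi> i j. dx j (v i) (t, x))"

definition grad :: "real \<Rightarrow> real^3 \<Rightarrow> real^3"
  where "grad t x = (\<chi> i. dx i g (t, x))"

definition hess :: "real \<Rightarrow> real^3 \<Rightarrow> real^3^3"
  where "hess t x = (\<chi> i j. dx j (dx i g) (t, x))"

lemma periodic_C1_adv: "0 < t \<Longrightarrow> periodic_C1 Lx Ly (adv t) (adv_d t)"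
  unfolding adv_def adv_d_def
  by (intro periodic_C1_sum periodic_C1_mult st_field_periodic_C1[OF v] st_field_periodic_C1[OF st_field_dx[OF g]])

lemma periodic_C1_W:
  assumes t: "0 < t"
  shows "periodic_C1 Lx Ly (W t) (W_d t)"
  using periodic_C1_cmult[OF periodic_C1_add[OF st_field_periodic_C1[OF st_field_dt[OF g] t] periodic_C1_adv[OF t]], of Pe]
  by (simp add: W_def[abs_def] W_d_def[abs_def])

lemma periodic_C1_lap: "0 < t \<Longrightarrow> periodic_C1 Lx Ly (lap t) (lap_d t)"
  unfolding lap_def lap_d_def
  by (intro periodic_C1_sum st_field_periodic_C1[OF st_field_dx[OF st_field_dx[OF g]]])

lemma continuous_vel: "0 < t \<Longrightarrow> continuous_on slab (vel t)"
  unfolding vel_def by (intro continuous_intros st_field_continuous_on_slice[OF v]) simp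

lemma continuous_grad_vel: "0 < t \<Longrightarrow> continuous_on slab (grad_vel t)"
  unfolding grad_vel_def by (intro continuous_intros st_field_continuous_on_slice[OF st_field_dx[OF v]]) simp

lemma continuous_grad: "0 < t \<Longrightarrow> continuous_on slab (grad t)"
  unfolding grad_def by (intro continuous_intros st_field_continuous_on_slice[OF st_field_dx[OF g]]) simp

lemma continuous_hess: "0 < t \<Longrightarrow> continuous_on slab (hess t)"
  unfolding hess_def by (intro continuous_intros st_field_continuous_on_slice[OF st_field_dx[OF st_field_dx[OF g]]]) simp

text \<open>Tangential derivatives of \<open>g\<close> vanish on the walls, so only
  \<open>v 3\<close> times the normal derivative could survive; no-penetration removes it.\<close>

lemma W_walls:
  assumes t: "0 < t" and x: "x \<in> walls"
  shows "W t x = 0"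
proof -
  have "dt g (t, x) = 0" "dx 1 g (t, x) = 0" "dx 2 g (t, x) = 0"
    using st_field_zero_on_walls[of g, OF g_walls t x] by simp_all
  then show ?thesis using v_walls[OF t x] by (simp add: W_def adv_def sum_3)
qed

lemma continuous_on_cell_vec_of:
  assumes "periodic_C1 Lx Ly f F"
  shows "continuous_on (cell Lx Ly) (vec_of F)"
  by (intro continuous_on_cell continuous_intros periodic_C1D[OF assms])

lemma Poincare_W: "0 < t \<Longrightarrow> pi * L2n (cell Lx Ly) (W t) \<le> L2n (cell Lx Ly) (vec_of (W_d t))"
proof -
  assume t: "0 < t"
  note C = periodic_C1D[OF periodic_C1_W[OF t]]
  have "pi * L2n (cell Lx Ly) (W t) \<le> L2n (cell Lx Ly) (W_d t 3)"
    by (rule Poincare_cell[OF periodic_C1_W[OF t] W_walls[OF t]])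
  also have "\<dots> \<le> L2n (cell Lx Ly) (vec_of (W_d t))"
    unfolding cell_def
  proof (rule L2n_mono, fold cell_def)
    show "continuous_on (cell Lx Ly) (W_d t 3)" by (rule continuous_on_cell[OF C(3)])
    show "continuous_on (cell Lx Ly) (vec_of (W_d t))" by (rule continuous_on_cell_vec_of[OF periodic_C1_W[OF t]])
    show "norm (W_d t 3 x) \<le> norm (vec_of (W_d t) x)" for x
      using component_le_norm_cart[of "vec_of (W_d t) x" 3] by simp
  qed
  finally show ?thesis .
qed

text \<open>The product rule splits the gradient of \<open>adv\<close> into \<open>A\<close>, the
  velocity gradient acting on grad T, and \<open>B\<close>, the Hessian acting on the velocity.
  \<open>A\<close> is estimated by L-infinity times L2, \<open>B\<close> by L3 times L6. The bound
  \<open>M\<close> holds almost everywhere because it will come from an essential supremum.\<close>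

lemma L2n_grad_adv_le:
  assumes t: "0 < t" and M: "AE x in lebesgue_on (cell Lx Ly). norm (grad t x) \<le> M" and M0: "0 \<le> M"
  shows "L2n (cell Lx Ly) (vec_of (adv_d t)) \<le> M * L2n (cell Lx Ly) (grad_vel t) +
    root 3 (integral (cell Lx Ly) (\<lambda>x. norm (vel t x) ^ 3)) * root 6 (integral (cell Lx Ly) (\<lambda>x. norm (hess t x) ^ 6))"
proof -
  define A where "A = (\<lambda>x. (\<chi> i. \<Sum>k\<in>UNIV. grad_vel t x $ k $ i * grad t x $ k) :: real^3)"
  define B where "B = (\<lambda>x. (\<chi> i. \<Sum>k\<in>UNIV. hess t x $ k $ i * vel t x $ k) :: real^3)"
  let ?v = "vector [Lx, Ly, 1] :: real^3"
  have cs: "continuous_on slab A" "continuous_on slab B"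
    unfolding A_def B_def
    by (intro continuous_intros continuous_grad continuous_grad_vel continuous_vel continuous_hess t)+
  have c: "continuous_on (cbox 0 ?v) A" "continuous_on (cbox 0 ?v) B"
    "continuous_on (cbox 0 ?v) (vel t)" "continuous_on (cbox 0 ?v) (hess t)" "continuous_on (cbox 0 ?v) (grad_vel t)"
    using cs[THEN continuous_on_cell, of Lx Ly] continuous_vel[OF t, THEN continuous_on_cell, of Lx Ly]
      continuous_hess[OF t, THEN continuous_on_cell, of Lx Ly] continuous_grad_vel[OF t, THEN continuous_on_cell, of Lx Ly]
    by (simp_all add: cell_def)
  have eq: "vec_of (adv_d t) = (\<lambda>x. A x + B x)"
    by (simp add: fun_eq_iff vec_eq_iff A_def B_def adv_d_def grad_vel_def grad_def hess_def vel_def sum.distrib mult.commute)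
  have "L2n (cell Lx Ly) (vec_of (adv_d t)) \<le> L2n (cell Lx Ly) A + L2n (cell Lx Ly) B"
    unfolding eq cell_def by (rule L2n_triangle[OF c(1,2)])
  moreover have "L2n (cell Lx Ly) A \<le> M * L2n (cell Lx Ly) (grad_vel t)"
  proof (rule power2_le_imp_le)
    obtain N where N: "N \<in> null_sets (lebesgue_on (cell Lx Ly))"
      "{x \<in> space (lebesgue_on (cell Lx Ly)). \<not> norm (grad t x) \<le> M} \<subseteq> N"
      using M unfolding eventually_ae_filter by blast
    have Nn: "negligible N"
      using N(1) null_sets_restrict_space[of "cell Lx Ly" lebesgue]
      by (auto simp: negligible_iff_null_sets cell_def)
    have "integral (cell Lx Ly) (\<lambda>x. (norm (A x))\<^sup>2) \<le> integral (cell Lx Ly) (\<lambda>x. M\<^sup>2 * (norm (grad_vel t x))\<^sup>2)"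
    proof (rule integral_le_except_negligible[OF _ _ Nn])
      show "(\<lambda>x. (norm (A x))\<^sup>2) integrable_on cell Lx Ly"
        "(\<lambda>x. M\<^sup>2 * (norm (grad_vel t x))\<^sup>2) integrable_on cell Lx Ly"
        by (intro integrable_on_cell continuous_intros cs continuous_grad_vel t)+
      fix x assume x: "x \<in> cell Lx Ly - N"
      then have "norm (grad t x) \<le> M" using N(2) by (auto simp: space_restrict_space)
      then have "norm (A x) \<le> M * norm (grad_vel t x)"
        using norm_transpose_mult_le[of "grad_vel t x" "grad t x"] mult_left_mono[of "norm (grad t x)" M "norm (grad_vel t x)"]
        by (simp add: A_def mult.commute)
      then show "(norm (A x))\<^sup>2 \<le> M\<^sup>2 * (norm (grad_vel t x))\<^sup>2"
        by (metis norm_ge_zero power_mono power_mult_distrib)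
    qed
    then show "(L2n (cell Lx Ly) A)\<^sup>2 \<le> (M * L2n (cell Lx Ly) (grad_vel t))\<^sup>2"
      by (simp add: power_mult_distrib L2n_power2)
  qed (simp add: M0 L2n_nonneg)
  moreover have "L2n (cell Lx Ly) B \<le>
    root 3 (integral (cell Lx Ly) (\<lambda>x. norm (vel t x) ^ 3)) * root 6 (integral (cell Lx Ly) (\<lambda>x. norm (hess t x) ^ 6))"
  proof (rule power2_le_imp_le)
    have "(L2n (cell Lx Ly) B)\<^sup>2 \<le> integral (cell Lx Ly) (\<lambda>x. (norm (vel t x) * norm (hess t x))\<^sup>2)"
      unfolding L2n_power2
    proof (rule integral_le)
      show "(\<lambda>x. (norm (B x))\<^sup>2) integrable_on cell Lx Ly"
        "(\<lambda>x. (norm (vel t x) * norm (hess t x))\<^sup>2) integrable_on cell Lx Ly"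
        by (intro integrable_on_cell continuous_intros cs continuous_vel continuous_hess t)+
      show "(norm (B x))\<^sup>2 \<le> (norm (vel t x) * norm (hess t x))\<^sup>2" for x
        using norm_transpose_mult_le[of "hess t x" "vel t x"]
        by (intro power_mono) (simp_all add: B_def mult.commute)
    qed
    also have "\<dots> \<le> (root 3 (integral (cell Lx Ly) (\<lambda>x. norm (vel t x) ^ 3)) * root 6 (integral (cell Lx Ly) (\<lambda>x. norm (hess t x) ^ 6)))\<^sup>2"
      unfolding cell_def by (rule Holder_3_6) (auto intro!: continuous_intros c)
    finally show "(L2n (cell Lx Ly) B)\<^sup>2 \<le> \<dots>" .
  qed (simp add: integral_nonneg_pointwise)
  ultimately show ?thesis by simp
qed

text \<open>Neither integration by parts leaves a boundary term: the first is horizontal and uses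
  periodicity, the second is vertical and uses that the horizontal derivative of \<open>g\<close>
  vanishes on the walls.\<close>

lemma L2n_lap_xy_le:
  assumes t: "0 < t"
  shows "L2n (cell Lx Ly) (\<lambda>x. dx 1 (dx 1 g) (t, x) + dx 2 (dx 2 g) (t, x)) \<le> L2n (cell Lx Ly) (lap t)"
proof (rule power2_le_imp_le)
  let ?I = "integral (cell Lx Ly)"
  have cc: "continuous_on slab (\<lambda>x. dx i (dx j g) (t, x))" for i j
    using st_field_continuous_on_slice[OF st_field_dx[OF st_field_dx[OF g]]] t by simp
  have nn: "0 \<le> ?I (\<lambda>x. dx i (dx i g) (t, x) * dx 3 (dx 3 g) (t, x))" if i: "i \<noteq> 3" for i
  proof -
    note p1 = st_field_periodic_C1[OF st_field_dx[OF g, of i] t]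
    note p33 = st_field_periodic_C1[OF st_field_dx[OF st_field_dx[OF g, of 3], of 3] t]
    note pi3 = st_field_periodic_C1[OF st_field_dx[OF st_field_dx[OF g, of 3], of i] t]
    have "?I (\<lambda>x. dx i (dx i g) (t, x) * dx 3 (dx 3 g) (t, x)) =
        - ?I (\<lambda>x. dx i g (t, x) * dx i (dx 3 (dx 3 g)) (t, x))"
      by (rule integral_cell_by_parts[OF p1 p33 pos(1,2)]) (use i in simp)
    also have "\<dots> = - ?I (\<lambda>x. dx i g (t, x) * dx 3 (dx i (dx 3 g)) (t, x))"
      by (intro arg_cong[where f=uminus] integral_cong)
        (simp add: st_field_commute(1)[OF st_field_dx[OF g, of 3] t subsetD[OF cell_subset_slab], of _ _ _ 3 i])
    also have "\<dots> = ?I (\<lambda>x. dx 3 (dx i g) (t, x) * dx i (dx 3 g) (t, x))"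
      by (rule integral_cell_by_parts[OF p1 pi3 pos(1,2), symmetric])
        (use st_field_zero_on_walls(2)[of g, OF g_walls t _ i] in simp)
    also have "\<dots> = ?I (\<lambda>x. (dx 3 (dx i g) (t, x))\<^sup>2)"
      by (intro integral_cong)
        (simp add: st_field_commute(1)[OF g t subsetD[OF cell_subset_slab], of _ _ _ 3 i] power2_eq_square)
    finally show ?thesis by (simp add: integral_nonneg_pointwise)
  qed
  let ?h = "\<lambda>x. dx 1 (dx 1 g) (t, x) + dx 2 (dx 2 g) (t, x)"
  let ?a = "\<lambda>x. dx 1 (dx 1 g) (t, x) * dx 3 (dx 3 g) (t, x)"
  let ?b = "\<lambda>x. dx 2 (dx 2 g) (t, x) * dx 3 (dx 3 g) (t, x)"
  have "?I (\<lambda>x. (?h x)\<^sup>2) + 2 * ?I ?a + 2 * ?I ?b = ?I (\<lambda>x. (?h x)\<^sup>2 + 2 * ?a x + 2 * ?b x)"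
    by (subst integral_add, (intro integrable_on_cell continuous_intros cc)+)+ simp
  also have "\<dots> \<le> ?I (\<lambda>x. (lap t x)\<^sup>2)"
  proof (rule integral_le)
    show "(\<lambda>x. (?h x)\<^sup>2 + 2 * ?a x + 2 * ?b x) integrable_on cell Lx Ly"
      "(\<lambda>x. (lap t x)\<^sup>2) integrable_on cell Lx Ly"
      unfolding lap_def by (intro integrable_on_cell continuous_intros cc)+
    show "(?h x)\<^sup>2 + 2 * ?a x + 2 * ?b x \<le> (lap t x)\<^sup>2" for x
    proof -
      have "(lap t x)\<^sup>2 = ((?h x)\<^sup>2 + 2 * ?a x + 2 * ?b x) + (dx 3 (dx 3 g) (t, x))\<^sup>2"
        by (simp add: lap_def sum_3 power2_eq_square algebra_simps)
      then show ?thesis by simp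
    qed
  qed
  finally show "(L2n (cell Lx Ly) ?h)\<^sup>2 \<le> (L2n (cell Lx Ly) (lap t))\<^sup>2"
    using nn[of 1] nn[of 2] by (simp add: L2n_power2)
qed (rule L2n_nonneg)

end

text \<open>\<open>q\<close> stands for the C1 representative of the source; with it the heat
  equation holds everywhere on the closed slab.\<close>

locale heat_balance = advected_field +
  fixes q :: "real^3 \<Rightarrow> real" and q_d :: "3 \<Rightarrow> real^3 \<Rightarrow> real"
  assumes q: "periodic_C1 Lx Ly q q_d"
    and W_eq: "\<And>t x. 0 < t \<Longrightarrow> x \<in> slab \<Longrightarrow> W t x = lap t x + q x"
begin

text \<open>Equation \<open>W_eq\<close> can be differentiated vertically only where both sides
  agree on a neighbourhood, hence in the open slab; continuity of the derivatives gives the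
  walls.\<close>

lemma W_d_eq:
  assumes t: "0 < t" and x: "x \<in> slab"
  shows "W_d t i x = lap_d t i x + q_d i x"
proof (rule AE_continuous_imp_eq_slab[OF _ _ _ x])
  note pW = periodic_C1D[OF periodic_C1_W[OF t]]
  note pS = periodic_C1D[OF periodic_C1_add[OF periodic_C1_lap[OF t] q]]
  show "continuous_on slab (W_d t i)" "continuous_on slab (\<lambda>x. lap_d t i x + q_d i x)"
    by (rule pW pS)+
  show "AE x in lebesgue_on open_slab. W_d t i x = lap_d t i x + q_d i x"
  proof (rule AE_lebesgue_on_open_slabI)
    fix y :: "real^3" assume y: "y \<in> open_slab"
    then have ys: "y \<in> slab" using open_slab_subset_slab by blast
    have "\<forall>\<^sub>F s in nhds 0. y + s *\<^sub>R axis i 1 \<in> open_slab"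
      by (rule eventually_line_in_open[OF open_open_slab y])
    then have "\<forall>\<^sub>F s in nhds 0. W t (y + s *\<^sub>R axis i 1) = lap t (y + s *\<^sub>R axis i 1) + q (y + s *\<^sub>R axis i 1)"
      by eventually_elim (use W_eq[OF t] open_slab_subset_slab in blast)
    then have "((\<lambda>s. W t (y + s *\<^sub>R axis i 1)) has_real_derivative lap_d t i y + q_d i y) (at 0)"
      by (rule DERIV_cong_ev[OF refl _ refl, THEN iffD2, OF _ pS(4)[OF ys]])
    then show "W_d t i y = lap_d t i y + q_d i y"
      using pW(4)[OF ys] DERIV_unique by blast
  qed
qed

text \<open>The squared L2 norm of \<open>W\<close>, written through \<open>lap t x + q x\<close> so
  that differentiation in time yields \<open>lap_dt\<close> alone and no time derivative of the
  velocity.\<close>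

definition energy :: "real \<Rightarrow> real"
  where "energy t = integral (cell Lx Ly) (\<lambda>x. (lap t x + q x)\<^sup>2)"

definition energy_d :: "real \<Rightarrow> real"
  where "energy_d t = integral (cell Lx Ly) (\<lambda>x. 2 * (lap t x + q x) * lap_dt t x)"

lemma energy_eq: "0 < t \<Longrightarrow> energy t = (L2n (cell Lx Ly) (W t))\<^sup>2"
  unfolding energy_def L2n_power2
  by (rule integral_cong) (simp add: W_eq[OF _ subsetD[OF cell_subset_slab]])

lemma energy_nonneg: "0 \<le> energy t"
  unfolding energy_def by (rule integral_nonneg_pointwise) simp

lemma energy_has_derivative:
  assumes t: "0 < t"
  shows "(energy has_real_derivative energy_d t) (at t)"
proof -
  have "((\<lambda>t. integral (cbox 0 (vector [Lx, Ly, 1])) (\<lambda>x. (lap t x + q x)\<^sup>2)) has_field_derivative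
    integral (cbox 0 (vector [Lx, Ly, 1])) (\<lambda>x. 2 * (lap t x + q x) * lap_dt t x)) (at t within {0<..})"
  proof (rule leibniz_rule_field_derivative)
    fix t :: real and x :: "real^3" assume t: "t \<in> {0<..}" and x: "x \<in> cbox 0 (vector [Lx, Ly, 1])"
    then have xs: "x \<in> slab" using cell_subset_slab by (auto simp: cell_def)
    have "((\<lambda>t. lap t x) has_real_derivative lap_dt t x) (at t)"
      unfolding lap_def lap_dt_def
      by (intro DERIV_sum st_field_has_time_derivative[OF st_field_dx[OF st_field_dx[OF g]]] xs) (use t in simp)
    then have "((\<lambda>t. (lap t x + q x)\<^sup>2) has_real_derivative 2 * (lap t x + q x) * lap_dt t x) (at t)"
      by (auto intro!: derivative_eq_intros)
    then show "((\<lambda>t. (lap t x + q x)\<^sup>2) has_field_derivative 2 * (lap t x + q x) * lap_dt t x) (at t within {0<..})"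
      by (rule has_field_derivative_at_within)
  next
    fix t :: real assume t: "t \<in> {0<..}"
    show "(\<lambda>x. (lap t x + q x)\<^sup>2) integrable_on cbox 0 (vector [Lx, Ly, 1])"
      using integrable_on_cell[of "\<lambda>x. (lap t x + q x)\<^sup>2" Lx Ly] periodic_C1D(2)[OF periodic_C1_lap[of t]] t periodic_C1D(2)[OF q]
      by (simp add: cell_def continuous_intros)
  next
    let ?S = "{0<..} \<times> cbox 0 (vector [Lx, Ly, 1]) :: (real \<times> (real^3)) set"
    have sub: "?S \<subseteq> {0<..} \<times> slab" using cell_subset_slab by (auto simp: cell_def)
    have c: "continuous_on ?S h" if "st_field Lx Ly U h" for h
      by (rule continuous_on_subset[OF st_field_continuous_on[OF that] sub])
    have cq: "continuous_on ?S (\<lambda>z. q (snd z))"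
      by (rule continuous_on_compose2[OF periodic_C1D(2)[OF q]]) (use cell_subset_slab[of Lx Ly, unfolded cell_def] in \<open>auto intro!: continuous_intros\<close>)
    show "continuous_on ?S (\<lambda>(t, x). 2 * (lap t x + q x) * lap_dt t x)"
      unfolding lap_def lap_dt_def case_prod_beta prod.collapse
      by (intro continuous_intros cq c st_field_dx st_field_dt g)
  qed (use t in auto)
  then have "(energy has_field_derivative energy_d t) (at t within {0<..})"
    by (simp add: energy_def[abs_def] energy_d_def cell_def)
  then show ?thesis using at_within_open[of t "{0<..}"] t by simp
qed

lemma energy_d_le:
  assumes t: "0 < t"
  shows "energy_d t \<le> - (2 / Pe) * (L2n (cell Lx Ly) (vec_of (W_d t)))\<^sup>2 +
    2 * (L2n (cell Lx Ly) (vec_of (W_d t)) * L2n (cell Lx Ly) (vec_of (adv_d t)))"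
proof -
  let ?I = "integral (cell Lx Ly)"
  note pW = periodic_C1_W[OF t]
  note CW = periodic_C1D[OF pW]
  note CA = periodic_C1D[OF periodic_C1_adv[OF t]]
  have pg: "periodic_C1 Lx Ly (\<lambda>x. dx k (dt g) (t, x)) (\<lambda>i x. dx i (dx k (dt g)) (t, x))" for k
    by (rule st_field_periodic_C1[OF st_field_dx[OF st_field_dt[OF g]] t])
  note Cg = periodic_C1D[OF pg]
  \<comment> \<open>After the integration by parts this substitution splits the integral into the
    dissipation and the advection term.\<close>
  have dxdt: "dx k (dt g) (t, x) = W_d t k x / Pe - adv_d t k x" for k x
    using pos(3) by (simp add: W_d_def)
  have k: "?I (\<lambda>x. W t x * dx k (dx k (dt g)) (t, x)) = - ?I (\<lambda>x. W_d t k x * dx k (dt g) (t, x))" for k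
    using integral_cell_by_parts[OF pW pg pos(1,2), of k k] W_walls[OF t] by simp
  have "energy_d t = ?I (\<lambda>x. \<Sum>k\<in>UNIV. 2 * (W t x * dx k (dx k (dt g)) (t, x)))"
    unfolding energy_d_def
  proof (rule integral_cong)
    fix x assume "x \<in> cell Lx Ly"
    then have x: "x \<in> slab" using cell_subset_slab by blast
    show "2 * (lap t x + q x) * lap_dt t x = (\<Sum>k\<in>UNIV. 2 * (W t x * dx k (dx k (dt g)) (t, x)))"
      by (simp add: W_eq[OF t x] lap_dt_def st_field_dt_dx_dx[OF g t x] sum_distrib_left algebra_simps)
  qed
  also have "\<dots> = (\<Sum>k\<in>UNIV. 2 * ?I (\<lambda>x. W t x * dx k (dx k (dt g)) (t, x)))"
    by (subst integral_sum) (auto intro!: integrable_on_cell continuous_intros CW Cg)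
  also have "\<dots> = - 2 * (\<Sum>k\<in>UNIV. ?I (\<lambda>x. W_d t k x * dx k (dt g) (t, x)))"
    unfolding k by (simp add: sum_distrib_left sum_negf)
  also have "(\<Sum>k\<in>UNIV. ?I (\<lambda>x. W_d t k x * dx k (dt g) (t, x))) =
      ?I (\<lambda>x. \<Sum>k\<in>UNIV. W_d t k x * dx k (dt g) (t, x))"
    by (subst integral_sum) (auto intro!: integrable_on_cell continuous_intros CW Cg)
  also have "(\<lambda>x. \<Sum>k\<in>UNIV. W_d t k x * dx k (dt g) (t, x)) =
      (\<lambda>x. (1 / Pe) * (norm (vec_of (W_d t) x))\<^sup>2 - vec_of (W_d t) x \<bullet> vec_of (adv_d t) x)"
    unfolding dxdt power2_norm_eq_inner
    by (simp add: fun_eq_iff inner_vec_def sum_distrib_left sum_subtractf[symmetric] algebra_simps)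
  also have "?I \<dots> = (1 / Pe) * (L2n (cell Lx Ly) (vec_of (W_d t)))\<^sup>2 - ?I (\<lambda>x. vec_of (W_d t) x \<bullet> vec_of (adv_d t) x)"
    unfolding L2n_power2
    using pos by (subst integral_diff) (auto intro!: integrable_on_cell continuous_intros CW CA)
  finally have e: "energy_d t = - 2 * ((1 / Pe) * (L2n (cell Lx Ly) (vec_of (W_d t)))\<^sup>2 - ?I (\<lambda>x. vec_of (W_d t) x \<bullet> vec_of (adv_d t) x))" .
  have "?I (\<lambda>x. vec_of (W_d t) x \<bullet> vec_of (adv_d t) x) \<le> L2n (cell Lx Ly) (vec_of (W_d t)) * L2n (cell Lx Ly) (vec_of (adv_d t))"
    unfolding cell_def
    by (rule L2n_Cauchy_Schwarz; fold cell_def) (rule continuous_on_cell_vec_of[OF pW] continuous_on_cell_vec_of[OF periodic_C1_adv[OF t]])+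
  then show ?thesis unfolding e by (simp add: algebra_simps)
qed

text \<open>The Laplacian is \<open>W\<close> minus \<open>q\<close>. By Poincare the squared H1
  norm of \<open>W\<close> is at most 1/\<open>pi\<close>^2 + 1 times the squared norm of its
  gradient, which is the origin of the constant.\<close>

lemma C1n_lap_le:
  assumes t: "0 < t"
  shows "C1n Lx Ly (lap t) (lap_d t) \<le>
    sqrt (1 + pi\<^sup>2) / pi * L2n (cell Lx Ly) (vec_of (W_d t)) + C1n Lx Ly q q_d"
proof -
  note CW = periodic_C1D[OF periodic_C1_W[OF t]]
  note Cq = periodic_C1D[OF q]
  let ?N = "L2n (cell Lx Ly) (vec_of (W_d t))"
  have cW: "continuous_on (cell Lx Ly) (\<lambda>x. (W t x, vec_of (W_d t) x))"
    and cq: "continuous_on (cell Lx Ly) (\<lambda>x. (- 1) *\<^sub>R (q x, vec_of q_d x))"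
    by (intro continuous_on_cell continuous_intros CW Cq)+
  have "C1n Lx Ly (lap t) (lap_d t) =
      L2n (cell Lx Ly) (\<lambda>x. (W t x, vec_of (W_d t) x) + (- 1) *\<^sub>R (q x, vec_of q_d x))"
    unfolding C1n_def
  proof (rule L2n_cong)
    fix x assume "x \<in> cell Lx Ly"
    then have x: "x \<in> slab" using cell_subset_slab by blast
    have "(lap t x, vec_of (lap_d t) x) = (W t x, vec_of (W_d t) x) + (- 1) *\<^sub>R (q x, vec_of q_d x)"
      by (simp add: W_eq[OF t x] W_d_eq[OF t x] vec_eq_iff)
    then show "norm (lap t x, vec_of (lap_d t) x) = norm ((W t x, vec_of (W_d t) x) + (- 1) *\<^sub>R (q x, vec_of q_d x))"
      by simp
  qed
  also have "\<dots> \<le> C1n Lx Ly (W t) (W_d t) + L2n (cell Lx Ly) (\<lambda>x. (- 1) *\<^sub>R (q x, vec_of q_d x))"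
    using L2n_triangle[OF cW[unfolded cell_def] cq[unfolded cell_def]] by (simp add: C1n_def cell_def)
  also have "L2n (cell Lx Ly) (\<lambda>x. (- 1) *\<^sub>R (q x, vec_of q_d x)) = C1n Lx Ly q q_d"
    unfolding L2n_scaleR by (simp add: C1n_def)
  also have "C1n Lx Ly (W t) (W_d t) \<le> sqrt (1 + pi\<^sup>2) / pi * ?N"
  proof (rule power2_le_imp_le)
    have "(L2n (cell Lx Ly) (W t))\<^sup>2 \<le> (?N / pi)\<^sup>2"
      using Poincare_W[OF t] by (intro power_mono) (simp_all add: L2n_nonneg field_simps)
    then have "(C1n Lx Ly (W t) (W_d t))\<^sup>2 \<le> (?N / pi)\<^sup>2 + ?N\<^sup>2"
      unfolding C1n_power2[OF CW(2,3)] by simp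
    also have "\<dots> = (sqrt (1 + pi\<^sup>2) / pi * ?N)\<^sup>2"
      by (simp add: power_mult_distrib power_divide field_simps)
    finally show "(C1n Lx Ly (W t) (W_d t))\<^sup>2 \<le> (sqrt (1 + pi\<^sup>2) / pi * ?N)\<^sup>2" .
  qed (simp add: L2n_nonneg)
  finally show ?thesis by simp
qed

text \<open>
  The condition \<open>U' Pe \<surd>(1 + \<pi>\<^sup>2) < \<pi>\<close> makes the dissipation dominate as soon as the norm of \<open>W\<close> reaches \<open>m\<close>.
\<close>

lemma eventually_L2n_W_le:
  assumes K: "\<And>t. 0 < t \<Longrightarrow> L2n (cell Lx Ly) (vec_of (adv_d t)) \<le> K t * C1n Lx Ly (lap t) (lap_d t)"
    and KU: "\<forall>\<^sub>F t in at_top. K t \<le> U'" and U0: "0 \<le> U'"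
    and m: "0 < m" "U' * Pe * C1n Lx Ly q q_d < (pi - sqrt (1 + pi\<^sup>2) * U' * Pe) * m"
  shows "\<forall>\<^sub>F t in at_top. L2n (cell Lx Ly) (W t) \<le> m"
proof -
  define Hq where "Hq = C1n Lx Ly q q_d"
  define c where "c = sqrt (1 + pi\<^sup>2) / pi"
  \<comment> \<open>The slack in the hypothesis on \<open>m\<close>. Once the gradient norm
    \<open>N\<close> is at least \<open>pi * m\<close>, it bounds
    \<open>(1 - U' * c * Pe) * N - U' * Pe * Hq\<close> from below.\<close>
  define d where "d = (pi - sqrt (1 + pi\<^sup>2) * U' * Pe) * m - U' * Pe * Hq"
  have d: "d > 0" using m by (simp add: d_def Hq_def)
  have Hq0: "Hq \<ge> 0" by (simp add: Hq_def C1n_def L2n_nonneg)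
  have cpi: "pi * c = sqrt (1 + pi\<^sup>2)" by (simp add: c_def)
  have "0 \<le> U' * Pe * Hq" using U0 Hq0 pos by simp
  then have "0 < (pi - sqrt (1 + pi\<^sup>2) * U' * Pe) * m" using m(2) by (simp add: Hq_def)
  then have "0 < pi - sqrt (1 + pi\<^sup>2) * U' * Pe" using m(1) by (simp add: zero_less_mult_iff)
  then have "0 < pi * (1 - U' * c * Pe)" by (simp add: cpi[symmetric] algebra_simps)
  then have small: "0 < 1 - U' * c * Pe" by (simp add: zero_less_mult_iff)
  obtain t0 where t0: "\<And>t. t \<ge> t0 \<Longrightarrow> K t \<le> U'" using KU unfolding eventually_at_top_linorder by blast
  have "\<forall>\<^sub>F t in at_top. energy t \<le> m\<^sup>2"
  \<comment> \<open>The rate is the product of \<open>2 / Pe\<close>, the lower bound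
    \<open>pi * m\<close> for \<open>N\<close> and the lower bound \<open>d\<close> for the bracket
    multiplying \<open>N\<close>.\<close>
  proof (rule eventually_le_if_decreasing_above[where y'=energy_d and c="2 / Pe * (pi * m) * d"])
    show "(energy has_real_derivative energy_d t) (at t)" if "max t0 0 < t" for t
      using that by (intro energy_has_derivative) simp
    show "0 \<le> energy t" for t by (rule energy_nonneg)
    show "0 < 2 / Pe * (pi * m) * d" using pos m d by simp
    fix t assume t: "max t0 0 < t" and e: "m\<^sup>2 \<le> energy t"
    then have tp: "0 < t" by simp
    define N where "N = L2n (cell Lx Ly) (vec_of (W_d t))"
    define G where "G = L2n (cell Lx Ly) (vec_of (adv_d t))"
    define H where "H = C1n Lx Ly (lap t) (lap_d t)"
    have N0: "N \<ge> 0" and H0: "H \<ge> 0" by (auto simp: N_def H_def C1n_def L2n_nonneg)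
    have "m \<le> L2n (cell Lx Ly) (W t)"
      using e unfolding energy_eq[OF tp] by (rule power2_le_imp_le) (rule L2n_nonneg)
    then have "pi * m \<le> pi * L2n (cell Lx Ly) (W t)" by simp
    also have "\<dots> \<le> N" unfolding N_def by (rule Poincare_W[OF tp])
    finally have Nm: "pi * m \<le> N" .
    have "G \<le> K t * H" using K[OF tp] by (simp add: G_def H_def)
    also have "\<dots> \<le> U' * H" using t0[of t] t H0 by (intro mult_right_mono) auto
    also have "\<dots> \<le> U' * (c * N + Hq)"
      using C1n_lap_le[OF tp] U0 by (intro mult_left_mono) (simp_all add: H_def N_def c_def Hq_def)
    finally have G: "G \<le> U' * (c * N + Hq)" .
    have "d \<le> (1 - U' * c * Pe) * N - U' * Pe * Hq"
    proof -
      have "(1 - U' * c * Pe) * (pi * m) \<le> (1 - U' * c * Pe) * N"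
        using small Nm by (intro mult_left_mono) auto
      moreover have "(1 - U' * c * Pe) * (pi * m) = (pi - sqrt (1 + pi\<^sup>2) * U' * Pe) * m"
        unfolding cpi[symmetric] by (simp add: algebra_simps)
      ultimately show ?thesis by (simp add: d_def)
    qed
    then have "(pi * m) * d \<le> N * ((1 - U' * c * Pe) * N - U' * Pe * Hq)"
      using Nm N0 d m by (intro mult_mono) auto
    then have "2 / Pe * ((pi * m) * d) \<le> 2 / Pe * (N * ((1 - U' * c * Pe) * N - U' * Pe * Hq))"
      using pos by (intro mult_left_mono) auto
    also have "\<dots> = 2 / Pe * N\<^sup>2 - 2 * (N * (U' * (c * N + Hq)))"
      using pos by (simp add: power2_eq_square field_simps)
    also have "\<dots> \<le> 2 / Pe * N\<^sup>2 - 2 * (N * G)"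
      using mult_left_mono[OF G N0] by simp
    also have "\<dots> \<le> - energy_d t"
      using energy_d_le[OF tp] by (simp add: N_def G_def)
    finally show "energy_d t \<le> - (2 / Pe * (pi * m) * d)" by (simp add: mult.assoc)
  qed
  then show ?thesis
    using eventually_gt_at_top[of 0]
  proof eventually_elim
    case (elim t)
    then have "(L2n (cell Lx Ly) (W t))\<^sup>2 \<le> m\<^sup>2" by (simp add: energy_eq)
    then show ?case using m(1) power2_le_imp_le[of "L2n (cell Lx Ly) (W t)" m] by simp
  qed
qed

end

subsection \<open>The limit superior bound\<close>

lemma smooth_open_subset: "smooth_open U f \<Longrightarrow> V \<subseteq> U \<Longrightarrow> smooth_open V f"
  unfolding smooth_open_def by (meson continuous_on_subset subsetD)

lemma pd_periodic_C1: "periodic_C1 Lx Ly f F \<Longrightarrow> x \<in> slab \<Longrightarrow> pd i f x = F i x"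
  unfolding dir_deriv_def by (rule DERIV_imp_deriv) (rule periodic_C1D(4))

lemma zint_add:
  assumes "continuous_on slab f" "continuous_on slab g" "x \<in> slab"
  shows "zint (\<lambda>x. f x + g x) x = zint f x + zint g x"
proof -
  have "x $ 3 \<le> 1" using assms(3) by (simp add: slab_def)
  then have "(\<lambda>r. h (ins3 3 ((x $ 1, x $ 2), r))) integrable_on {0..x $ 3}" if "continuous_on slab h" for h :: "_ \<Rightarrow> real"
    by (intro integrable_continuous_real continuous_on_compose2[OF that])
      (auto intro!: continuous_on_compose2[OF continuous_on_ins3[of UNIV]] continuous_intros simp: ins3_3_slab)
  then show ?thesis unfolding zint_eq using assms by (intro integral_add) auto
qed

lemma laplacian_xy_zint:
  assumes g: "st_field Lx Ly U g" and t: "0 < t" and f: "\<And>x. x \<in> slab \<Longrightarrow> f x = g (t, x)" and x: "x \<in> slab"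
  shows "laplacian_xy (zint f) x = zint (\<lambda>x. dx 1 (dx 1 g) (t, x) + dx 2 (dx 2 g) (t, x)) x"
proof -
  have 1: "pd i (pd i (zint f)) x = zint (\<lambda>x. dx i (dx i g) (t, x)) x" if i: "i \<noteq> 3" for i
  proof -
    have "pd i (zint f) y = zint (\<lambda>x. dx i g (t, x)) y" if y: "y \<in> slab" for y
    proof -
      have "pd i (zint f) y = pd i (zint (\<lambda>x. g (t, x))) y"
        by (rule pd_cong_slab[OF zint_cong y i]) (use f in auto)
      also have "\<dots> = zint (\<lambda>x. dx i g (t, x)) y"
        by (rule pd_zint[OF st_field_periodic_C1[OF g t] i y])
      finally show ?thesis .
    qed
    then have "pd i (pd i (zint f)) x = pd i (zint (\<lambda>x. dx i g (t, x))) x"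
      by (rule pd_cong_slab[OF _ x i])
    also have "\<dots> = zint (\<lambda>x. dx i (dx i g) (t, x)) x"
      by (rule pd_zint[OF st_field_periodic_C1[OF st_field_dx[OF g] t] i x])
    finally show ?thesis .
  qed
  have "continuous_on slab (\<lambda>x. dx i (dx i g) (t, x))" for i
    using st_field_continuous_on_slice[OF st_field_dx[OF st_field_dx[OF g]]] t by simp
  then show ?thesis using zint_add[OF _ _ x] by (simp add: laplacian_xy_def 1)
qed

text \<open>Since \<open>c\<close> and \<open>d\<close> are positive and the sum is below a finite
  bound, both limits superior are finite, and the estimate can be made with real numbers.\<close>

lemma ennreal_mult_Limsup_add_less:
  fixes a b :: "real \<Rightarrow> real"
  assumes cd: "0 < c" "0 < d" and a: "\<And>t. 0 \<le> a t" and b: "\<And>t. 0 \<le> b t"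
    and A: "\<forall>\<^sub>F t in at_top. A t = ennreal (a t)" and B: "\<forall>\<^sub>F t in at_top. B t = ennreal (b t)"
    and fin: "ennreal c * Limsup at_top A + ennreal d * Limsup at_top B < ennreal r"
  shows "\<forall>\<^sub>F t in at_top. c * a t + d * b t \<le> r"
proof -
  have LA: "Limsup at_top A < top"
  proof (rule ccontr)
    assume "\<not> ?thesis"
    then have "Limsup at_top A = top" by (metis less_top)
    then show False using fin cd by (simp add: ennreal_mult_top)
  qed
  have LB: "Limsup at_top B < top"
  proof (rule ccontr)
    assume "\<not> ?thesis"
    then have "Limsup at_top B = top" by (metis less_top)
    then show False using fin cd by (simp add: ennreal_mult_top)
  qed
  obtain x where x: "Limsup at_top A = ennreal x" "0 \<le> x" using LA by (cases "Limsup at_top A") auto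
  obtain y where y: "Limsup at_top B = ennreal y" "0 \<le> y" using LB by (cases "Limsup at_top B") auto
  have "ennreal (c * x + d * y) < ennreal r"
    using fin cd x y by (simp add: ennreal_mult' ennreal_plus)
  then have lt: "c * x + d * y < r"
    by (rule ennreal_less_iff[THEN iffD1, rotated]) (use cd x y in simp)
  \<comment> \<open>Raising both limits superior by \<open>e\<close> uses up the slack
    exactly.\<close>
  define e where "e = (r - (c * x + d * y)) / (c + d)"
  have e: "e > 0" using lt cd by (simp add: e_def)
  have "(c + d) * e = r - (c * x + d * y)" using cd by (simp add: e_def)
  then have re: "c * (x + e) + d * (y + e) = r" by (simp add: algebra_simps)
  have "Limsup at_top A < ennreal (x + e)" "Limsup at_top B < ennreal (y + e)"
    using x y e by (simp_all add: ennreal_less_iff)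
  then have "\<forall>\<^sub>F t in at_top. A t < ennreal (x + e)" "\<forall>\<^sub>F t in at_top. B t < ennreal (y + e)"
    by (auto dest: Limsup_lessD)
  then show ?thesis using A B
  proof eventually_elim
    case (elim t)
    have "a t \<le> x + e" "b t \<le> y + e" using elim a[of t] b[of t] by (simp_all add: ennreal_less_iff)
    then have "c * a t + d * b t \<le> c * (x + e) + d * (y + e)"
      using cd by (intro add_mono mult_left_mono) auto
    then show ?case using re by simp
  qed
qed

text \<open>At each point where the equation holds, the product rule turns the divergence of uT into
  \<open>adv\<close> plus T times the divergence of u, which is zero.\<close>

lemma (in advected_field) W_minus_lap_AE:
  assumes T: "\<And>t x. 0 \<le> t \<Longrightarrow> x \<in> slab \<Longrightarrow> T t x = g (t, x)"
    and u: "\<And>t x i. 0 \<le> t \<Longrightarrow> x \<in> slab \<Longrightarrow> u t x $ i = v i (t, x)"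
    and div: "\<And>x. x \<in> open_slab \<Longrightarrow> divergence (u t) x = 0"
    and eq: "AE x in lebesgue_on open_slab.
        deriv (\<lambda>s. T s x) t + divergence (\<lambda>y. T t y *\<^sub>R u t y) x
          = 1 / Pe * laplacian (T t) x + Q x / Pe"
    and t: "0 < t"
  shows "AE x in lebesgue_on open_slab. W t x - lap t x = Q x"
  using eq AE_space
proof eventually_elim
  case (elim x)
  then have x: "x \<in> open_slab" by (simp add: space_restrict_space)
  then have xs: "x \<in> slab" using open_slab_subset_slab by blast
  have Tt: "T t y = g (t, y)" "u t y $ i = v i (t, y)" if "y \<in> open_slab" for y i
    using T u t that open_slab_subset_slab by (auto simp: subset_iff)
  have "deriv (\<lambda>s. T s x) t = dt g (t, x)"
  proof -
    have "\<forall>\<^sub>F s in nhds t. s \<in> {0<..}" using t by (intro eventually_nhds_in_open) auto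
    then have "\<forall>\<^sub>F s in nhds t. T s x = g (s, x)" by eventually_elim (use T xs in auto)
    then have "deriv (\<lambda>s. T s x) t = deriv (\<lambda>s. g (s, x)) t" by (rule deriv_cong_ev) simp
    then show ?thesis using DERIV_imp_deriv[OF st_field_has_time_derivative[OF g t xs]] by simp
  qed
  moreover have "divergence (\<lambda>y. T t y *\<^sub>R u t y) x = adv t x"
  proof -
    have "pd i (\<lambda>y. (T t y *\<^sub>R u t y) $ i) x = dx i g (t, x) * v i (t, x) + g (t, x) * dx i (v i) (t, x)" for i
    proof -
      have "pd i (\<lambda>y. (T t y *\<^sub>R u t y) $ i) x = pd i (\<lambda>y. g (t, y) * v i (t, y)) x"
        by (rule pd_cong_open_slab[OF _ x]) (simp add: Tt)
      also have "\<dots> = dx i g (t, x) * v i (t, x) + g (t, x) * dx i (v i) (t, x)"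
        by (rule pd_periodic_C1[OF periodic_C1_mult[OF st_field_periodic_C1[OF g t] st_field_periodic_C1[OF v t]] xs])
      finally show ?thesis .
    qed
    then have "divergence (\<lambda>y. T t y *\<^sub>R u t y) x =
        (\<Sum>i\<in>UNIV. v i (t, x) * dx i g (t, x)) + g (t, x) * (\<Sum>i\<in>UNIV. dx i (v i) (t, x))"
      by (simp add: divergence_def sum.distrib sum_distrib_left mult.commute)
    moreover have "(\<Sum>i\<in>UNIV. dx i (v i) (t, x)) = divergence (u t) x"
      unfolding divergence_def
      by (intro sum.cong refl)
        (simp add: pd_slice[symmetric] pd_cong_open_slab[OF Tt(2) x])
    ultimately show ?thesis using div[OF x] by (simp add: adv_def)
  qed
  moreover have "laplacian (T t) x = lap t x"
    unfolding laplacian_def lap_def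
  proof (intro sum.cong refl)
    fix i
    have "pd i (T t) y = dx i g (t, y)" if "y \<in> open_slab" for y
      using pd_cong_open_slab[OF Tt(1) that] by (simp add: pd_slice)
    then show "pd i (pd i (T t)) x = dx i (dx i g) (t, x)"
      using pd_cong_open_slab[of "pd i (T t)" "\<lambda>y. dx i g (t, y)" x i] x by (simp add: pd_slice)
  qed
  ultimately show ?case
    using elim pos(3) by (simp add: W_def field_simps)
qed

text \<open>The chosen weak derivatives of \<open>f\<close> agree almost everywhere with the
  classical derivatives of \<open>g\<close>, so the abstract constants yield estimates for the
  classical gradient and Hessian.\<close>

lemma (in advected_field) sobolev_elliptic_bounds:
  assumes C: "sobolev_elliptic_constants Lx Ly C\<^sub>S C\<^sub>i" and t: "0 < t"
    and f: "\<And>x. x \<in> slab \<Longrightarrow> f x = g (t, x)" and per: "xy_periodic Lx Ly f"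
  shows "AE x in lebesgue_on (cell Lx Ly). norm (grad t x) \<le> C\<^sub>i * C1n Lx Ly (lap t) (lap_d t)"
    and "root 6 (integral (cell Lx Ly) (\<lambda>x. norm (hess t x) ^ 6)) \<le> C\<^sub>S * C1n Lx Ly (lap t) (lap_d t)"
proof -
  have fo: "AE x in lebesgue_on open_slab. f x = g (t, x)"
    using f open_slab_subset_slab by (intro AE_lebesgue_on_open_slabI) blast
  have w1: "AE x in lebesgue_on open_slab. wpd i f x = dx i g (t, x)" for i
    by (rule wpd_AE_eq_periodic_C1[OF st_field_periodic_C1[OF g t] fo])
  have w2: "AE x in lebesgue_on open_slab. wpd j (wpd i f) x = dx j (dx i g) (t, x)" for i j
    by (rule wpd_AE_eq_periodic_C1[OF st_field_periodic_C1[OF st_field_dx[OF g] t] w1])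
  have "AE x in lebesgue_on open_slab. \<forall>i. wpd i (wpd i f) x = dx i (dx i g) (t, x)"
    by (intro eventually_all_finite w2)
  then have "AE x in lebesgue_on open_slab. wlaplacian f x = lap t x"
    by eventually_elim (simp add: wlaplacian_def lap_def)
  then have H: "H1norm Lx Ly (wlaplacian f) = ennreal (C1n Lx Ly (lap t) (lap_d t))"
    by (rule H1norm_periodic_C1[OF periodic_C1_lap[OF t]])
  have "AE x in lebesgue_on open_slab. \<forall>i. wpd i f x = dx i g (t, x)"
    by (intro eventually_all_finite w1)
  then have wg: "AE x in lebesgue_on open_slab. wgrad f x = grad t x"
    by eventually_elim (simp add: wgrad_def grad_def)
  have "AE x in lebesgue_on open_slab. \<forall>i j. wpd j (wpd i f) x = dx j (dx i g) (t, x)"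
    by (intro eventually_all_finite w2)
  then have wh: "AE x in lebesgue_on open_slab. whess f x = hess t x"
    by eventually_elim (simp add: whess_def hess_def)
  have "sobolev Lx Ly 3 f"
    by (rule sobolev_eq_on_slab[OF sobolev_st_field[OF g t] f])
  moreover have "zero_on_walls f"
    unfolding zero_on_walls_def
  proof (intro exI conjI)
    show "continuous_on slab (\<lambda>x. g (t, x))" by (rule st_field_continuous_on_slice[OF g]) (use t in simp)
    show "AE x in lebesgue_on slab. g (t, x) = f x"
      by (rule AE_I2) (simp add: space_restrict_space f)
    show "\<forall>x\<in>walls. g (t, x) = 0" using g_walls t by blast
  qed
  ultimately have bounds: "Linfnorm (lebesgue_on (cell Lx Ly)) (wgrad f) \<le> ennreal C\<^sub>i * H1norm Lx Ly (wlaplacian f)"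
    "Lnorm 6 (lebesgue_on (cell Lx Ly)) (whess f) \<le> ennreal C\<^sub>S * H1norm Lx Ly (wlaplacian f)"
    and Cpos: "0 < C\<^sub>S" "0 < C\<^sub>i"
    using C per unfolding sobolev_elliptic_constants_def periodic_H_def by blast+
  have H0: "0 \<le> C1n Lx Ly (lap t) (lap_d t)" by (simp add: C1n_def L2n_nonneg)
  show "AE x in lebesgue_on (cell Lx Ly). norm (grad t x) \<le> C\<^sub>i * C1n Lx Ly (lap t) (lap_d t)"
    using AE_cell_if_AE_open_slab[OF wg, of Lx Ly]
      esssup_AE[of "\<lambda>x. ennreal (norm (wgrad f x))" "lebesgue_on (cell Lx Ly)"]
  proof eventually_elim
    case (elim x)
    have "ennreal (norm (grad t x)) \<le> ennreal C\<^sub>i * ennreal (C1n Lx Ly (lap t) (lap_d t))"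
      using elim(2) bounds(1) unfolding H Linfnorm_def elim(1) by (rule order_trans)
    then show ?case using Cpos H0 by (simp add: ennreal_mult[symmetric] ennreal_le_iff)
  qed
  show "root 6 (integral (cell Lx Ly) (\<lambda>x. norm (hess t x) ^ 6)) \<le> C\<^sub>S * C1n Lx Ly (lap t) (lap_d t)"
    using bounds(2) Cpos H0 unfolding H Lnorm_cell[OF continuous_hess[OF t] wh]
    by (simp add: ennreal_mult[symmetric] ennreal_le_iff)
qed

theorem theorem4p4:
  fixes Lx Ly Pe C\<^sub>S C\<^sub>i :: real
    and u :: "real \<Rightarrow> real^3 \<Rightarrow> real^3"
    and T :: "real \<Rightarrow> real^3 \<Rightarrow> real"
    and Q :: "real^3 \<Rightarrow> real"
  assumes "0 < Lx" and "0 < Ly" and "0 < Pe"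
    and constants: "sobolev_elliptic_constants Lx Ly C\<^sub>S C\<^sub>i"
    and u_smooth: "\<And>i. smooth_on ({0..} \<times> slab) (\<lambda>(t, x). u t x $ i)"
    and u_periodic: "\<And>t. 0 \<le> t \<Longrightarrow> xy_periodic Lx Ly (u t)"
    and u_div_free: "\<And>t x. 0 \<le> t \<Longrightarrow> x \<in> open_slab \<Longrightarrow> divergence (u t) x = 0"
    and u_no_penetration: "\<And>t x. 0 \<le> t \<Longrightarrow> x \<in> walls \<Longrightarrow> u t x $ 3 = 0"
    and T_smooth: "smooth_on ({0..} \<times> slab) (\<lambda>(t, x). T t x)"
    and T_periodic: "\<And>t. 0 \<le> t \<Longrightarrow> xy_periodic Lx Ly (T t)"
    and T_boundary: "\<And>t x. 0 \<le> t \<Longrightarrow> x \<in> walls \<Longrightarrow> T t x = 0"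
    and T_equation: "\<And>t. 0 < t \<Longrightarrow>
      AE x in lebesgue_on open_slab.
        deriv (\<lambda>s. T s x) t + divergence (\<lambda>y. T t y *\<^sub>R u t y) x
          = 1 / Pe * laplacian (T t) x + Q x / Pe"
    and Q_H1: "periodic_H Lx Ly 1 Q"
    and small: "U_inf Lx Ly C\<^sub>S C\<^sub>i u * ennreal Pe < ennreal (pi / sqrt (1 + pi\<^sup>2))"
  shows "Limsup at_top (\<lambda>t. Linf_z_L2_xy Lx Ly (laplacian_xy (zint (T t))))
    \<le> ennreal (R2 Lx Ly Pe (enn2real (U_inf Lx Ly C\<^sub>S C\<^sub>i u)) Q)"
proof -
  have walls_slab: "x \<in> walls \<Longrightarrow> x \<in> slab" for x by (auto simp: walls_def slab_def)
  obtain U0 g where U0: "open U0" "{0..} \<times> slab \<subseteq> U0" "smooth_open U0 g"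
    and g0: "\<forall>z\<in>{0..} \<times> slab. g z = (case z of (t, x) \<Rightarrow> T t x)"
    using T_smooth unfolding smooth_on_def by blast
  have "\<forall>i. \<exists>V h. open V \<and> {0..} \<times> slab \<subseteq> V \<and> smooth_open V h \<and>
      (\<forall>z\<in>{0..} \<times> slab. h z = (case z of (t, x) \<Rightarrow> u t x $ i))"
    using u_smooth unfolding smooth_on_def by blast
  then obtain V v where V: "\<And>i. open (V i)" "\<And>i. {0..} \<times> slab \<subseteq> V i" "\<And>i. smooth_open (V i) (v i)"
    and v0: "\<And>i. \<forall>z\<in>{0..} \<times> slab. v i z = (case z of (t, x) \<Rightarrow> u t x $ i)"
    by metis
  \<comment> \<open>The extensions of the temperature and of the velocity components have different
    domains; they are restricted to a common one.\<close>
  define U where "U = U0 \<inter> (\<Inter>i. V i)"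
  have U: "open U" "{0..} \<times> slab \<subseteq> U" "U \<subseteq> U0" "\<And>i. U \<subseteq> V i"
  proof -
    show "open U" unfolding U_def by (intro open_Int open_INT U0 ballI V) simp
    show "{0..} \<times> slab \<subseteq> U" using U0(2) V(2) unfolding U_def by blast
  qed (auto simp: U_def)
  have gT: "g (t, x) = T t x" if "0 \<le> t" "x \<in> slab" for t x using g0 that by auto
  have vu: "v i (t, x) = u t x $ i" if "0 \<le> t" "x \<in> slab" for t x i using v0 that by auto
  have st_g: "st_field Lx Ly U g"
    unfolding st_field_def
    using U smooth_open_subset[OF U0(3) U(3)] T_periodic
    by (auto simp: xy_periodic_def gT slab_add_axis)
  have st_v: "st_field Lx Ly U (v i)" for i
    unfolding st_field_def
    using U smooth_open_subset[OF V(3) U(4)] u_periodic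
    by (auto simp: xy_periodic_def vu slab_add_axis)
  interpret A: advected_field Lx Ly Pe U g v
    using assms(1-3) st_g st_v T_boundary u_no_penetration
    by unfold_locales (auto simp: gT vu walls_slab)
  have AE_Q: "AE x in lebesgue_on open_slab. A.W t x - A.lap t x = Q x" if "0 < t" for t
    using A.W_minus_lap_AE[of T u t Q] gT vu u_div_free T_equation[OF that] that by simp
  \<comment> \<open>Q does not depend on time, so the equation at the single time 1 supplies a
    representative valid for all positive times.\<close>
  define q where "q x = A.W 1 x - A.lap 1 x" for x
  define q_d where "q_d i x = A.W_d 1 i x - A.lap_d 1 i x" for i x
  have q: "periodic_C1 Lx Ly q q_d"
    unfolding q_def[abs_def] q_d_def[abs_def]
    by (intro periodic_C1_diff A.periodic_C1_W A.periodic_C1_lap) simp_all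
  have Q_q: "AE x in lebesgue_on open_slab. Q x = q x"
    using AE_Q[of 1] by (simp add: q_def eq_commute)
  have W_eq: "A.W t x = A.lap t x + q x" if t: "0 < t" and x: "x \<in> slab" for t x
  proof -
    note cW = periodic_C1D(2)[OF A.periodic_C1_W[OF t]] periodic_C1D(2)[OF A.periodic_C1_lap[OF t]]
    have "AE x in lebesgue_on open_slab. A.W t x - A.lap t x = q x"
      using AE_Q[OF t] Q_q by eventually_elim simp
    then have "A.W t x - A.lap t x = q x"
      by (rule AE_continuous_imp_eq_slab[OF continuous_on_diff[OF cW] periodic_C1D(2)[OF q] _ x])
    then show ?thesis by simp
  qed
  interpret B: heat_balance Lx Ly Pe U g v q q_d
    by unfold_locales (fact q, fact W_eq)
  define Hq where "Hq = C1n Lx Ly q q_d"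
  have Hq: "H1norm Lx Ly Q = ennreal Hq" "0 \<le> Hq"
    unfolding Hq_def by (rule H1norm_periodic_C1[OF q Q_q]) (simp add: C1n_def L2n_nonneg)
  have Lq: "Lnorm 2 (lebesgue_on (cell Lx Ly)) Q = ennreal (L2n (cell Lx Ly) q)"
    by (rule Lnorm_2_cell[OF periodic_C1D(2)[OF q] Q_q])
  have C: "0 < C\<^sub>S" "0 < C\<^sub>i" using constants by (auto simp: sobolev_elliptic_constants_def)
  define a where "a t = root 3 (integral (cell Lx Ly) (\<lambda>x. norm (A.vel t x) ^ 3))" for t
  define b where "b t = L2n (cell Lx Ly) (A.grad_vel t)" for t
  have ab: "0 \<le> a t" "0 \<le> b t" for t by (simp_all add: a_def b_def L2n_nonneg integral_nonneg_pointwise)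
  have K: "L2n (cell Lx Ly) (vec_of (A.adv_d t)) \<le> (C\<^sub>S * a t + C\<^sub>i * b t) * C1n Lx Ly (A.lap t) (A.lap_d t)"
    if t: "0 < t" for t
  proof -
    have f: "T t x = g (t, x)" if "x \<in> slab" for x using gT that t by simp
    note bounds = A.sobolev_elliptic_bounds[OF constants t f T_periodic]
    have H0: "0 \<le> C1n Lx Ly (A.lap t) (A.lap_d t)" by (simp add: C1n_def L2n_nonneg)
    have "L2n (cell Lx Ly) (vec_of (A.adv_d t)) \<le> C\<^sub>i * C1n Lx Ly (A.lap t) (A.lap_d t) * b t +
      a t * root 6 (integral (cell Lx Ly) (\<lambda>x. norm (A.hess t x) ^ 6))"
      unfolding a_def b_def by (rule A.L2n_grad_adv_le[OF t bounds(1)]) (use C H0 t in auto)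
    also have "\<dots> \<le> C\<^sub>i * C1n Lx Ly (A.lap t) (A.lap_d t) * b t + a t * (C\<^sub>S * C1n Lx Ly (A.lap t) (A.lap_d t))"
      using bounds(2) ab t by (intro add_left_mono mult_left_mono) auto
    finally show ?thesis by (simp add: algebra_simps)
  qed
  have norm_u: "Lnorm 3 (lebesgue_on (cell Lx Ly)) (u t) = ennreal (a t)"
    "Lnorm 2 (lebesgue_on (cell Lx Ly)) (vgrad (u t)) = ennreal (b t)" if t: "0 < t" for t
  proof -
    have "u t x $ i = v i (t, x)" if "x \<in> open_slab" for x i
      using vu[of t x i] t that open_slab_subset_slab by auto
    then have e: "u t x = A.vel t x" "vgrad (u t) x = A.grad_vel t x" if "x \<in> open_slab" for x
      using that by (auto simp: A.vel_def A.grad_vel_def vgrad_def vec_eq_iff pd_slice[symmetric] intro!: pd_cong_open_slab)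
    show "Lnorm 3 (lebesgue_on (cell Lx Ly)) (u t) = ennreal (a t)"
      unfolding a_def by (rule Lnorm_cell[OF A.continuous_vel[OF t] AE_lebesgue_on_open_slabI]) (rule e)
    show "Lnorm 2 (lebesgue_on (cell Lx Ly)) (vgrad (u t)) = ennreal (b t)"
      unfolding b_def by (rule Lnorm_2_cell[OF A.continuous_grad_vel[OF t] AE_lebesgue_on_open_slabI]) (rule e)
  qed
  define S where "S = sqrt (1 + pi\<^sup>2)"
  have S: "S > 0" by (simp add: S_def add_pos_nonneg)
  define Ui where "Ui = enn2real (U_inf Lx Ly C\<^sub>S C\<^sub>i u)"
  \<comment> \<open>An infinite value times \<open>Pe > 0\<close> would be infinite, against
    \<open>small\<close>; hence \<open>enn2real\<close> returns the true value and not its default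
    0.\<close>
  have "U_inf Lx Ly C\<^sub>S C\<^sub>i u < top"
    using small \<open>0 < Pe\<close> by (cases "U_inf Lx Ly C\<^sub>S C\<^sub>i u") (auto simp: ennreal_top_mult)
  then have Ui: "U_inf Lx Ly C\<^sub>S C\<^sub>i u = ennreal Ui" "0 \<le> Ui"
    by (simp_all add: Ui_def)
  have "Ui * Pe < pi / S"
    using small Ui(2) \<open>0 < Pe\<close> unfolding Ui(1) S_def by (simp add: ennreal_mult[symmetric] ennreal_less_iff)
  then have den: "0 < pi - S * Ui * Pe" using S by (simp add: field_simps)
  \<comment> \<open>A limit superior bounds the velocity norms eventually only up to an arbitrarily
    small excess, hence the strict \<open>Ui < U'\<close>.\<close>
  have eventually_K: "\<forall>\<^sub>F t in at_top. C\<^sub>S * a t + C\<^sub>i * b t \<le> U'" if U': "Ui < U'" for U'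
  proof (rule ennreal_mult_Limsup_add_less[OF C ab])
    show "\<forall>\<^sub>F t in at_top. Lnorm 3 (lebesgue_on (cell Lx Ly)) (u t) = ennreal (a t)"
      "\<forall>\<^sub>F t in at_top. Lnorm 2 (lebesgue_on (cell Lx Ly)) (vgrad (u t)) = ennreal (b t)"
      by (rule eventually_mono[OF eventually_gt_at_top[of 0]], erule norm_u)+
    show "ennreal C\<^sub>S * Limsup at_top (\<lambda>t. Lnorm 3 (lebesgue_on (cell Lx Ly)) (u t)) +
        ennreal C\<^sub>i * Limsup at_top (\<lambda>t. Lnorm 2 (lebesgue_on (cell Lx Ly)) (vgrad (u t))) < ennreal U'"
      using Ui U' by (simp add: U_inf_def[symmetric] ennreal_less_iff)
  qed
  \<comment> \<open>The value of \<open>m\<close> at which the hypothesis of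
    \<open>eventually_L2n_W_le\<close> with \<open>U' = Ui\<close> becomes an equality.\<close>
  define r where "r = Ui * Pe * Hq / (pi - S * Ui * Pe)"
  have r0: "0 \<le> r" using Ui Hq den \<open>0 < Pe\<close> by (simp add: r_def)
  have R2: "R2 Lx Ly Pe Ui Q = r + L2n (cell Lx Ly) q"
    using Hq L2n_nonneg[of "cell Lx Ly" q] by (simp add: R2_def Lq r_def S_def)
  have ev: "\<forall>\<^sub>F t in at_top. L2n (cell Lx Ly) (A.W t) \<le> r + e" if e: "0 < e" for e
  proof -
    define m where "m = r + e"
    have m: "0 < m" "r < m" using r0 e by (auto simp: m_def)
    \<comment> \<open>\<open>F\<close> is the slack of that hypothesis at \<open>Ui\<close>. It is
      affine in the velocity bound with slope \<open>- D\<close>, so raising \<open>Ui\<close> by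
      \<open>F / (2 * D)\<close> spends half of it.\<close>
    define F where "F = (pi - S * Ui * Pe) * m - Ui * Pe * Hq"
    have F: "F > 0" using m(2) den by (simp add: F_def r_def field_simps)
    define D where "D = S * Pe * m + Pe * Hq"
    have D: "D > 0" using S m Hq \<open>0 < Pe\<close> by (simp add: D_def add_pos_nonneg)
    define U' where "U' = Ui + F / (2 * D)"
    have U': "Ui < U'" using F D by (simp add: U'_def)
    have "F / (2 * D) * D < F" using F D by simp
    then have "(U' - Ui) * D < F" by (simp add: U'_def)
    then have "U' * Pe * Hq < (pi - S * U' * Pe) * m"
      unfolding F_def D_def by (simp add: algebra_simps)
    then show ?thesis
      unfolding m_def[symmetric]
      by (intro B.eventually_L2n_W_le[where K="\<lambda>t. C\<^sub>S * a t + C\<^sub>i * b t" and U'=U'])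
        (use K eventually_K[OF U'] U' Ui m(1) in \<open>auto simp: S_def Hq_def\<close>)
  qed
  have bound: "Linf_z_L2_xy Lx Ly (laplacian_xy (zint (T t))) \<le> ennreal (L2n (cell Lx Ly) (A.W t) + L2n (cell Lx Ly) q)"
    if t: "0 < t" for t
  proof -
    let ?h = "\<lambda>x. dx 1 (dx 1 g) (t, x) + dx 2 (dx 2 g) (t, x)"
    have "continuous_on slab ?h"
      by (intro continuous_intros st_field_continuous_on_slice[OF st_field_dx[OF st_field_dx[OF st_g]]]) (use t in auto)
    then have "Linf_z_L2_xy Lx Ly (laplacian_xy (zint (T t))) \<le> ennreal (L2n (cell Lx Ly) ?h)"
      by (rule Linf_z_L2_xy_zint_le) (rule laplacian_xy_zint[OF st_g t], use gT t in auto)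
    also have "\<dots> \<le> ennreal (L2n (cell Lx Ly) (A.lap t))"
      by (rule ennreal_leI[OF A.L2n_lap_xy_le[OF t]])
    also have "L2n (cell Lx Ly) (A.lap t) = L2n (cell Lx Ly) (\<lambda>x. A.W t x + (- 1) *\<^sub>R q x)"
      by (rule L2n_cong) (simp add: W_eq[OF t subsetD[OF cell_subset_slab]])
    also have "ennreal \<dots> \<le> ennreal (L2n (cell Lx Ly) (A.W t) + L2n (cell Lx Ly) (\<lambda>x. (- 1) *\<^sub>R q x))"
      unfolding cell_def
      by (intro ennreal_leI L2n_triangle; fold cell_def)
        (intro continuous_on_cell continuous_intros periodic_C1D(2)[OF A.periodic_C1_W[OF t]] periodic_C1D(2)[OF q])+
    finally show ?thesis unfolding L2n_scaleR by simp
  qed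
  show ?thesis
    unfolding Ui_def[symmetric] R2
  proof (rule ennreal_le_epsilon)
    fix e :: real assume e: "0 < e"
    have "\<forall>\<^sub>F t in at_top. Linf_z_L2_xy Lx Ly (laplacian_xy (zint (T t))) \<le> ennreal (r + L2n (cell Lx Ly) q + e)"
      using ev[OF e] eventually_gt_at_top[of 0]
    proof eventually_elim
      case (elim t)
      then show ?case by (intro order_trans[OF bound] ennreal_leI) auto
    qed
    then have "Limsup at_top (\<lambda>t. Linf_z_L2_xy Lx Ly (laplacian_xy (zint (T t)))) \<le> ennreal (r + L2n (cell Lx Ly) q + e)"
      by (rule Limsup_bounded)
    also have "\<dots> = ennreal (r + L2n (cell Lx Ly) q) + ennreal e"
      using r0 e by (intro ennreal_plus) (simp_all add: L2n_nonneg)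
    finally show "Limsup at_top (\<lambda>t. Linf_z_L2_xy Lx Ly (laplacian_xy (zint (T t)))) \<le> ennreal (r + L2n (cell Lx Ly) q) + ennreal e" .
  qed
qed

end
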